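(* Let $\Omega\subset\mathbb{R}^2$ be an open, bounded domain and let $\frac23<\alpha<1$. If $v\in\mathcal{C}^{1,\alpha}(\bar\Omega)$ is a solution to $\mathcal{D}et\,\nabla^2 v=0$ in $\Omega$, then $v$ must be developable. More precisely, for all $x\in\Omega$, either $v$ is affine in a neighbourhood of $x$, or there exists a segment $l_x$ passing through $x$ and joining $\partial\Omega$ on its both ends, such that $\nabla v$ is constant on $l_x$.
   Context: For $v\in W^{1,2}_{loc}(\Omega)$, the very weak Hessian determinant is the distribution $\mathcal{D}et\,\nabla^2 v=-\frac12\,\mathrm{curl}\,\mathrm{curl}(\nabla v\otimes\nabla v)$, where for a symmetric $2\times2$ matrix field $A$ one sets $\mathrm{curl}\,\mathrm{curl}\,A=\partial_{22}A_{11}+\partial_{11}A_{22}-2\partial_{12}A_{12}$ in the sense of distributions. The equation $\mathcal{D}et\,\nabla^2 v=0$ is understood in the sense of distributions in $\Omega$. The space $\mathcal{C}^{1,\alpha}(\bar\Omega)$ consists of restrictions to $\Omega$ of functions in $\mathcal{C}^{1,\alpha}(\mathbb{R}^2)$. The term "developable" means the property spelled out in the last sentence of the claim. *)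

theory Defs
  imports "HOL-Analysis.Analysis"
begin

subsection \<open>Classical derivatives\<close>

definition partial_deriv :: "'n::finite \<Rightarrow> (real^'n \<Rightarrow> real) \<Rightarrow> real^'n \<Rightarrow> real" where
  "partial_deriv i f x = frechet_derivative f (at x) (axis i 1)"

definition grad :: "(real^'n::finite \<Rightarrow> real) \<Rightarrow> real^'n \<Rightarrow> real^'n" where
  "grad f x = (\<chi> i. partial_deriv i f x)"

primrec Ck :: "nat \<Rightarrow> (real^'n::finite \<Rightarrow> real) \<Rightarrow> bool" where
  "Ck 0 f \<longleftrightarrow> continuous_on UNIV f"
| "Ck (Suc k) f \<longleftrightarrow> (\<forall>x. f differentiable (at x)) \<and> (\<forall>i. Ck k (partial_deriv i f))"

text \<open>Elements of $C^\infty_c(\Omega)$ are represented by their extensions by zero to the whole space.\<close>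

definition test_functions :: "(real^'n::finite) set \<Rightarrow> (real^'n \<Rightarrow> real) set" where
  "test_functions \<Omega> =
     {\<phi>. (\<forall>k. Ck k \<phi>) \<and> compact (closure {x. \<phi> x \<noteq> 0}) \<and> closure {x. \<phi> x \<noteq> 0} \<subseteq> \<Omega>}"

subsection \<open>Hoelder spaces\<close>

text \<open>The Banach space $C^{1,\alpha}$ of the whole space, i.e. the functions with finite norm:
  function and gradient are bounded, the gradient is globally Hoelder. Continuity of the gradient
  is implied when \<open>\<alpha> > 0\<close>.\<close>

definition C1_holder :: "real \<Rightarrow> (real^'n::finite \<Rightarrow> real) set" where
  "C1_holder \<alpha> =
     {f. (\<forall>x. f differentiable (at x)) \<and> bounded (range f) \<and> bounded (range (grad f)) \<and>
         (\<exists>C. \<forall>x y. norm (grad f x - grad f y) \<le> C * norm (x - y) powr \<alpha>)}"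

text \<open>The space $C^{1,\alpha}(\bar\Omega)$ of restrictions to \<open>\<Omega>\<close>. Members are total functions
  whose values outside \<open>\<Omega>\<close> are irrelevant.\<close>

definition C1_holder_closure :: "real \<Rightarrow> (real^'n::finite) set \<Rightarrow> (real^'n \<Rightarrow> real) set" where
  "C1_holder_closure \<alpha> \<Omega> = {v. \<exists>V\<in>C1_holder \<alpha>. \<forall>x\<in>\<Omega>. v x = V x}"

subsection \<open>Distributions\<close>

text \<open>Distributions on \<open>\<Omega>\<close> are handled as functionals whose values matter on
  \<open>test_functions \<Omega>\<close> only.\<close>

type_synonym 'n distr = "(real^'n \<Rightarrow> real) \<Rightarrow> real"

definition regular_distr :: "(real^'n::finite) set \<Rightarrow> (real^'n \<Rightarrow> real) \<Rightarrow> 'n distr" where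
  "regular_distr \<Omega> f = (\<lambda>\<phi>. LINT x:\<Omega>|lebesgue. f x * \<phi> x)"

definition distr_deriv :: "'n::finite \<Rightarrow> 'n distr \<Rightarrow> 'n distr" where
  "distr_deriv i T = (\<lambda>\<phi>. - T (partial_deriv i \<phi>))"

definition distr_eq :: "(real^'n::finite) set \<Rightarrow> 'n distr \<Rightarrow> 'n distr \<Rightarrow> bool" where
  "distr_eq \<Omega> S T \<longleftrightarrow> (\<forall>\<phi>\<in>test_functions \<Omega>. S \<phi> = T \<phi>)"

definition L2_loc :: "(real^'n::finite) set \<Rightarrow> (real^'n \<Rightarrow> real) set" where
  "L2_loc \<Omega> = {f. \<forall>K. compact K \<and> K \<subseteq> \<Omega> \<longrightarrow>
     set_borel_measurable lebesgue K f \<and> set_integrable lebesgue K (\<lambda>x. (f x)\<^sup>2)}"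

definition is_weak_grad :: "(real^'n::finite) set \<Rightarrow> (real^'n \<Rightarrow> real) \<Rightarrow> (real^'n \<Rightarrow> real^'n) \<Rightarrow> bool" where
  "is_weak_grad \<Omega> v g \<longleftrightarrow>
     (\<forall>i. (\<lambda>x. g x $ i) \<in> L2_loc \<Omega> \<and>
          distr_eq \<Omega> (distr_deriv i (regular_distr \<Omega> v)) (regular_distr \<Omega> (\<lambda>x. g x $ i)))"

definition W12_loc :: "(real^'n::finite) set \<Rightarrow> (real^'n \<Rightarrow> real) set" where
  "W12_loc \<Omega> = {v \<in> L2_loc \<Omega>. \<exists>g. is_weak_grad \<Omega> v g}"

text \<open>For \<open>v \<in> W12_loc \<Omega>\<close> and open \<open>\<Omega>\<close> the weak gradient is unique almost everywhere in \<open>\<Omega>\<close>,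
  so the choice does not affect the integrals below.\<close>

definition weak_grad :: "(real^'n::finite) set \<Rightarrow> (real^'n \<Rightarrow> real) \<Rightarrow> real^'n \<Rightarrow> real^'n" where
  "weak_grad \<Omega> v = (SOME g. is_weak_grad \<Omega> v g)"

subsection \<open>The very weak Hessian determinant\<close>

definition tensor :: "real^2 \<Rightarrow> real^2 \<Rightarrow> real^2^2" where
  "tensor a b = (\<chi> i j. a $ i * b $ j)"

definition curl_curl :: "(real^2) set \<Rightarrow> (real^2 \<Rightarrow> real^2^2) \<Rightarrow> 2 distr" where
  "curl_curl \<Omega> A = (\<lambda>\<phi>.
       distr_deriv 2 (distr_deriv 2 (regular_distr \<Omega> (\<lambda>x. A x $ 1 $ 1))) \<phi>
     + distr_deriv 1 (distr_deriv 1 (regular_distr \<Omega> (\<lambda>x. A x $ 2 $ 2))) \<phi>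
     - 2 * distr_deriv 1 (distr_deriv 2 (regular_distr \<Omega> (\<lambda>x. A x $ 1 $ 2))) \<phi>)"

text \<open>Meaningful for \<open>v \<in> W12_loc \<Omega>\<close>.\<close>

definition very_weak_det_hessian :: "(real^2) set \<Rightarrow> (real^2 \<Rightarrow> real) \<Rightarrow> 2 distr" where
  "very_weak_det_hessian \<Omega> v =
     (\<lambda>\<phi>. - (1/2) * curl_curl \<Omega> (\<lambda>x. tensor (weak_grad \<Omega> v x) (weak_grad \<Omega> v x)) \<phi>)"

subsection \<open>Developability\<close>

definition affine_near :: "(real^'n::finite \<Rightarrow> real) \<Rightarrow> (real^'n) set \<Rightarrow> real^'n \<Rightarrow> bool" where
  "affine_near v \<Omega> x \<longleftrightarrow>
     (\<exists>U. open U \<and> x \<in> U \<and> U \<subseteq> \<Omega> \<and> (\<exists>a b. \<forall>y\<in>U. v y = a \<bullet> y + b))"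

text \<open>The segment runs inside \<open>\<Omega>\<close> and only its end points \<open>p\<close>, \<open>q\<close> lie on the boundary, where
  \<open>v\<close> itself carries no information; hence the open segment.\<close>

definition developable_on :: "(real^2) set \<Rightarrow> (real^2 \<Rightarrow> real) \<Rightarrow> bool" where
  "developable_on \<Omega> v \<longleftrightarrow>
     (\<forall>x\<in>\<Omega>. affine_near v \<Omega> x \<or>
        (\<exists>p q. p \<in> frontier \<Omega> \<and> q \<in> frontier \<Omega> \<and> x \<in> open_segment p q \<and>
               open_segment p q \<subseteq> \<Omega> \<and> grad v constant_on open_segment p q))"

end

theory Submission
  imports Defs
begin

text \<open>Let \<open>u = \<nabla>V\<close> for a \<open>C\<^sup>1\<^sup>,\<^sup>\<alpha>\<close> extension \<open>V\<close> of \<open>v\<close>. Mollifying at scale \<open>t\<close>, the commutator estimate bounds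
  the determinant of the mollified Hessian by the divergence of a field of size \<open>t\<^sup>2\<^sup>\<alpha>\<^sup>-\<^sup>1\<close>, while the mollified
  Hessian has size \<open>t\<^sup>\<alpha>\<^sup>-\<^sup>1\<close>. Since \<open>3 \<alpha> - 2 > 0\<close>, integral identities that hold for smooth functions with
  vanishing Hessian determinant pass to the limit. Testing with powers of positive parts gives a maximum principle
  for \<open>u\<close> on half planes, so every component of a level set of \<open>u\<close> reaches the boundary; together with planar
  separation arguments this makes the level sets locally convex. A level set without interior is then locally a
  segment, which extends up to the boundary of the domain.\<close>

section \<open>Calculus in the plane\<close>

text \<open>The Hessian of \<open>V\<close> is no function here, so an identity survives the limit
  only if Hessian entries enter it through their determinant alone. Cutoffs in position times
  cutoffs in the gradient, which are the natural test objects, produce a term linear in the Hessian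
  that does not become small. It is cancelled by a rotated gradient field, which is divergence free
  because third derivatives commute: differentiating its scalar weight returns the same linear term
  with the opposite sign, plus a multiple of the determinant. The device is used twice: with the
  gradient of \<open>u \<bullet> e\<close> for a fixed direction, and with the gradient of
  \<open>z \<bullet> u z - V z\<close>, which is the Hessian applied to the position
  \<open>z\<close>. The second obstacle is that nothing is known about the shape of level sets,
  which need not be curves. The geometry therefore uses only connected components in closed discs:
  convexity comes from separating the plane, and then comparison with nearby level sets shows that
  each component is spanned by its points on the circle. A boundary point of a level set at the
  centre of a disc thus carries a whole diameter.\<close>

definition has_grad2 :: "(real^2 \<Rightarrow> real) \<Rightarrow> real \<Rightarrow> real \<Rightarrow> real^2 \<Rightarrow> bool" where
  "has_grad2 f a b x \<longleftrightarrow> (f has_derivative (\<lambda>h. a * h $ 1 + b * h $ 2)) (at x)"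

lemma has_grad2_eq: "has_grad2 f a b x \<Longrightarrow> a = a' \<Longrightarrow> b = b' \<Longrightarrow> has_grad2 f a' b' x"
  by simp

lemma has_grad2_const: "has_grad2 (\<lambda>_. c) 0 0 x"
  by (simp add: has_grad2_def)

lemma has_grad2_coord1: "has_grad2 (\<lambda>x. x $ 1) 1 0 x"
  by (simp add: has_grad2_def bounded_linear_imp_has_derivative bounded_linear_vec_nth)

lemma has_grad2_coord2: "has_grad2 (\<lambda>x. x $ 2) 0 1 x"
  by (simp add: has_grad2_def bounded_linear_imp_has_derivative bounded_linear_vec_nth)

lemma has_grad2_add:
  assumes "has_grad2 f a b x" "has_grad2 g c d x"
  shows "has_grad2 (\<lambda>x. f x + g x) (a + c) (b + d) x"
  using has_derivative_add[OF assms[unfolded has_grad2_def]]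
  by (simp add: has_grad2_def algebra_simps)

lemma has_grad2_diff:
  assumes "has_grad2 f a b x" "has_grad2 g c d x"
  shows "has_grad2 (\<lambda>x. f x - g x) (a - c) (b - d) x"
  using has_derivative_diff[OF assms[unfolded has_grad2_def]]
  by (simp add: has_grad2_def algebra_simps)

lemma has_grad2_mult:
  assumes "has_grad2 f a b x" "has_grad2 g c d x"
  shows "has_grad2 (\<lambda>x. f x * g x) (a * g x + f x * c) (b * g x + f x * d) x"
  using has_derivative_mult[OF assms[unfolded has_grad2_def]]
  by (simp add: has_grad2_def algebra_simps)

lemma has_grad2_cmult:
  "has_grad2 f a b x \<Longrightarrow> has_grad2 (\<lambda>x. c * f x) (c * a) (c * b) x"
  using has_grad2_mult[OF has_grad2_const] by simp

lemma has_grad2_chain: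
  assumes "(A has_real_derivative A') (at (f x))" "has_grad2 f a b x"
  shows "has_grad2 (\<lambda>x. A (f x)) (A' * a) (A' * b) x"
  using has_derivative_compose[OF assms(2)[unfolded has_grad2_def], of A "\<lambda>y. y * A'"]
    assms(1)[unfolded has_field_derivative_def]
  by (simp add: has_grad2_def algebra_simps mult_commute_abs)

lemma has_grad2_unique:
  assumes "has_grad2 f a b x" "has_grad2 f c d x"
  shows "a = c" "b = d"
proof -
  have "(\<lambda>h::real^2. a * h $ 1 + b * h $ 2) = (\<lambda>h. c * h $ 1 + d * h $ 2)"
    using has_derivative_unique[OF assms[unfolded has_grad2_def]] .
  from fun_cong[OF this, of "axis 1 1"] fun_cong[OF this, of "axis 2 1"]
  show "a = c" "b = d" by (auto simp: axis_def)
qed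

lemma has_grad2_cong:
  assumes "has_grad2 f a b x" "open S" "x \<in> S" "\<And>y. y \<in> S \<Longrightarrow> f y = g y"
  shows "has_grad2 g a b x"
  using has_derivative_transform_within_open[of f _ x UNIV S g] assms by (simp add: has_grad2_def)

lemma has_grad2_isCont: "has_grad2 f a b x \<Longrightarrow> isCont f x"
  unfolding has_grad2_def by (rule has_derivative_continuous)

lemma has_grad2_continuous_on:
  "(\<And>x. x \<in> S \<Longrightarrow> has_grad2 f (f1 x) (f2 x) x) \<Longrightarrow> continuous_on S f"
  by (meson continuous_at_imp_continuous_on has_grad2_isCont)

lemma has_grad2_partial_deriv:
  assumes "has_grad2 f a b x"
  shows "partial_deriv 1 f x = a" "partial_deriv 2 f x = b"
  using frechet_derivative_at[OF assms[unfolded has_grad2_def], symmetric]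
  by (auto simp: partial_deriv_def axis_def)

lemma has_grad2_differentiable: "has_grad2 f a b x \<Longrightarrow> f differentiable (at x)"
  by (auto simp: has_grad2_def differentiable_def)

lemma has_grad2_line:
  assumes "has_grad2 f a b (y + t *\<^sub>R d)"
  shows "((\<lambda>t. f (y + t *\<^sub>R d)) has_real_derivative (a * d $ 1 + b * d $ 2)) (at t)"
proof -
  have "((\<lambda>t. y + t *\<^sub>R d) has_derivative (\<lambda>h. h *\<^sub>R d)) (at t)"
    by (auto intro!: derivative_eq_intros)
  from has_derivative_compose[OF this assms[unfolded has_grad2_def]]
  show ?thesis
    unfolding has_field_derivative_def by (rule has_derivative_eq_rhs) (auto simp: algebra_simps)
qed

lemma has_grad2_reflect:
  assumes "has_grad2 k a b (x - y)"
  shows "has_grad2 (\<lambda>y. k (x - y)) (- a) (- b) y"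
proof -
  have "((\<lambda>y. x - y) has_derivative (\<lambda>h. - h)) (at y)"
    by (auto intro!: derivative_eq_intros)
  from has_derivative_compose[OF this assms[unfolded has_grad2_def]]
  show ?thesis by (simp add: has_grad2_def algebra_simps)
qed

lemma has_grad2_shift:
  assumes "has_grad2 k a b (x - y)"
  shows "has_grad2 (\<lambda>x. k (x - y)) a b x"
proof -
  have "((\<lambda>x. x - y) has_derivative (\<lambda>h. h)) (at x)"
    by (auto intro!: derivative_eq_intros)
  from has_derivative_compose[OF this assms[unfolded has_grad2_def]]
  show ?thesis by (simp add: has_grad2_def)
qed

text \<open>From the second power on, a positive part is continuously differentiable across 0, where
  the difference quotient is at most \<open>\<bar>h\<bar> ^ (n - 1)\<close>. Cutoffs can therefore
  be built from positive parts without smoothing them.\<close>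

lemma pos_power_deriv:
  assumes "n \<ge> 2"
  shows "((\<lambda>t::real. max 0 t ^ n) has_real_derivative (real n * max 0 t ^ (n - 1))) (at t)"
proof -
  consider "t < 0" | "t = 0" | "t > 0" by linarith
  then show ?thesis
  proof cases
    case 1
    have "((\<lambda>t::real. 0) has_real_derivative 0) (at t)" by simp
    then have "((\<lambda>t::real. max 0 t ^ n) has_real_derivative 0) (at t)"
      by (rule has_field_derivative_transform_within_open[where S="{..<0}"])
         (use 1 assms in auto)
    then show ?thesis using 1 assms by (simp add: max_absorb1 zero_power)
  next
    case 2
    have "((\<lambda>h::real. (max 0 h ^ n) / h) \<longlongrightarrow> 0) (at 0)"
    proof (rule Lim_null_comparison[where g="\<lambda>h. \<bar>h\<bar> ^ (n - 1)"])
      have "norm (max 0 h ^ n / h) \<le> \<bar>h\<bar> ^ (n - 1)" for h :: real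
        using assms by (cases n) (auto simp: max_def)
      then show "\<forall>\<^sub>F h in at 0. norm (max 0 h ^ n / h) \<le> \<bar>h\<bar> ^ (n - 1)" for h :: real
        by simp
      have "((\<lambda>h::real. \<bar>h\<bar> ^ (n - 1)) \<longlongrightarrow> \<bar>0\<bar> ^ (n - 1)) (at 0)"
        by (intro tendsto_intros)
      moreover have "\<bar>0::real\<bar> ^ (n - 1) = 0" using assms by (simp add: zero_power)
      ultimately show "((\<lambda>h::real. \<bar>h\<bar> ^ (n - 1)) \<longlongrightarrow> 0) (at 0)" by (simp only:)
    qed
    moreover obtain m where "n = Suc (Suc m)" using assms by (metis add_2_eq_Suc le_Suc_ex)
    ultimately show ?thesis using 2 by (simp add: DERIV_def)
  next
    case 3
    have "((\<lambda>t::real. t ^ n) has_real_derivative (real n * t ^ (n - 1))) (at t)"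
      using DERIV_pow[of n t] by simp
    then have "((\<lambda>t::real. max 0 t ^ n) has_real_derivative (real n * t ^ (n - 1))) (at t)"
      by (rule has_field_derivative_transform_within_open[where S="{0<..}"])
         (use 3 assms in auto)
    then show ?thesis using 3 by (simp add: max_def)
  qed
qed

section \<open>Extension by zero and integration by parts\<close>

text \<open>The approximating fields are controlled only near \<open>U\<close>. Integrals are taken
  over a box after replacing the integrand by 0 outside \<open>U\<close>; a compact support inside
  \<open>U\<close> keeps this as regular as the integrand.\<close>

definition zext :: "'a set \<Rightarrow> ('a \<Rightarrow> real) \<Rightarrow> 'a \<Rightarrow> real" where
  "zext U f x = (if x \<in> U then f x else 0)"

lemma continuous_on_zext:
  fixes U :: "'a::t2_space set"
  assumes "open U" "compact K" "K \<subseteq> U" "continuous_on U f" "\<And>x. x \<in> U - K \<Longrightarrow> f x = 0"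
  shows "continuous_on S (zext U f)"
proof -
  have "continuous_on (U \<union> - K) (zext U f)"
  proof (rule continuous_on_open_Un)
    show "continuous_on U (zext U f)"
      using assms(4) by (rule continuous_on_eq) (simp add: zext_def)
    show "continuous_on (- K) (zext U f)"
      by (rule continuous_on_eq[of _ "\<lambda>_. 0"]) (use assms in \<open>auto simp: zext_def\<close>)
  qed (use assms compact_imp_closed in auto)
  moreover have "U \<union> - K = UNIV" using assms by auto
  ultimately show ?thesis by (metis continuous_on_subset top_greatest)
qed

text \<open>Off \<open>K\<close> the extension is locally zero, so uniqueness of the gradient makes
  \<open>f1\<close> and \<open>f2\<close> vanish on \<open>U - K\<close> too. This is what lets the
  derivatives be extended by zero in turn.\<close>

lemma has_grad2_zext:
  assumes "open U" "compact K" "K \<subseteq> U" "\<And>x. x \<in> U \<Longrightarrow> has_grad2 f (f1 x) (f2 x) x"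
    "\<And>x. x \<in> U - K \<Longrightarrow> f x = 0"
  shows "has_grad2 (zext U f) (zext U f1 x) (zext U f2 x) x"
    "x \<in> U - K \<Longrightarrow> f1 x = 0" "x \<in> U - K \<Longrightarrow> f2 x = 0"
proof -
  have "open (- K)" using assms(2) compact_imp_closed by blast
  have z: "has_grad2 (zext U f) 0 0 x" if "x \<notin> K" for x
    by (rule has_grad2_cong[OF has_grad2_const[of 0] \<open>open (-K)\<close>])
       (use that assms in \<open>auto simp: zext_def\<close>)
  have i: "has_grad2 (zext U f) (f1 x) (f2 x) x" if "x \<in> U" for x
    by (rule has_grad2_cong[OF assms(4)[OF that] \<open>open U\<close>])
       (use that assms in \<open>auto simp: zext_def\<close>)
  show "x \<in> U - K \<Longrightarrow> f1 x = 0" "x \<in> U - K \<Longrightarrow> f2 x = 0"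
    using has_grad2_unique[OF z i] by auto
  show "has_grad2 (zext U f) (zext U f1 x) (zext U f2 x) x"
    using z[of x] i[of x] assms(3) by (auto simp: zext_def)
qed

lemma integral_cbox_support:
  fixes f :: "'a::euclidean_space \<Rightarrow> real"
  assumes "\<And>x. x \<notin> K \<Longrightarrow> f x = 0" "K \<subseteq> cbox a b" "K \<subseteq> cbox c d"
  shows "integral (cbox a b) f = integral (cbox c d) f"
proof -
  have "integral (cbox a b) f = integral UNIV f" if "K \<subseteq> cbox a b" for a b
  proof -
    have "integral (cbox a b) f = integral UNIV (\<lambda>x. if x \<in> cbox a b then f x else 0)"
      by (simp add: integral_restrict_UNIV)
    also have "(\<lambda>x. if x \<in> cbox a b then f x else 0) = f"
      using assms(1) that by (auto simp: fun_eq_iff)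
    finally show ?thesis .
  qed
  from this[OF assms(2)] this[OF assms(3)] show ?thesis by simp
qed

text \<open>For small \<open>t\<close> the translate of \<open>F\<close> by
  \<open>t *\<^sub>R e\<close> is still supported in the box, so its integral does not depend on
  \<open>t\<close>. Differentiating under the integral at \<open>t = 0\<close> gives the claim for
  any direction, without iterated integrals.\<close>

lemma integral_directional_derivative_zero:
  fixes F :: "real^2 \<Rightarrow> real" and e :: "real^2"
  assumes "compact K" "K \<subseteq> box l r" "\<And>x. x \<notin> K \<Longrightarrow> F x = 0"
    and g: "\<And>x. has_grad2 F (F1 x) (F2 x) x"
    and c: "continuous_on UNIV F1" "continuous_on UNIV F2"
  shows "integral (cbox l r) (\<lambda>x. F1 x * e $ 1 + F2 x * e $ 2) = 0"
proof (cases "K = {}")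
  case True
  then have "F = (\<lambda>_. 0)" using assms(3) by auto
  then have "has_grad2 F 0 0 x" for x by (simp add: has_grad2_const)
  from has_grad2_unique[OF this g] show ?thesis by (simp flip: \<open>\<And>x. 0 = F1 x\<close> \<open>\<And>x. 0 = F2 x\<close>)
next
  case False
  obtain \<kappa> where \<kappa>: "\<kappa> > 0" "\<And>x y. x \<in> K \<Longrightarrow> y \<notin> box l r \<Longrightarrow> \<kappa> \<le> dist x y"
    using separate_compact_closed[OF assms(1), of "- box l r"] assms(2)
    by (metis Compl_iff closed_Compl disjoint_eq_subset_Compl double_compl open_box)
  \<comment> \<open>\<open>\<kappa>\<close> is a lower bound for the distance from \<open>K\<close>
    to the outside of the box, and shifts up to \<open>t0\<close> move points by less than that; the
    summand 1 covers \<open>e = 0\<close>.\<close>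
  define t0 where "t0 = \<kappa> / (norm e + 1) / 2"
  have t0: "t0 > 0" using \<kappa> by (simp add: t0_def add_nonneg_pos)
  have small: "norm (t *\<^sub>R e) < \<kappa>" if "\<bar>t\<bar> \<le> t0" for t
  proof -
    have "norm (t *\<^sub>R e) \<le> t0 * (norm e + 1)"
      using that by (simp add: mult_mono)
    also have "\<dots> = \<kappa> / 2"
      using norm_ge_zero[of e] by (simp add: t0_def field_simps del: norm_ge_zero)
    finally show ?thesis using \<kappa> by simp
  qed
  define \<Phi> where "\<Phi> t = integral (cbox l r) (\<lambda>x. F (x + t *\<^sub>R e))" for t
  have Fc: "continuous_on UNIV F" using g by (rule has_grad2_continuous_on)
  have const: "\<Phi> t = integral (cbox l r) F" if "\<bar>t\<bar> \<le> t0" for t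
  proof -
    have i: "(F has_integral integral (cbox (l + t *\<^sub>R e) (r + t *\<^sub>R e)) F) (cbox (l + t *\<^sub>R e) (r + t *\<^sub>R e))"
      by (meson Fc continuous_on_subset integrable_continuous integrable_integral top_greatest)
    have "((\<lambda>x. F (1 *\<^sub>R x + t *\<^sub>R e)) has_integral integral (cbox (l + t *\<^sub>R e) (r + t *\<^sub>R e)) F /\<^sub>R 1 ^ DIM(real^2)) (cbox ((l + t *\<^sub>R e - t *\<^sub>R e) /\<^sub>R 1) ((r + t *\<^sub>R e - t *\<^sub>R e) /\<^sub>R 1))"
      using has_integral_affinity'[OF i, of 1 "t *\<^sub>R e"] by simp
    then have "\<Phi> t = integral (cbox (l + t *\<^sub>R e) (r + t *\<^sub>R e)) F"
      by (simp add: \<Phi>_def integral_unique)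
    also have "\<dots> = integral (cbox l r) F"
    proof (rule integral_cbox_support[where K=K])
      show "K \<subseteq> cbox (l + t *\<^sub>R e) (r + t *\<^sub>R e)"
      proof
        fix x assume "x \<in> K"
        have "x - t *\<^sub>R e \<in> box l r"
          using \<kappa>(2)[OF \<open>x \<in> K\<close>, of "x - t *\<^sub>R e"] small[OF that] by (force simp: dist_norm)
        then show "x \<in> cbox (l + t *\<^sub>R e) (r + t *\<^sub>R e)"
          unfolding mem_box inner_add_left inner_diff_left
          by (meson diff_less_eq less_diff_eq less_imp_le)
      qed
    qed (use assms(2,3) box_subset_cbox[of l r] in auto)
    finally show ?thesis .
  qed
  have "(\<Phi> has_vector_derivative integral (cbox l r) (\<lambda>x. F1 (x + 0 *\<^sub>R e) * e $ 1 + F2 (x + 0 *\<^sub>R e) * e $ 2)) (at 0 within {-t0..t0})"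
    unfolding \<Phi>_def
  proof (rule leibniz_rule_vector_derivative[where fx="\<lambda>t x. F1 (x + t *\<^sub>R e) * e $ 1 + F2 (x + t *\<^sub>R e) * e $ 2"])
    fix t x
    show "((\<lambda>t. F (x + t *\<^sub>R e)) has_vector_derivative F1 (x + t *\<^sub>R e) * e $ 1 + F2 (x + t *\<^sub>R e) * e $ 2) (at t within {-t0..t0})"
      by (rule has_vector_derivative_at_within)
         (rule has_grad2_line[OF g, unfolded has_real_derivative_iff_has_vector_derivative])
  next
    fix t
    show "(\<lambda>x. F (x + t *\<^sub>R e)) integrable_on cbox l r"
      by (intro integrable_continuous continuous_on_compose2[OF Fc] continuous_intros) auto
  next
    show "continuous_on ({-t0..t0} \<times> cbox l r) (\<lambda>(t, x). F1 (x + t *\<^sub>R e) * e $ 1 + F2 (x + t *\<^sub>R e) * e $ 2)"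
      unfolding split_beta
      by (intro continuous_intros continuous_on_compose2[OF c(1)] continuous_on_compose2[OF c(2)]) auto
  qed (use t0 in auto)
  moreover have "(\<Phi> has_vector_derivative 0) (at 0 within {-t0..t0})"
    by (rule has_vector_derivative_transform[where f="\<lambda>_. integral (cbox l r) F"])
       (use t0 const in auto)
  ultimately have "integral (cbox l r) (\<lambda>x. F1 (x + 0 *\<^sub>R e) * e $ 1 + F2 (x + 0 *\<^sub>R e) * e $ 2) = 0"
    using t0 by (intro vector_derivative_unique_within_closed_interval[of "-t0" t0 0 \<Phi>]) auto
  then show ?thesis by simp
qed

lemma integral_zext_grad_zero:
  fixes f :: "real^2 \<Rightarrow> real"
  assumes "open U" "compact K" "K \<subseteq> U" "K \<subseteq> box l r" 
    and "\<And>x. x \<in> U \<Longrightarrow> has_grad2 f (f1 x) (f2 x) x"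
    and "continuous_on U f1" "continuous_on U f2" "\<And>x. x \<in> U - K \<Longrightarrow> f x = 0"
  shows "integral (cbox l r) (zext U f1) = 0" "integral (cbox l r) (zext U f2) = 0"
proof -
  note z = has_grad2_zext[OF assms(1,2,3,5,8)]
  note D = integral_directional_derivative_zero[OF assms(2,4) _ z(1)
      continuous_on_zext[OF assms(1-3,6) z(2)] continuous_on_zext[OF assms(1-3,7) z(3)]]
  have 0: "zext U f x = 0" if "x \<notin> K" for x using that assms(8) by (auto simp: zext_def)
  show "integral (cbox l r) (zext U f1) = 0"
    using D[of "axis 1 1 :: real^2"] 0 by (simp add: axis_def)
  show "integral (cbox l r) (zext U f2) = 0"
    using D[of "axis 2 1 :: real^2"] 0 by (simp add: axis_def)
qed

section \<open>Integral identities surviving mollification\<close>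

text \<open>\<open>P\<close>, \<open>Q\<close> stand for a smooth gradient near \<open>u\<close>,
  with Hessian entries \<open>a\<close>, \<open>b\<close>, \<open>c\<close>. That \<open>b\<close>
  occurs in two gradients, and likewise \<open>a2\<close> and \<open>b2\<close>, encodes the
  symmetry of second and third derivatives, which makes rotated Hessian fields divergence
  free.\<close>

locale smooth_approx =
  fixes W :: "(real^2) set" and u :: "real^2 \<Rightarrow> real^2" and \<eta> :: real
    and P Q a b c a1 a2 b2 c2 :: "real^2 \<Rightarrow> real"
  assumes close: "x \<in> W \<Longrightarrow> \<bar>P x - u x $ 1\<bar> \<le> \<eta>" "x \<in> W \<Longrightarrow> \<bar>Q x - u x $ 2\<bar> \<le> \<eta>"
    and grad_P: "x \<in> W \<Longrightarrow> has_grad2 P (a x) (b x) x"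
    and grad_Q: "x \<in> W \<Longrightarrow> has_grad2 Q (b x) (c x) x"
    and grad_a: "x \<in> W \<Longrightarrow> has_grad2 a (a1 x) (a2 x) x"
    and grad_b: "x \<in> W \<Longrightarrow> has_grad2 b (a2 x) (b2 x) x"
    and grad_c: "x \<in> W \<Longrightarrow> has_grad2 c (b2 x) (c2 x) x"
    and cont: "continuous_on W a1" "continuous_on W a2" "continuous_on W b2" "continuous_on W c2"
begin

lemma cont_low:
  "continuous_on W P" "continuous_on W Q" "continuous_on W a" "continuous_on W b" "continuous_on W c"
  using has_grad2_continuous_on grad_P grad_Q grad_a grad_b grad_c by blast+

end

text \<open>The determinant is the divergence of a field of size \<open>\<rho>\<close>. A test
  function of position and gradient has derivatives of order \<open>1 + M\<close>, so the product in
  \<open>small\<close> is exactly the price of one integration by parts.\<close>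

locale det_approx = smooth_approx +
  fixes M \<rho> :: real and r s r1 r2 s1 s2 :: "real^2 \<Rightarrow> real"
  assumes grad_r: "x \<in> W \<Longrightarrow> has_grad2 r (r1 x) (r2 x) x"
    and grad_s: "x \<in> W \<Longrightarrow> has_grad2 s (s1 x) (s2 x) x"
    and cont_rs: "continuous_on W r1" "continuous_on W r2" "continuous_on W s1" "continuous_on W s2"
    and det_eq: "x \<in> W \<Longrightarrow> r1 x + s2 x = a x * c x - (b x)\<^sup>2"
    and bounds: "x \<in> W \<Longrightarrow> \<bar>a x\<bar> \<le> M" "x \<in> W \<Longrightarrow> \<bar>b x\<bar> \<le> M" "x \<in> W \<Longrightarrow> \<bar>c x\<bar> \<le> M"
      "x \<in> W \<Longrightarrow> \<bar>r x\<bar> \<le> \<rho>" "x \<in> W \<Longrightarrow> \<bar>s x\<bar> \<le> \<rho>"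
    and small: "\<rho> * (1 + M) \<le> \<eta>" and nonneg: "0 \<le> \<rho>" "0 \<le> M"

definition det_approximable :: "(real^2) set \<Rightarrow> (real^2 \<Rightarrow> real^2) \<Rightarrow> bool" where
  "det_approximable W u \<longleftrightarrow> (\<forall>\<eta>>0. \<exists>P Q a b c a1 a2 b2 c2 M \<rho> r s r1 r2 s1 s2.
      det_approx W u \<eta> P Q a b c a1 a2 b2 c2 M \<rho> r s r1 r2 s1 s2)"

lemma abs_integral_zext_le:
  fixes f :: "real^2 \<Rightarrow> real"
  assumes "continuous_on (cbox lo hi) (zext U f)" "\<And>x. x \<in> U \<Longrightarrow> \<bar>f x\<bar> \<le> B" "0 \<le> B"
  shows "\<bar>integral (cbox lo hi) (zext U f)\<bar> \<le> B * measure lborel (cbox lo hi)"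
  using has_integral_bound[OF assms(3) integrable_integral[OF integrable_continuous[OF assms(1)]]]
    assms(2,3) by (auto simp: zext_def)

text \<open>Writing the determinant as the divergence of \<open>(r, s)\<close> and integrating by
  parts moves the derivative to \<open>G\<close>, whose growth \<open>L * (1 + M)\<close> is
  compensated by \<open>\<rho>\<close> through \<open>small\<close>.\<close>

lemma (in det_approx) abs_integral_mult_det_le:
  assumes U: "open U" "U \<subseteq> W" and K: "compact K" "K \<subseteq> U" "K \<subseteq> box lo hi"
    and G: "\<And>x. x \<in> U \<Longrightarrow> has_grad2 G (G1 x) (G2 x) x"
    and cG: "continuous_on U G1" "continuous_on U G2" and G0: "\<And>x. x \<in> U - K \<Longrightarrow> G x = 0"
    and L: "\<And>x. x \<in> U \<Longrightarrow> \<bar>G1 x\<bar> \<le> L * (1 + M)" "\<And>x. x \<in> U \<Longrightarrow> \<bar>G2 x\<bar> \<le> L * (1 + M)" "0 \<le> L"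
  shows "\<bar>integral (cbox lo hi) (zext U (\<lambda>x. G x * (a x * c x - (b x)\<^sup>2)))\<bar>
    \<le> 2 * L * \<eta> * measure lborel (cbox lo hi)"
proof -
  note sub = continuous_on_subset[OF _ U(2)]
  have c: "continuous_on U r" "continuous_on U s" "continuous_on U G"
    using has_grad2_continuous_on grad_r grad_s G U(2) by (meson subset_iff)+
  note c = c cG sub[OF cont_rs(1)] sub[OF cont_rs(2)] sub[OF cont_rs(3)] sub[OF cont_rs(4)]
  have G12: "G1 x = 0" "G2 x = 0" if "x \<in> U - K" for x
    using has_grad2_zext(2,3)[OF U(1) K(1,2) G G0] that by auto
  have 1: "integral (cbox lo hi) (zext U (\<lambda>x. G1 x * r x + G x * r1 x)) = 0"
    using G0 U(2)
    by (intro integral_zext_grad_zero[OF U(1) K, of "\<lambda>x. G x * r x" _ "\<lambda>x. G2 x * r x + G x * r2 x"]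
        has_grad2_mult G grad_r continuous_intros c) auto
  have 2: "integral (cbox lo hi) (zext U (\<lambda>x. G2 x * s x + G x * s2 x)) = 0"
    using G0 U(2)
    by (intro integral_zext_grad_zero(2)[OF U(1) K, of "\<lambda>x. G x * s x" "\<lambda>x. G1 x * s x + G x * s1 x"]
        has_grad2_mult G grad_s continuous_intros c) auto
  have z: "continuous_on (cbox lo hi) (zext U (\<lambda>x. G1 x * r x + G x * r1 x))"
      "continuous_on (cbox lo hi) (zext U (\<lambda>x. G2 x * s x + G x * s2 x))"
      "continuous_on (cbox lo hi) (zext U (\<lambda>x. - (G1 x * r x + G2 x * s x)))"
    by (intro continuous_on_zext[OF U(1) K(1,2)] continuous_intros c; simp add: G0 G12)+
  have "zext U (\<lambda>x. G x * (a x * c x - (b x)\<^sup>2)) = (\<lambda>x. (zext U (\<lambda>x. G1 x * r x + G x * r1 x) x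
      + zext U (\<lambda>x. G2 x * s x + G x * s2 x) x) + zext U (\<lambda>x. - (G1 x * r x + G2 x * s x)) x)"
  proof
    fix x
    show "zext U (\<lambda>x. G x * (a x * c x - (b x)\<^sup>2)) x = zext U (\<lambda>x. G1 x * r x + G x * r1 x) x
      + zext U (\<lambda>x. G2 x * s x + G x * s2 x) x + zext U (\<lambda>x. - (G1 x * r x + G2 x * s x)) x"
    proof (cases "x \<in> U")
      case True
      then show ?thesis using det_eq[OF subsetD[OF U(2) True], symmetric]
        by (simp add: zext_def distrib_left)
    qed (simp add: zext_def)
  qed
  then have "integral (cbox lo hi) (zext U (\<lambda>x. G x * (a x * c x - (b x)\<^sup>2)))
      = integral (cbox lo hi) (zext U (\<lambda>x. - (G1 x * r x + G2 x * s x)))"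
    using 1 2 integral_add[OF integrable_add[OF z(1,2)[THEN integrable_continuous]] integrable_continuous[OF z(3)]]
      integral_add[OF z(1,2)[THEN integrable_continuous]] by (simp only: add_0_left)
  moreover have "\<bar>\<dots>\<bar> \<le> (2 * L * \<eta>) * measure lborel (cbox lo hi)"
  proof (rule abs_integral_zext_le[OF z(3)])
    fix x assume "x \<in> U"
    have "\<bar>G1 x * r x\<bar> \<le> (L * (1 + M)) * \<rho>" "\<bar>G2 x * s x\<bar> \<le> (L * (1 + M)) * \<rho>"
      unfolding abs_mult using L \<open>x \<in> U\<close> U(2) bounds nonneg by (intro mult_mono; auto)+
    then have "\<bar>- (G1 x * r x + G2 x * s x)\<bar> \<le> 2 * L * (\<rho> * (1 + M))"
      by (simp add: algebra_simps)
    also have "\<dots> \<le> 2 * L * \<eta>" using small L(3) by (intro mult_left_mono) auto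
    finally show "\<bar>- (G1 x * r x + G2 x * s x)\<bar> \<le> 2 * L * \<eta>" .
  next
    have "0 \<le> \<eta>" using small nonneg by (smt (verit) mult_nonneg_nonneg)
    then show "0 \<le> 2 * L * \<eta>" using L(3) by simp
  qed
  ultimately show ?thesis by simp
qed

text \<open>The functions \<open>g\<close> and \<open>H\<close> of position and gradient are paired so that
  \<open>g + H det\<close> is the divergence of a compactly supported field whenever the gradient is smooth;
  the term \<open>H det\<close> disappears in the limit.\<close>

lemma null_integral:
  fixes u :: "real^2 \<Rightarrow> real^2" and g H H1 H2 H3 H4 :: "real^2 \<Rightarrow> real \<Rightarrow> real \<Rightarrow> real"
  assumes approx: "det_approximable W u" and W: "compact W" and uc: "continuous_on W u"
    and U: "open U" "U \<subseteq> W" and K: "compact K" "K \<subseteq> U" "K \<subseteq> box lo hi" and "\<epsilon> > 0"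
    and cg: "continuous_on UNIV (\<lambda>(x, p, q). g x p q)"
    and cH: "continuous_on UNIV (\<lambda>(x, p, q). H1 x p q)" "continuous_on UNIV (\<lambda>(x, p, q). H2 x p q)"
      "continuous_on UNIV (\<lambda>(x, p, q). H3 x p q)" "continuous_on UNIV (\<lambda>(x, p, q). H4 x p q)"
    and supp: "\<And>x p q. x \<in> U - K \<Longrightarrow> \<bar>p - u x $ 1\<bar> \<le> \<epsilon> \<Longrightarrow> \<bar>q - u x $ 2\<bar> \<le> \<epsilon> \<Longrightarrow>
        g x p q = 0 \<and> H x p q = 0"
    and grad: "\<And>P Q x a b c. has_grad2 P a b x \<Longrightarrow> has_grad2 Q b c x \<Longrightarrow>
        has_grad2 (\<lambda>x. H x (P x) (Q x))
          (H1 x (P x) (Q x) + H3 x (P x) (Q x) * a + H4 x (P x) (Q x) * b)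
          (H2 x (P x) (Q x) + H3 x (P x) (Q x) * b + H4 x (P x) (Q x) * c) x"
    and dv: "\<And>P Q a b c a1 a2 b2 c2. smooth_approx W u \<epsilon> P Q a b c a1 a2 b2 c2 \<Longrightarrow>
        integral (cbox lo hi) (zext U (\<lambda>x. g x (P x) (Q x) + H x (P x) (Q x) * (a x * c x - (b x)\<^sup>2))) = 0"
  shows "integral (cbox lo hi) (zext U (\<lambda>x. g x (u x $ 1) (u x $ 2))) = 0"
proof -
  define C where "C = measure lborel (cbox lo hi)"
  have C: "C \<ge> 0" by (simp add: C_def)
  have "compact ((\<lambda>x. norm (u x)) ` W)"
    by (intro compact_continuous_image continuous_intros uc W)
  then obtain B0 where B0: "\<And>x. x \<in> W \<Longrightarrow> norm (u x) \<le> B0"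
    by (meson bounded_imp_bdd_above bdd_above.unfold compact_imp_bounded image_eqI)
  \<comment> \<open>A compact set containing the graph of \<open>u\<close> over \<open>W\<close> and
    of every approximation within \<open>\<epsilon>\<close>. Bounds for the derivatives of
    \<open>H\<close> and the modulus of continuity of \<open>g\<close> are taken on it, uniformly in
    the approximation.\<close>
  define D :: "((real^2) \<times> real \<times> real) set" where "D = W \<times> {- B0 - \<epsilon>..B0 + \<epsilon>} \<times> {- B0 - \<epsilon>..B0 + \<epsilon>}"
  have D: "compact D" unfolding D_def by (intro compact_Times W compact_Icc)
  have inD: "(x, p, q) \<in> D" if "x \<in> W" "\<bar>p - u x $ 1\<bar> \<le> \<epsilon>" "\<bar>q - u x $ 2\<bar> \<le> \<epsilon>" for x p q
    using that B0[OF that(1)] component_le_norm_cart[of "u x" 1] component_le_norm_cart[of "u x" 2]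
    by (auto simp: D_def)
  have bdd: "\<exists>L. \<forall>(x, p, q) \<in> D. \<bar>h x p q\<bar> \<le> L" if "continuous_on UNIV (\<lambda>(x, p, q). h x p q)"
    for h :: "real^2 \<Rightarrow> real \<Rightarrow> real \<Rightarrow> real"
  proof -
    have "bounded ((\<lambda>(x, p, q). h x p q) ` D)"
      by (intro compact_imp_bounded compact_continuous_image D continuous_on_subset[OF that]) auto
    then show ?thesis by (force simp: bounded_iff)
  qed
  obtain L1 L2 L3 L4 where L: "\<forall>(x, p, q) \<in> D. \<bar>H1 x p q\<bar> \<le> L1" "\<forall>(x, p, q) \<in> D. \<bar>H2 x p q\<bar> \<le> L2"
    "\<forall>(x, p, q) \<in> D. \<bar>H3 x p q\<bar> \<le> L3" "\<forall>(x, p, q) \<in> D. \<bar>H4 x p q\<bar> \<le> L4"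
    using bdd[OF cH(1)] bdd[OF cH(2)] bdd[OF cH(3)] bdd[OF cH(4)] by blast
  define L where "L = \<bar>L1\<bar> + \<bar>L2\<bar> + \<bar>L3\<bar> + \<bar>L4\<bar>"
  have cgU: "continuous_on U (\<lambda>x. g x (p x) (q x))" if "continuous_on W p" "continuous_on W q" for p q
  proof -
    have "continuous_on W (\<lambda>x. (\<lambda>(x, p, q). g x p q) (x, p x, q x))"
      by (intro continuous_on_compose2[OF cg] continuous_intros that) auto
    then show ?thesis using continuous_on_subset U(2) by auto
  qed
  have cHU: "continuous_on U (\<lambda>x. h x (p x) (q x))"
    if "continuous_on UNIV (\<lambda>(x, p, q). h x p q)" "continuous_on W p" "continuous_on W q"
    for h :: "real^2 \<Rightarrow> real \<Rightarrow> real \<Rightarrow> real" and p q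
  proof -
    have "continuous_on W (\<lambda>x. (\<lambda>(x, p, q). h x p q) (x, p x, q x))"
      by (intro continuous_on_compose2[OF that(1)] continuous_intros that) auto
    then show ?thesis using continuous_on_subset U(2) by auto
  qed
  have ucomp: "continuous_on W (\<lambda>x. u x $ 1)" "continuous_on W (\<lambda>x. u x $ 2)"
    using uc by (auto intro!: continuous_intros)
  have zu: "continuous_on (cbox lo hi) (zext U (\<lambda>x. g x (u x $ 1) (u x $ 2)))"
    using supp \<open>\<epsilon> > 0\<close> by (intro continuous_on_zext[OF U(1) K(1,2)] cgU ucomp) auto
  have "\<bar>integral (cbox lo hi) (zext U (\<lambda>x. g x (u x $ 1) (u x $ 2)))\<bar> \<le> \<delta>" if "\<delta> > 0" for \<delta>
  proof -
    define \<delta>' where "\<delta>' = \<delta> / (2 * (C + 1))"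
    have \<delta>': "\<delta>' > 0" "\<delta>' * C \<le> \<delta> / 2" using C \<open>\<delta> > 0\<close> by (auto simp: \<delta>'_def field_simps)
    have "uniformly_continuous_on D (\<lambda>(x, p, q). g x p q)"
      by (intro compact_uniformly_continuous D continuous_on_subset[OF cg]) auto
    then obtain d where d: "d > 0"
      "\<And>y z. y \<in> D \<Longrightarrow> z \<in> D \<Longrightarrow> dist z y < d \<Longrightarrow> dist ((\<lambda>(x, p, q). g x p q) z) ((\<lambda>(x, p, q). g x p q) y) < \<delta>'"
      unfolding uniformly_continuous_on_def using \<delta>' by meson
    \<comment> \<open>Three requirements: respect the support margin \<open>\<epsilon>\<close>, keep
      \<open>(P, Q)\<close> within the distance \<open>d\<close> in which \<open>g\<close> varies by
      less than \<open>\<delta>'\<close>, and make the determinant term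
      \<open>2 * L * \<eta> * C\<close> at most \<open>\<delta> / 2\<close>.\<close>
    define \<eta> where "\<eta> = Min {\<epsilon>, d / 3, \<delta> / (4 * (L + 1) * (C + 1))}"
    have "L \<ge> 0" by (simp add: L_def)
    have \<eta>: "\<eta> > 0" "\<eta> \<le> \<epsilon>" "\<eta> < d / 2"
      using d(1) \<open>\<epsilon> > 0\<close> \<open>\<delta> > 0\<close> \<open>L \<ge> 0\<close> C by (auto simp: \<eta>_def min_less_iff_disj)
    have "\<eta> \<le> \<delta> / (4 * (L + 1) * (C + 1))" by (simp add: \<eta>_def)
    then have "\<eta> * (4 * (L + 1) * (C + 1)) \<le> \<delta>"
      using \<open>L \<ge> 0\<close> C by (simp add: le_divide_eq)
    moreover have "\<eta> * (4 * L * C) \<le> \<eta> * (4 * (L + 1) * (C + 1))"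
      using \<open>L \<ge> 0\<close> C \<eta> by (intro mult_left_mono mult_mono) auto
    ultimately have small': "2 * L * \<eta> * C \<le> \<delta> / 2" by (simp add: algebra_simps)
    obtain P Q a b c a1 a2 b2 c2 M \<rho> r s r1 r2 s1 s2 where
      "det_approx W u \<eta> P Q a b c a1 a2 b2 c2 M \<rho> r s r1 r2 s1 s2"
      using approx[unfolded det_approximable_def, rule_format, OF \<eta>(1)] by (elim exE) (rule that)
    then interpret det_approx W u \<eta> P Q a b c a1 a2 b2 c2 M \<rho> r s r1 r2 s1 s2 .
    have sa: "smooth_approx W u \<epsilon> P Q a b c a1 a2 b2 c2"
    proof
      fix x assume "x \<in> W"
      then show "\<bar>P x - u x $ 1\<bar> \<le> \<epsilon>" "\<bar>Q x - u x $ 2\<bar> \<le> \<epsilon>"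
        using close[of x] \<eta>(2) by linarith+
    qed (fact grad_P grad_Q grad_a grad_b grad_c cont)+
    have PQ: "(x, P x, Q x) \<in> D" "\<bar>P x - u x $ 1\<bar> \<le> \<epsilon>" "\<bar>Q x - u x $ 2\<bar> \<le> \<epsilon>" if "x \<in> W" for x
      using close[OF that] \<eta>(2) inD[OF that] by auto
    have uD: "(x, u x $ 1, u x $ 2) \<in> D" if "x \<in> W" for x
      using inD[OF that] \<open>\<epsilon> > 0\<close> by auto
    have zPQ: "g x (P x) (Q x) = 0" "H x (P x) (Q x) = 0" if "x \<in> U - K" for x
      using supp[OF that PQ(2) PQ(3)] that U(2) by auto
    have zu0: "g x (u x $ 1) (u x $ 2) = 0" if "x \<in> U - K" for x
      using supp[OF that, of "u x $ 1" "u x $ 2"] \<open>\<epsilon> > 0\<close> by auto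
    note cl = cont_low[THEN continuous_on_subset, OF U(2)]
    note gr = grad[OF grad_P grad_Q, OF subsetD[OF U(2)] subsetD[OF U(2)]]
    have HL: "\<bar>H1 x (P x) (Q x)\<bar> \<le> L1" "\<bar>H2 x (P x) (Q x)\<bar> \<le> L2"
      "\<bar>H3 x (P x) (Q x)\<bar> \<le> L3" "\<bar>H4 x (P x) (Q x)\<bar> \<le> L4" if "x \<in> U" for x
      using L[THEN bspec, OF PQ(1)[OF subsetD[OF U(2) that]]] by simp_all
    have lin: "\<bar>h + k * p + l * q\<bar> \<le> L * (1 + M)"
      if "\<bar>h\<bar> + \<bar>k\<bar> + \<bar>l\<bar> \<le> L" "\<bar>p\<bar> \<le> M" "\<bar>q\<bar> \<le> M" for h k l p q
    proof -
      have "\<bar>h + k * p + l * q\<bar> \<le> \<bar>h\<bar> + \<bar>k\<bar> * \<bar>p\<bar> + \<bar>l\<bar> * \<bar>q\<bar>"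
        by (simp flip: abs_mult)
      also have "\<dots> \<le> \<bar>h\<bar> * (1 + M) + \<bar>k\<bar> * (1 + M) + \<bar>l\<bar> * (1 + M)"
        using that nonneg mult_left_mono[of 1 "1 + M" "\<bar>h\<bar>"] by (intro add_mono mult_left_mono) auto
      also have "\<dots> = (\<bar>h\<bar> + \<bar>k\<bar> + \<bar>l\<bar>) * (1 + M)" by (simp add: algebra_simps)
      also have "\<dots> \<le> L * (1 + M)" using that nonneg by (intro mult_right_mono) auto
      finally show ?thesis .
    qed
    have det: "\<bar>integral (cbox lo hi) (zext U (\<lambda>x. H x (P x) (Q x) * (a x * c x - (b x)\<^sup>2)))\<bar> \<le> 2 * L * \<eta> * C"
      unfolding C_def
    proof (rule abs_integral_mult_det_le[OF U K gr])
      note cH' = cH[THEN cHU, OF cont_low(1,2)]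
      show "continuous_on U (\<lambda>x. H1 x (P x) (Q x) + H3 x (P x) (Q x) * a x + H4 x (P x) (Q x) * b x)"
        "continuous_on U (\<lambda>x. H2 x (P x) (Q x) + H3 x (P x) (Q x) * b x + H4 x (P x) (Q x) * c x)"
        by (intro continuous_intros cl cH')+
      fix x assume x: "x \<in> U"
      show "\<bar>H1 x (P x) (Q x) + H3 x (P x) (Q x) * a x + H4 x (P x) (Q x) * b x\<bar> \<le> L * (1 + M)"
        "\<bar>H2 x (P x) (Q x) + H3 x (P x) (Q x) * b x + H4 x (P x) (Q x) * c x\<bar> \<le> L * (1 + M)"
        by (rule lin; use HL[OF x] bounds x U(2) in \<open>auto simp: L_def\<close>)+
    next
      fix x assume "x \<in> U - K"
      then show "H x (P x) (Q x) = 0" by (rule zPQ)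
    qed (use \<open>L \<ge> 0\<close> in auto)
    have zg: "continuous_on (cbox lo hi) (zext U (\<lambda>x. g x (P x) (Q x)))"
      by (intro continuous_on_zext[OF U(1) K(1,2)] cgU cont_low zPQ(1))
    have zH: "continuous_on (cbox lo hi) (zext U (\<lambda>x. H x (P x) (Q x) * (a x * c x - (b x)\<^sup>2)))"
    proof (intro continuous_on_zext[OF U(1) K(1,2)] continuous_intros)
      show "continuous_on U (\<lambda>x. H x (P x) (Q x))" using gr by (rule has_grad2_continuous_on)
    qed (use cl zPQ in auto)
    have "integral (cbox lo hi) (zext U (\<lambda>x. g x (P x) (Q x)))
        + integral (cbox lo hi) (zext U (\<lambda>x. H x (P x) (Q x) * (a x * c x - (b x)\<^sup>2))) = 0"
    proof -
      have "zext U (\<lambda>x. g x (P x) (Q x) + H x (P x) (Q x) * (a x * c x - (b x)\<^sup>2))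
          = (\<lambda>x. zext U (\<lambda>x. g x (P x) (Q x)) x + zext U (\<lambda>x. H x (P x) (Q x) * (a x * c x - (b x)\<^sup>2)) x)"
        by (auto simp: zext_def)
      with dv[OF sa] show ?thesis
        by (simp add: integral_add[OF integrable_continuous[OF zg] integrable_continuous[OF zH]])
    qed
    then have A: "\<bar>integral (cbox lo hi) (zext U (\<lambda>x. g x (P x) (Q x)))\<bar> \<le> \<delta> / 2"
      using det small' by linarith
    have "\<bar>integral (cbox lo hi) (zext U (\<lambda>x. g x (u x $ 1) (u x $ 2) - g x (P x) (Q x)))\<bar> \<le> \<delta>' * C"
      unfolding C_def
    proof (rule abs_integral_zext_le)
      show "continuous_on (cbox lo hi) (zext U (\<lambda>x. g x (u x $ 1) (u x $ 2) - g x (P x) (Q x)))"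
        by (intro continuous_on_zext[OF U(1) K(1,2)] continuous_on_diff cgU cont_low ucomp)
           (simp add: zPQ zu0)
      fix x assume "x \<in> U"
      then have x: "x \<in> W" using U by auto
      have "dist (x, u x $ 1, u x $ 2) (x, P x, Q x) \<le> \<bar>P x - u x $ 1\<bar> + \<bar>Q x - u x $ 2\<bar>"
        using sqrt_sum_squares_le_sum_abs[of "u x $ 1 - P x" "u x $ 2 - Q x"]
        by (simp add: dist_Pair_Pair dist_real_def)
      also have "\<dots> < d" using close[OF x] \<eta>(3) by linarith
      finally show "\<bar>g x (u x $ 1) (u x $ 2) - g x (P x) (Q x)\<bar> \<le> \<delta>'"
        using d(2)[OF PQ(1)[OF x] uD[OF x]] by (simp add: dist_real_def)
    qed (use \<delta>' in auto)
    also have "zext U (\<lambda>x. g x (u x $ 1) (u x $ 2) - g x (P x) (Q x))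
        = (\<lambda>x. zext U (\<lambda>x. g x (u x $ 1) (u x $ 2)) x - zext U (\<lambda>x. g x (P x) (Q x)) x)"
      by (auto simp: zext_def)
    finally show ?thesis
      using A \<delta>'(2) by (simp add: integral_diff integrable_continuous zu zg)
  qed
  then have "\<bar>integral (cbox lo hi) (zext U (\<lambda>x. g x (u x $ 1) (u x $ 2)))\<bar> \<le> 0"
    by (rule field_le_epsilon) auto
  then show ?thesis by simp
qed

section \<open>Two rigidity identities: maximum principle on half planes and contact of level sets
  with the boundary\<close>

lemma has_grad2_pos_power:
  assumes "n \<ge> 2" "has_grad2 f a b x"
  shows "has_grad2 (\<lambda>x. max 0 (f x) ^ n) (real n * max 0 (f x) ^ (n - 1) * a)
    (real n * max 0 (f x) ^ (n - 1) * b) x"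
  using has_grad2_chain[OF pos_power_deriv[OF assms(1)] assms(2)] by simp

lemmas has_grad2_intros = has_grad2_const has_grad2_coord1 has_grad2_coord2 has_grad2_add
  has_grad2_diff has_grad2_cmult has_grad2_mult

lemma integral_divergence_zero:
  fixes X1 X2 :: "real^2 \<Rightarrow> real"
  assumes U: "open U" and K: "compact K" "K \<subseteq> U" "K \<subseteq> box l r"
    and X1: "\<And>x. x \<in> U \<Longrightarrow> has_grad2 X1 (x11 x) (x12 x) x"
    and X2: "\<And>x. x \<in> U \<Longrightarrow> has_grad2 X2 (x21 x) (x22 x) x"
    and c: "continuous_on U x11" "continuous_on U x12" "continuous_on U x21" "continuous_on U x22"
    and X0: "\<And>x. x \<in> U - K \<Longrightarrow> X1 x = 0 \<and> X2 x = 0"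
    and h: "\<And>x. x \<in> U \<Longrightarrow> h x = x11 x + x22 x"
  shows "integral (cbox l r) (zext U h) = 0"
proof -
  have X0': "\<And>x. x \<in> U - K \<Longrightarrow> X1 x = 0" "\<And>x. x \<in> U - K \<Longrightarrow> X2 x = 0" using X0 by auto
  have "zext U h = (\<lambda>x. zext U x11 x + zext U x22 x)" using h by (auto simp: zext_def)
  moreover have "continuous_on (cbox l r) (zext U x11)"
    by (rule continuous_on_zext[OF U K(1,2) c(1) has_grad2_zext(2)[OF U K(1,2) X1 X0'(1)]])
  moreover have "continuous_on (cbox l r) (zext U x22)"
    by (rule continuous_on_zext[OF U K(1,2) c(4) has_grad2_zext(3)[OF U K(1,2) X2 X0'(2)]])
  ultimately show ?thesis
    using integral_zext_grad_zero(1)[OF U K X1 c(1,2) X0'(1)] integral_zext_grad_zero(2)[OF U K X2 c(3,4) X0'(2)]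
    by (simp add: integral_add integrable_continuous)
qed

lemma zext_integral_zero_imp:
  fixes f :: "real^2 \<Rightarrow> real"
  assumes "integral (cbox lo hi) (zext U f) = 0" "continuous_on (cbox lo hi) (zext U f)"
    and "\<And>x. x \<in> U \<Longrightarrow> 0 \<le> f x" "x \<in> U" "x \<in> box lo hi"
  shows "f x = 0"
proof -
  have "(zext U f has_integral 0) (cbox lo hi)"
    using integrable_integral[OF integrable_continuous[OF assms(2)]] assms(1) by simp
  moreover have "0 \<le> zext U f y" for y using assms(3) by (simp add: zext_def)
  moreover have "box lo hi \<noteq> {}" using assms(5) by auto
  ultimately have "zext U f x = 0"
    using has_integral_0_cbox_imp_0[OF assms(2)] subsetD[OF box_subset_cbox assms(5)] by blast
  then show ?thesis using assms(4) by (simp add: zext_def)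
qed

lemma bounded_subset_box:
  fixes S :: "(real^2) set"
  assumes "bounded S"
  obtains lo hi where "S \<subseteq> box lo hi"
  using bounded_subset_box_symmetric[OF assms] by blast

text \<open>With \<open>\<mu>\<close> the positive part of \<open>e \<bullet> x - s\<close> and
  \<open>\<nu>\<close> that of \<open>u x \<bullet> \<tau> - (k + 2 * \<kappa>)\<close>, the field
  \<open>3 * S * \<mu>^2 * \<nu>^4\<close> times \<open>e\<close> has divergence
  \<open>6 * S^2 * \<mu> * \<nu>^4\<close> plus a cross term containing the derivative of
  \<open>u \<bullet> \<tau>\<close> along \<open>e\<close>. Adding
  \<open>4 * J * \<mu>^3 * \<nu>^3\<close> times the rotated gradient of
  \<open>u \<bullet> e\<close> cancels the cross term and leaves
  \<open>12 * J^2 * \<mu>^3 * \<nu>^2\<close> times the determinant. In the limit the integral of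
  \<open>\<mu> * \<nu>^4\<close> is zero, although both factors are positive at a point violating
  the bound.\<close>

lemma half_plane_max_principle:
  fixes u :: "real^2 \<Rightarrow> real^2"
  assumes approx: "det_approximable (closure U) u" and uc: "continuous_on UNIV u"
    and U: "open U" "bounded U" and e: "e \<bullet> \<tau> = 0" "e \<noteq> 0"
    and bd: "\<And>z. z \<in> frontier U \<Longrightarrow> s \<le> e \<bullet> z \<Longrightarrow> u z \<bullet> \<tau> \<le> k"
    and x: "x \<in> U" "s < e \<bullet> x"
  shows "u x \<bullet> \<tau> \<le> k"
proof (rule ccontr)
  assume "\<not> u x \<bullet> \<tau> \<le> k"
  \<comment> \<open>A quarter of the excess at \<open>x\<close>. The support set \<open>K\<close>
    uses the level \<open>k + \<kappa>\<close> and the cutoff the level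
    \<open>k + 2 * \<kappa>\<close>: the gap absorbs the passage from \<open>u\<close> to an
    approximation, while the cutoff stays positive at \<open>x\<close>.\<close>
  define \<kappa> where "\<kappa> = (u x \<bullet> \<tau> - k) / 4"
  have \<kappa>: "\<kappa> > 0" "u x \<bullet> \<tau> = k + 4 * \<kappa>" using \<open>\<not> u x \<bullet> \<tau> \<le> k\<close> by (auto simp: \<kappa>_def field_simps)
  have W: "compact (closure U)" using U by (simp add: compact_closure)
  define K where "K = closure U \<inter> ({z. s \<le> e \<bullet> z} \<inter> {z. k + \<kappa> \<le> u z \<bullet> \<tau>})"
  have "compact K" unfolding K_def
    by (intro compact_Int_closed W closed_Int closed_Collect_le continuous_intros uc)
  have "K \<subseteq> U"
  proof
    fix z assume "z \<in> K"
    then have "z \<notin> frontier U" using bd[of z] \<kappa>(1) by (auto simp: K_def)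
    then show "z \<in> U" using \<open>z \<in> K\<close> U(1) by (simp add: K_def frontier_def interior_open)
  qed
  obtain lo hi where box: "closure U \<subseteq> box lo hi"
    using bounded_subset_box[OF compact_imp_bounded[OF W]] by blast
  have Kbox: "K \<subseteq> box lo hi" using box by (auto simp: K_def)
  \<comment> \<open>In the plane a vector orthogonal to \<open>e\<close> is a multiple
    \<open>l0\<close> of \<open>e\<close> rotated by a right angle. This makes the two cross terms
    proportional.\<close>
  define e1 e2 t1 t2 S l0 where d: "e1 = e $ 1" "e2 = e $ 2" "t1 = \<tau> $ 1" "t2 = \<tau> $ 2"
    "S = e1\<^sup>2 + e2\<^sup>2" "l0 = (e1 * t2 - e2 * t1) / S"
  have inn: "v \<bullet> w = v $ 1 * w $ 1 + v $ 2 * w $ 2" for v w :: "real^2"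
    by (simp add: inner_vec_def sum_2)
  have "S > 0" using e(2) by (auto simp: d vec_eq_iff forall_2 sum_power2_gt_zero_iff)
  have et: "e1 * t1 + e2 * t2 = 0" using e(1) by (simp add: inn d)
  have "l0 * S = e1 * t2 - e2 * t1" using \<open>S > 0\<close> by (simp add: d)
  have "t1 * S = - (l0 * S) * e2 + (e1 * t1 + e2 * t2) * e1"
    unfolding \<open>l0 * S = _\<close> unfolding d by (simp add: power2_eq_square algebra_simps)
  then have "(t1 + l0 * e2) * S = 0" using et by (simp add: algebra_simps)
  then have t1: "t1 = - l0 * e2" using \<open>S > 0\<close> by simp
  have "t2 * S = (l0 * S) * e1 + (e1 * t1 + e2 * t2) * e2"
    unfolding \<open>l0 * S = _\<close> unfolding d by (simp add: power2_eq_square algebra_simps)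
  then have "(t2 - l0 * e1) * S = 0" using et by (simp add: algebra_simps)
  then have t2: "t2 = l0 * e1" using \<open>S > 0\<close> by simp
  \<comment> \<open>Equal to \<open>t1 * e2 - t2 * e1\<close>: pairing the gradient of
    \<open>u \<bullet> \<tau>\<close> with the rotated gradient of \<open>u \<bullet> e\<close>
    gives \<open>J\<close> times the determinant.\<close>
  define J where "J = - l0 * S"
  define \<mu> where "\<mu> x = max 0 (e1 * x $ 1 + e2 * x $ 2 - s)" for x :: "real^2"
  define \<nu> where "\<nu> p q = max 0 (t1 * p + t2 * q - (k + 2 * \<kappa>))" for p q
  \<comment> \<open>Moving \<open>p\<close> and \<open>q\<close> by at most
    \<open>\<epsilon>\<close> changes \<open>t1 * p + t2 * q\<close> by at most
    \<open>\<kappa>\<close>.\<close>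
  define \<epsilon> where "\<epsilon> = \<kappa> / (\<bar>t1\<bar> + \<bar>t2\<bar> + 1)"
  have \<epsilon>: "\<epsilon> > 0" using \<kappa>(1) by (simp add: \<epsilon>_def add_nonneg_pos)
  have g\<mu>: "has_grad2 (\<lambda>x. \<mu> x ^ n) (real n * \<mu> x ^ (n - 1) * e1) (real n * \<mu> x ^ (n - 1) * e2) x"
    if "n \<ge> 2" for n x
    unfolding \<mu>_def
    by (rule has_grad2_pos_power[OF that]) (rule has_grad2_eq, (rule has_grad2_intros)+, simp_all)
  have g\<nu>: "has_grad2 (\<lambda>x. \<nu> (P x) (Q x) ^ n) (real n * \<nu> (P x) (Q x) ^ (n - 1) * (t1 * a + t2 * b))
      (real n * \<nu> (P x) (Q x) ^ (n - 1) * (t1 * b + t2 * c)) x"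
    if "n \<ge> 2" "has_grad2 P a b x" "has_grad2 Q b c x" for n x P Q a b c
    unfolding \<nu>_def
    by (rule has_grad2_pos_power[OF that(1)]) (rule has_grad2_eq, (rule has_grad2_intros that)+, simp_all)
  have c\<mu>: "continuous_on T (\<lambda>x. \<mu> (f x))" if "continuous_on T f" for T and f :: "'z::topological_space \<Rightarrow> real^2"
    unfolding \<mu>_def by (intro continuous_intros that)
  have c\<nu>: "continuous_on T (\<lambda>x. \<nu> (f x) (h x))" if "continuous_on T f" "continuous_on T h"
    for T and f h :: "'z::topological_space \<Rightarrow> real"
    unfolding \<nu>_def by (intro continuous_intros that)
  have lin: "t * z \<le> \<bar>t\<bar> * \<epsilon>" if "\<bar>z\<bar> \<le> \<epsilon>" for t z
  proof -
    have "t * z \<le> \<bar>t\<bar> * \<bar>z\<bar>" by (metis abs_ge_self abs_mult)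
    also have "\<dots> \<le> \<bar>t\<bar> * \<epsilon>" using that by (intro mult_left_mono) auto
    finally show ?thesis .
  qed
  have supp: "\<mu> y = 0 \<or> \<nu> p q = 0"
    if "y \<in> U - K" "\<bar>p - u y $ 1\<bar> \<le> \<epsilon>" "\<bar>q - u y $ 2\<bar> \<le> \<epsilon>" for y p q
  proof (rule disjCI)
    assume "\<nu> p q \<noteq> 0"
    then have "t1 * p + t2 * q > k + 2 * \<kappa>" by (auto simp: \<nu>_def max_def split: if_splits)
    moreover have "t1 * p + t2 * q = u y \<bullet> \<tau> + (t1 * (p - u y $ 1) + t2 * (q - u y $ 2))"
      by (simp add: inn d algebra_simps)
    moreover have "t1 * (p - u y $ 1) + t2 * (q - u y $ 2) \<le> \<bar>t1\<bar> * \<epsilon> + \<bar>t2\<bar> * \<epsilon>"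
      by (intro add_mono lin that)
    moreover have "\<bar>t1\<bar> * \<epsilon> + \<bar>t2\<bar> * \<epsilon> \<le> \<kappa>"
    proof -
      have "\<bar>t1\<bar> + \<bar>t2\<bar> + 1 > 0" by linarith
      then have "\<epsilon> * (\<bar>t1\<bar> + \<bar>t2\<bar> + 1) = \<kappa>" by (simp add: \<epsilon>_def)
      then show ?thesis using \<epsilon> by (simp add: algebra_simps)
    qed
    ultimately have "u y \<bullet> \<tau> \<ge> k + \<kappa>" by linarith
    then have "\<not> s \<le> e \<bullet> y" using that(1) closure_subset[of U] by (auto simp: K_def)
    then show "\<mu> y = 0" by (simp add: \<mu>_def inn d)
  qed
  define g where "g x p q = 6 * S\<^sup>2 * (\<mu> x * \<nu> p q ^ 4)" for x p q
  define H where "H x p q = 12 * J\<^sup>2 * (\<mu> x ^ 3 * \<nu> p q ^ 2)" for x p q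
  have "integral (cbox lo hi) (zext U (\<lambda>x. g x (u x $ 1) (u x $ 2))) = 0"
  proof (rule null_integral[OF approx W continuous_on_subset[OF uc subset_UNIV] U(1) closure_subset \<open>compact K\<close> \<open>K \<subseteq> U\<close> Kbox \<epsilon>,
        where H = H
        and ?H1.0 = "\<lambda>x p q. 36 * J\<^sup>2 * e1 * \<mu> x ^ 2 * \<nu> p q ^ 2"
        and ?H2.0 = "\<lambda>x p q. 36 * J\<^sup>2 * e2 * \<mu> x ^ 2 * \<nu> p q ^ 2"
        and ?H3.0 = "\<lambda>x p q. 24 * J\<^sup>2 * t1 * \<mu> x ^ 3 * \<nu> p q"
        and ?H4.0 = "\<lambda>x p q. 24 * J\<^sup>2 * t2 * \<mu> x ^ 3 * \<nu> p q"])
    show "g x p q = 0 \<and> H x p q = 0" if "x \<in> U - K" "\<bar>p - u x $ 1\<bar> \<le> \<epsilon>" "\<bar>q - u x $ 2\<bar> \<le> \<epsilon>" for x p q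
      using supp[OF that] by (auto simp: g_def H_def)
  next
    fix P Q :: "real^2 \<Rightarrow> real" and x a b c
    assume PQ: "has_grad2 P a b x" "has_grad2 Q b c x"
    show "has_grad2 (\<lambda>x. H x (P x) (Q x))
          (36 * J\<^sup>2 * e1 * (\<mu> x)\<^sup>2 * (\<nu> (P x) (Q x))\<^sup>2 + 24 * J\<^sup>2 * t1 * \<mu> x ^ 3 * \<nu> (P x) (Q x) * a
            + 24 * J\<^sup>2 * t2 * \<mu> x ^ 3 * \<nu> (P x) (Q x) * b)
          (36 * J\<^sup>2 * e2 * (\<mu> x)\<^sup>2 * (\<nu> (P x) (Q x))\<^sup>2 + 24 * J\<^sup>2 * t1 * \<mu> x ^ 3 * \<nu> (P x) (Q x) * b
            + 24 * J\<^sup>2 * t2 * \<mu> x ^ 3 * \<nu> (P x) (Q x) * c) x"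
      unfolding H_def
      by (rule has_grad2_eq, rule has_grad2_cmult, rule has_grad2_mult, rule g\<mu>, simp, rule g\<nu>[OF _ PQ], simp)
         (simp_all add: algebra_simps)
  next
    fix P Q a b c a1 a2 b2 c2
    assume "smooth_approx (closure U) u \<epsilon> P Q a b c a1 a2 b2 c2"
    then interpret smooth_approx "closure U" u \<epsilon> P Q a b c a1 a2 b2 c2 .
    have sub: "y \<in> closure U" if "y \<in> U" for y using that closure_subset by auto
    note cs = continuous_on_subset[OF _ closure_subset]
    let ?m = \<mu> and ?n = "\<lambda>x. \<nu> (P x) (Q x)"
    have n: "has_grad2 (\<lambda>x. ?n x ^ n) (real n * ?n x ^ (n - 1) * (t1 * a x + t2 * b x))
      (real n * ?n x ^ (n - 1) * (t1 * b x + t2 * c x)) x" if "n \<ge> 2" "x \<in> U" for n x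
      by (rule g\<nu>[OF that(1) grad_P grad_Q]) (use sub that in auto)
    have Y: "has_grad2 (\<lambda>x. e1 * b x + e2 * c x) (e1 * a2 x + e2 * b2 x) (e1 * b2 x + e2 * c2 x) x"
      "has_grad2 (\<lambda>x. e1 * a x + e2 * b x) (e1 * a1 x + e2 * a2 x) (e1 * a2 x + e2 * b2 x) x" if "x \<in> U" for x
      by (intro has_grad2_intros grad_a grad_b grad_c sub that)+
    note cc = cs[OF cont_low(1)] cs[OF cont_low(2)] cs[OF cont_low(3)] cs[OF cont_low(4)] cs[OF cont_low(5)]
      cs[OF cont(1)] cs[OF cont(2)] cs[OF cont(3)] cs[OF cont(4)]
    show "integral (cbox lo hi) (zext U (\<lambda>x. g x (P x) (Q x) + H x (P x) (Q x) * (a x * c x - (b x)\<^sup>2))) = 0"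
    proof (rule integral_divergence_zero[OF U(1) \<open>compact K\<close> \<open>K \<subseteq> U\<close> Kbox])
      fix x assume x: "x \<in> U"
      show "has_grad2 (\<lambda>x. 3 * S * e1 * (?m x ^ 2 * ?n x ^ 4) + 4 * J * (?m x ^ 3 * (?n x ^ 3 * (e1 * b x + e2 * c x))))
        (3 * S * e1 * (real 2 * ?m x ^ (2 - 1) * e1 * ?n x ^ 4 + ?m x ^ 2 * (real 4 * ?n x ^ (4 - 1) * (t1 * a x + t2 * b x)))
         + 4 * J * (real 3 * ?m x ^ (3 - 1) * e1 * (?n x ^ 3 * (e1 * b x + e2 * c x))
           + ?m x ^ 3 * (real 3 * ?n x ^ (3 - 1) * (t1 * a x + t2 * b x) * (e1 * b x + e2 * c x) + ?n x ^ 3 * (e1 * a2 x + e2 * b2 x))))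
        (3 * S * e1 * (real 2 * ?m x ^ (2 - 1) * e2 * ?n x ^ 4 + ?m x ^ 2 * (real 4 * ?n x ^ (4 - 1) * (t1 * b x + t2 * c x)))
         + 4 * J * (real 3 * ?m x ^ (3 - 1) * e2 * (?n x ^ 3 * (e1 * b x + e2 * c x))
           + ?m x ^ 3 * (real 3 * ?n x ^ (3 - 1) * (t1 * b x + t2 * c x) * (e1 * b x + e2 * c x) + ?n x ^ 3 * (e1 * b2 x + e2 * c2 x)))) x"
        by (rule g\<mu> n[OF _ x] Y[OF x] has_grad2_add has_grad2_cmult has_grad2_mult | simp)+
      show "has_grad2 (\<lambda>x. 3 * S * e2 * (?m x ^ 2 * ?n x ^ 4) - 4 * J * (?m x ^ 3 * (?n x ^ 3 * (e1 * a x + e2 * b x))))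
        (3 * S * e2 * (real 2 * ?m x ^ (2 - 1) * e1 * ?n x ^ 4 + ?m x ^ 2 * (real 4 * ?n x ^ (4 - 1) * (t1 * a x + t2 * b x)))
         - 4 * J * (real 3 * ?m x ^ (3 - 1) * e1 * (?n x ^ 3 * (e1 * a x + e2 * b x))
           + ?m x ^ 3 * (real 3 * ?n x ^ (3 - 1) * (t1 * a x + t2 * b x) * (e1 * a x + e2 * b x) + ?n x ^ 3 * (e1 * a1 x + e2 * a2 x))))
        (3 * S * e2 * (real 2 * ?m x ^ (2 - 1) * e2 * ?n x ^ 4 + ?m x ^ 2 * (real 4 * ?n x ^ (4 - 1) * (t1 * b x + t2 * c x)))
         - 4 * J * (real 3 * ?m x ^ (3 - 1) * e2 * (?n x ^ 3 * (e1 * a x + e2 * b x))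
           + ?m x ^ 3 * (real 3 * ?n x ^ (3 - 1) * (t1 * b x + t2 * c x) * (e1 * a x + e2 * b x) + ?n x ^ 3 * (e1 * a2 x + e2 * b2 x)))) x"
        by (rule g\<mu> n[OF _ x] Y[OF x] has_grad2_diff has_grad2_cmult has_grad2_mult | simp)+
      show "g x (P x) (Q x) + H x (P x) (Q x) * (a x * c x - (b x)\<^sup>2)
        = (3 * S * e1 * (real 2 * ?m x ^ (2 - 1) * e1 * ?n x ^ 4 + ?m x ^ 2 * (real 4 * ?n x ^ (4 - 1) * (t1 * a x + t2 * b x)))
         + 4 * J * (real 3 * ?m x ^ (3 - 1) * e1 * (?n x ^ 3 * (e1 * b x + e2 * c x))
           + ?m x ^ 3 * (real 3 * ?n x ^ (3 - 1) * (t1 * a x + t2 * b x) * (e1 * b x + e2 * c x) + ?n x ^ 3 * (e1 * a2 x + e2 * b2 x))))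
        + (3 * S * e2 * (real 2 * ?m x ^ (2 - 1) * e2 * ?n x ^ 4 + ?m x ^ 2 * (real 4 * ?n x ^ (4 - 1) * (t1 * b x + t2 * c x)))
         - 4 * J * (real 3 * ?m x ^ (3 - 1) * e2 * (?n x ^ 3 * (e1 * a x + e2 * b x))
           + ?m x ^ 3 * (real 3 * ?n x ^ (3 - 1) * (t1 * b x + t2 * c x) * (e1 * a x + e2 * b x) + ?n x ^ 3 * (e1 * a2 x + e2 * b2 x))))"
        unfolding g_def H_def t1 t2 J_def d(5) by (simp add: eval_nat_numeral algebra_simps)
    next
      fix x assume "x \<in> U - K"
      then show "3 * S * e1 * (?m x ^ 2 * ?n x ^ 4) + 4 * J * (?m x ^ 3 * (?n x ^ 3 * (e1 * b x + e2 * c x))) = 0 \<and>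
          3 * S * e2 * (?m x ^ 2 * ?n x ^ 4) - 4 * J * (?m x ^ 3 * (?n x ^ 3 * (e1 * a x + e2 * b x))) = 0"
        using supp[of x "P x" "Q x"] close[OF sub] by auto
    qed (intro continuous_intros c\<mu> c\<nu> cc)+
  qed (unfold g_def split_beta, (intro continuous_intros c\<mu> c\<nu>)+)
  moreover have "continuous_on (cbox lo hi) (zext U (\<lambda>x. g x (u x $ 1) (u x $ 2)))"
  proof (rule continuous_on_zext[OF U(1) \<open>compact K\<close> \<open>K \<subseteq> U\<close>])
    show "continuous_on U (\<lambda>x. g x (u x $ 1) (u x $ 2))"
      unfolding g_def by (intro continuous_intros c\<mu> c\<nu> continuous_on_subset[OF uc subset_UNIV])
    show "g x (u x $ 1) (u x $ 2) = 0" if "x \<in> U - K" for x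
      using supp[OF that, of "u x $ 1" "u x $ 2"] \<epsilon> by (auto simp: g_def)
  qed
  ultimately have "g x (u x $ 1) (u x $ 2) = 0"
    by (rule zext_integral_zero_imp) (use x(1) box closure_subset in \<open>auto simp: g_def \<mu>_def \<nu>_def\<close>)
  moreover have "\<mu> x > 0" using x(2) by (simp add: \<mu>_def inn d)
  moreover have "\<nu> (u x $ 1) (u x $ 2) > 0"
    using \<kappa> by (simp add: \<nu>_def inn d mult.commute)
  ultimately show False using \<open>S > 0\<close> by (simp add: g_def)
qed

text \<open>Let \<open>m\<close> be the positive part of \<open>\<rho>^2\<close> minus the squared
  distance of the gradient to \<open>u x\<close>. The field \<open>m^4\<close> times the position
  has divergence \<open>2 * m^4\<close> plus a term linear in the Hessian. The Hessian applied to
  the position is itself a gradient, so its rotation is divergence free; weighted by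
  \<open>8 * m^3 * w\<close> it cancels the linear term, at the cost of
  \<open>48 * m^2 * w^2 - 8 * m^3 * n2\<close> times the determinant. If \<open>u\<close> avoided
  the value \<open>u x\<close> on the frontier, \<open>m\<close> would have compact support in
  \<open>U\<close> and the integral of \<open>m^4\<close> would vanish, while \<open>m\<close> is
  positive at \<open>x\<close>.\<close>

lemma level_set_meets_frontier:
  fixes u :: "real^2 \<Rightarrow> real^2"
  assumes approx: "det_approximable (closure U) u" and uc: "continuous_on UNIV u"
    and U: "open U" "bounded U" and x: "x \<in> U"
  shows "\<exists>z\<in>frontier U. u z = u x"
proof (rule ccontr)
  assume no: "\<not> (\<exists>z\<in>frontier U. u z = u x)"
  define k1 k2 where k: "k1 = u x $ 1" "k2 = u x $ 2"
  have W: "compact (closure U)" using U by (simp add: compact_closure)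
  obtain lo hi where box: "closure U \<subseteq> box lo hi"
    using bounded_subset_box[OF compact_imp_bounded[OF W]] by blast
  define N where "N z = (u z $ 1 - k1)\<^sup>2 + (u z $ 2 - k2)\<^sup>2" for z
  have Nc: "continuous_on T N" for T
    unfolding N_def by (intro continuous_intros continuous_on_subset[OF uc subset_UNIV])
  have "\<exists>\<rho>>0. \<forall>z\<in>frontier U. 9 / 4 * \<rho>\<^sup>2 < N z"
  proof (cases "frontier U = {}")
    case False
    have "compact (frontier U)" using U by (simp add: compact_frontier_bounded)
    then obtain z0 where z0: "z0 \<in> frontier U" "\<And>z. z \<in> frontier U \<Longrightarrow> N z0 \<le> N z"
      using continuous_attains_inf[OF _ False Nc] by blast
    have "N z0 > 0"
      using z0(1) no by (auto simp: N_def k sum_power2_gt_zero_iff vec_eq_iff forall_2)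
    \<comment> \<open>Half the distance from \<open>u x\<close> to the values of \<open>u\<close> on
      the frontier, so that the level \<open>3 / 2 * \<rho>\<close> used for \<open>K\<close> still
      misses the frontier.\<close>
    define \<rho> where "\<rho> = sqrt (N z0) / 2"
    have "\<rho> > 0" "9 / 4 * \<rho>\<^sup>2 < N z0" using \<open>N z0 > 0\<close> by (auto simp: \<rho>_def power_divide)
    then show ?thesis using z0(2) by (meson less_le_trans)
  qed (auto intro: exI[of _ 1])
  then obtain \<rho> where \<rho>: "\<rho> > 0" "\<And>z. z \<in> frontier U \<Longrightarrow> 9 / 4 * \<rho>\<^sup>2 < N z" by blast
  define K where "K = closure U \<inter> {z. N z \<le> 9 / 4 * \<rho>\<^sup>2}"
  have "compact K" unfolding K_def
    by (intro compact_Int_closed W closed_Collect_le continuous_intros Nc)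
  have "K \<subseteq> U"
  proof
    fix z assume "z \<in> K"
    then have "z \<notin> frontier U" using \<rho>(2)[of z] by (auto simp: K_def)
    then show "z \<in> U" using \<open>z \<in> K\<close> U(1) by (simp add: K_def frontier_def interior_open)
  qed
  have Kbox: "K \<subseteq> box lo hi" using box by (auto simp: K_def)
  \<comment> \<open>The cutoff \<open>m\<close> lives on the disc of radius \<open>\<rho>\<close>
    around \<open>u x\<close>, whereas \<open>K\<close> allows \<open>3 / 2 * \<rho>\<close>; an
    error of \<open>\<rho> / 8\<close> in each coordinate stays within this gap.\<close>
  define \<epsilon> where "\<epsilon> = \<rho> / 8"
  have \<epsilon>: "\<epsilon> > 0" using \<rho> by (simp add: \<epsilon>_def)
  define m where "m p q = max 0 (\<rho>\<^sup>2 - ((p - k1)\<^sup>2 + (q - k2)\<^sup>2))" for p q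
  have supp: "m p q = 0"
    if "y \<in> U - K" "\<bar>p - u y $ 1\<bar> \<le> \<epsilon>" "\<bar>q - u y $ 2\<bar> \<le> \<epsilon>" for y p q
  proof (rule ccontr)
    assume "m p q \<noteq> 0"
    then have s: "(p - k1)\<^sup>2 + (q - k2)\<^sup>2 < \<rho>\<^sup>2" by (auto simp: m_def max_def split: if_splits)
    then have "(p - k1)\<^sup>2 < \<rho>\<^sup>2" "(q - k2)\<^sup>2 < \<rho>\<^sup>2"
      using zero_le_power2[of "p - k1"] zero_le_power2[of "q - k2"] by linarith+
    then have ab: "\<bar>p - k1\<bar> \<le> \<rho>" "\<bar>q - k2\<bar> \<le> \<rho>"
      using \<rho>(1) abs_le_square_iff[of "p - k1" \<rho>] abs_le_square_iff[of "q - k2" \<rho>] by auto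
    have one: "(d + f)\<^sup>2 \<le> d\<^sup>2 + \<rho>\<^sup>2 / 4 + \<rho>\<^sup>2 / 64" if "\<bar>d\<bar> \<le> \<rho>" "\<bar>f\<bar> \<le> \<epsilon>" for d f
    proof -
      have "d * f \<le> \<bar>d\<bar> * \<bar>f\<bar>" by (metis abs_ge_self abs_mult)
      also have "\<dots> \<le> \<rho> * \<epsilon>" using that \<rho>(1) by (intro mult_mono) auto
      finally have "2 * (d * f) \<le> \<rho>\<^sup>2 / 4" by (simp add: \<epsilon>_def power2_eq_square)
      moreover have "f\<^sup>2 \<le> \<epsilon>\<^sup>2" using that \<epsilon> abs_le_square_iff[of f \<epsilon>] by simp
      then have "f\<^sup>2 \<le> \<rho>\<^sup>2 / 64" by (simp add: \<epsilon>_def power_divide)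
      ultimately show ?thesis by (simp add: power2_sum)
    qed
    have "N y \<le> ((p - k1)\<^sup>2 + \<rho>\<^sup>2 / 4 + \<rho>\<^sup>2 / 64) + ((q - k2)\<^sup>2 + \<rho>\<^sup>2 / 4 + \<rho>\<^sup>2 / 64)"
      unfolding N_def using one[OF ab(1), of "u y $ 1 - p"] one[OF ab(2), of "u y $ 2 - q"] that(2,3)
      by (intro add_mono) (auto simp: abs_minus_commute)
    also have "\<dots> \<le> 9 / 4 * \<rho>\<^sup>2" using s zero_le_power2[of \<rho>] by linarith
    finally show False using that(1) closure_subset[of U] by (auto simp: K_def)
  qed
  \<comment> \<open>The cross product of the position with the gradient offset from
    \<open>u x\<close>. Its gradient, paired with the rotated field \<open>(?Y, - ?Z)\<close> below,
    returns the linear term to be cancelled minus \<open>n2\<close> times the determinant.\<close>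
  define w where "w x p q = (q - k2) * x $ 1 - (p - k1) * x $ 2" for p q and x :: "real^2"
  define n2 where "n2 x = x $ 1 * x $ 1 + x $ 2 * x $ 2" for x :: "real^2"
  define g where "g p q = 2 * m p q ^ 4" for p q
  define H where "H x p q = 48 * (m p q ^ 2 * (w x p q * w x p q)) - 8 * (m p q ^ 3 * n2 x)" for x p q
  have gm: "has_grad2 (\<lambda>x. m (P x) (Q x) ^ n)
      (real n * m (P x) (Q x) ^ (n - 1) * (- 2 * ((P x - k1) * a + (Q x - k2) * b)))
      (real n * m (P x) (Q x) ^ (n - 1) * (- 2 * ((P x - k1) * b + (Q x - k2) * c))) x"
    if "n \<ge> 2" "has_grad2 P a b x" "has_grad2 Q b c x" for n x P Q a b c
    unfolding m_def power2_eq_square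
    by (rule has_grad2_pos_power[OF that(1)], rule has_grad2_eq, (rule has_grad2_intros that)+)
       (simp_all add: algebra_simps)
  have gw: "has_grad2 (\<lambda>x. w x (P x) (Q x)) (b * x $ 1 - a * x $ 2 + (Q x - k2)) (c * x $ 1 - b * x $ 2 - (P x - k1)) x"
    if "has_grad2 P a b x" "has_grad2 Q b c x" for x P Q a b c
    unfolding w_def
    by (rule has_grad2_eq, (rule has_grad2_intros that)+) (simp_all add: algebra_simps)
  have gn: "has_grad2 n2 (2 * x $ 1) (2 * x $ 2) x" for x
    unfolding n2_def by (rule has_grad2_eq, (rule has_grad2_intros)+) simp_all
  have cm: "continuous_on T (\<lambda>x. m (f x) (h x))" if "continuous_on T f" "continuous_on T h"
    for T and f h :: "'z::topological_space \<Rightarrow> real"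
    unfolding m_def by (intro continuous_intros that)
  have cw: "continuous_on T (\<lambda>x. w (h x) (f1 x) (f2 x))"
    if "continuous_on T f1" "continuous_on T f2" "continuous_on T h"
    for T and f1 f2 :: "'z::topological_space \<Rightarrow> real" and h
    unfolding w_def by (intro continuous_intros that)
  have cn: "continuous_on T (\<lambda>x. n2 (h x))" if "continuous_on T h" for T and h :: "'z::topological_space \<Rightarrow> real^2"
    unfolding n2_def by (intro continuous_intros that)
  have "integral (cbox lo hi) (zext U (\<lambda>x. g (u x $ 1) (u x $ 2))) = 0"
  proof (rule null_integral[OF approx W continuous_on_subset[OF uc subset_UNIV] U(1) closure_subset \<open>compact K\<close> \<open>K \<subseteq> U\<close> Kbox \<epsilon>,
        where H = H and g = "\<lambda>x. g"
        and ?H1.0 = "\<lambda>x p q. 96 * m p q ^ 2 * w x p q * (q - k2) - 16 * m p q ^ 3 * x $ 1"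
        and ?H2.0 = "\<lambda>x p q. - 96 * m p q ^ 2 * w x p q * (p - k1) - 16 * m p q ^ 3 * x $ 2"
        and ?H3.0 = "\<lambda>x p q. - 192 * m p q * (p - k1) * w x p q ^ 2 - 96 * m p q ^ 2 * w x p q * x $ 2
          + 48 * m p q ^ 2 * (p - k1) * n2 x"
        and ?H4.0 = "\<lambda>x p q. - 192 * m p q * (q - k2) * w x p q ^ 2 + 96 * m p q ^ 2 * w x p q * x $ 1
          + 48 * m p q ^ 2 * (q - k2) * n2 x"])
    show "g p q = 0 \<and> H x p q = 0" if "x \<in> U - K" "\<bar>p - u x $ 1\<bar> \<le> \<epsilon>" "\<bar>q - u x $ 2\<bar> \<le> \<epsilon>" for x p q
      using supp[OF that] by (auto simp: g_def H_def)
  next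
    fix P Q :: "real^2 \<Rightarrow> real" and x a b c
    assume PQ: "has_grad2 P a b x" "has_grad2 Q b c x"
    let ?m = "m (P x) (Q x)" and ?w = "w x (P x) (Q x)"
    show "has_grad2 (\<lambda>x. H x (P x) (Q x))
      (96 * ?m ^ 2 * ?w * (Q x - k2) - 16 * ?m ^ 3 * x $ 1
       + (- 192 * ?m * (P x - k1) * ?w ^ 2 - 96 * ?m ^ 2 * ?w * x $ 2 + 48 * ?m ^ 2 * (P x - k1) * n2 x) * a
       + (- 192 * ?m * (Q x - k2) * ?w ^ 2 + 96 * ?m ^ 2 * ?w * x $ 1 + 48 * ?m ^ 2 * (Q x - k2) * n2 x) * b)
      (- 96 * ?m ^ 2 * ?w * (P x - k1) - 16 * ?m ^ 3 * x $ 2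
       + (- 192 * ?m * (P x - k1) * ?w ^ 2 - 96 * ?m ^ 2 * ?w * x $ 2 + 48 * ?m ^ 2 * (P x - k1) * n2 x) * b
       + (- 192 * ?m * (Q x - k2) * ?w ^ 2 + 96 * ?m ^ 2 * ?w * x $ 1 + 48 * ?m ^ 2 * (Q x - k2) * n2 x) * c) x"
      unfolding H_def
      by (rule has_grad2_eq, (rule gm[OF _ PQ] gw[OF PQ] gn has_grad2_diff has_grad2_cmult has_grad2_mult | simp)+)
         (simp_all add: eval_nat_numeral algebra_simps)
  next
    fix P Q a b c a1 a2 b2 c2
    assume "smooth_approx (closure U) u \<epsilon> P Q a b c a1 a2 b2 c2"
    then interpret smooth_approx "closure U" u \<epsilon> P Q a b c a1 a2 b2 c2 .
    have sub: "y \<in> closure U" if "y \<in> U" for y using that closure_subset by auto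
    note cs = continuous_on_subset[OF _ closure_subset]
    note cc = cs[OF cont_low(1)] cs[OF cont_low(2)] cs[OF cont_low(3)] cs[OF cont_low(4)] cs[OF cont_low(5)]
      cs[OF cont(1)] cs[OF cont(2)] cs[OF cont(3)] cs[OF cont(4)]
    let ?m = "\<lambda>x. m (P x) (Q x)" and ?w = "\<lambda>x. w x (P x) (Q x)"
    let ?m1 = "\<lambda>x. - 2 * ((P x - k1) * a x + (Q x - k2) * b x)"
      and ?m2 = "\<lambda>x. - 2 * ((P x - k1) * b x + (Q x - k2) * c x)"
      and ?w1 = "\<lambda>x. b x * x $ 1 - a x * x $ 2 + (Q x - k2)"
      and ?w2 = "\<lambda>x. c x * x $ 1 - b x * x $ 2 - (P x - k1)"
      and ?Y = "\<lambda>x. c x * x $ 2 + b x * x $ 1" and ?Z = "\<lambda>x. b x * x $ 2 + a x * x $ 1"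
    have G: "has_grad2 (\<lambda>x. ?m x ^ n) (real n * ?m x ^ (n - 1) * ?m1 x) (real n * ?m x ^ (n - 1) * ?m2 x) x"
      "has_grad2 ?w (?w1 x) (?w2 x) x"
      "has_grad2 ?Y (b2 x * x $ 2 + (a2 x * x $ 1 + b x)) (c2 x * x $ 2 + c x + b2 x * x $ 1) x"
      "has_grad2 ?Z (a2 x * x $ 2 + (a1 x * x $ 1 + a x)) (b2 x * x $ 2 + b x + a2 x * x $ 1) x"
      if "n \<ge> 2" "x \<in> U" for n x
      using gm[OF that(1) grad_P[OF sub[OF that(2)]] grad_Q[OF sub[OF that(2)]]]
        gw[OF grad_P[OF sub[OF that(2)]] grad_Q[OF sub[OF that(2)]]]
      apply (simp_all)
      by (rule has_grad2_eq, (rule has_grad2_add has_grad2_mult has_grad2_coord1 has_grad2_coord2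
            grad_a grad_b grad_c sub that)+, simp_all)+
    show "integral (cbox lo hi) (zext U (\<lambda>x. g (P x) (Q x) + H x (P x) (Q x) * (a x * c x - (b x)\<^sup>2))) = 0"
    proof (rule integral_divergence_zero[OF U(1) \<open>compact K\<close> \<open>K \<subseteq> U\<close> Kbox])
      fix x assume x: "x \<in> U"
      show "has_grad2 (\<lambda>x. ?m x ^ 4 * x $ 1 + 8 * (?m x ^ 3 * (?w x * ?Y x)))
        ((real 4 * ?m x ^ (4 - 1) * ?m1 x) * x $ 1 + ?m x ^ 4 * 1 + 8 * ((real 3 * ?m x ^ (3 - 1) * ?m1 x) * (?w x * ?Y x)
          + ?m x ^ 3 * (?w1 x * ?Y x + ?w x * (b2 x * x $ 2 + (a2 x * x $ 1 + b x)))))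
        ((real 4 * ?m x ^ (4 - 1) * ?m2 x) * x $ 1 + ?m x ^ 4 * 0 + 8 * ((real 3 * ?m x ^ (3 - 1) * ?m2 x) * (?w x * ?Y x)
          + ?m x ^ 3 * (?w2 x * ?Y x + ?w x * (c2 x * x $ 2 + c x + b2 x * x $ 1)))) x"
        by (rule G(1)[OF _ x] G(2)[OF order_refl x] G(3)[OF order_refl x] has_grad2_coord1
            has_grad2_add has_grad2_cmult has_grad2_mult | simp)+
      show "has_grad2 (\<lambda>x. ?m x ^ 4 * x $ 2 - 8 * (?m x ^ 3 * (?w x * ?Z x)))
        ((real 4 * ?m x ^ (4 - 1) * ?m1 x) * x $ 2 + ?m x ^ 4 * 0 - 8 * ((real 3 * ?m x ^ (3 - 1) * ?m1 x) * (?w x * ?Z x)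
          + ?m x ^ 3 * (?w1 x * ?Z x + ?w x * (a2 x * x $ 2 + (a1 x * x $ 1 + a x)))))
        ((real 4 * ?m x ^ (4 - 1) * ?m2 x) * x $ 2 + ?m x ^ 4 * 1 - 8 * ((real 3 * ?m x ^ (3 - 1) * ?m2 x) * (?w x * ?Z x)
          + ?m x ^ 3 * (?w2 x * ?Z x + ?w x * (b2 x * x $ 2 + b x + a2 x * x $ 1)))) x"
        by (rule G(1)[OF _ x] G(2)[OF order_refl x] G(4)[OF order_refl x] has_grad2_coord2
            has_grad2_diff has_grad2_cmult has_grad2_mult | simp)+
      show "g (P x) (Q x) + H x (P x) (Q x) * (a x * c x - (b x)\<^sup>2) =
        ((real 4 * ?m x ^ (4 - 1) * ?m1 x) * x $ 1 + ?m x ^ 4 * 1 + 8 * ((real 3 * ?m x ^ (3 - 1) * ?m1 x) * (?w x * ?Y x)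
          + ?m x ^ 3 * (?w1 x * ?Y x + ?w x * (b2 x * x $ 2 + (a2 x * x $ 1 + b x)))))
        + ((real 4 * ?m x ^ (4 - 1) * ?m2 x) * x $ 2 + ?m x ^ 4 * 1 - 8 * ((real 3 * ?m x ^ (3 - 1) * ?m2 x) * (?w x * ?Z x)
          + ?m x ^ 3 * (?w2 x * ?Z x + ?w x * (b2 x * x $ 2 + b x + a2 x * x $ 1))))"
        unfolding g_def H_def w_def n2_def by (simp add: eval_nat_numeral) algebra
    next
      fix x assume "x \<in> U - K"
      then show "?m x ^ 4 * x $ 1 + 8 * (?m x ^ 3 * (?w x * ?Y x)) = 0 \<and>
          ?m x ^ 4 * x $ 2 - 8 * (?m x ^ 3 * (?w x * ?Z x)) = 0"
        using supp[of x "P x" "Q x"] close[OF sub] by auto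
    qed (intro continuous_intros cm cw cc)+
  qed (unfold g_def split_beta, (intro continuous_intros cm cw cn)+)
  moreover have "continuous_on (cbox lo hi) (zext U (\<lambda>x. g (u x $ 1) (u x $ 2)))"
  proof (rule continuous_on_zext[OF U(1) \<open>compact K\<close> \<open>K \<subseteq> U\<close>])
    show "continuous_on U (\<lambda>x. g (u x $ 1) (u x $ 2))"
      unfolding g_def by (intro continuous_intros cm continuous_on_subset[OF uc subset_UNIV])
    show "g (u x $ 1) (u x $ 2) = 0" if "x \<in> U - K" for x
      using supp[OF that, of "u x $ 1" "u x $ 2"] \<epsilon> by (auto simp: g_def)
  qed
  ultimately have "g (u x $ 1) (u x $ 2) = 0"
    by (rule zext_integral_zero_imp) (use x(1) box closure_subset in \<open>auto simp: g_def m_def\<close>)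
  then show False using \<rho>(1) by (simp add: g_def m_def k)
qed

section \<open>Plane topology\<close>

lemma inner_real2: "v \<bullet> w = v $ 1 * w $ 1 + v $ 2 * w $ 2" for v w :: "real^2"
  by (simp add: inner_vec_def sum_2)

lemma orthogonal_decomposition:
  fixes v \<tau> e :: "real^2"
  assumes "e \<bullet> \<tau> = 0" "e \<noteq> 0" "\<tau> \<noteq> 0"
  shows "v = (v \<bullet> \<tau> / (\<tau> \<bullet> \<tau>)) *\<^sub>R \<tau> + (v \<bullet> e / (e \<bullet> e)) *\<^sub>R e"
proof -
  define w where "w = v - ((v \<bullet> \<tau> / (\<tau> \<bullet> \<tau>)) *\<^sub>R \<tau> + (v \<bullet> e / (e \<bullet> e)) *\<^sub>R e)"
  have w: "w \<bullet> \<tau> = 0" "w \<bullet> e = 0"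
    using assms by (simp_all add: w_def inner_diff_left inner_add_left inner_commute[of \<tau> e])
  have J: "e $ 1 * \<tau> $ 2 - e $ 2 * \<tau> $ 1 \<noteq> 0"
  proof
    assume "e $ 1 * \<tau> $ 2 - e $ 2 * \<tau> $ 1 = 0"
    then have "(e \<bullet> e) * (\<tau> \<bullet> \<tau>) = (e \<bullet> \<tau>)\<^sup>2"
      unfolding inner_real2 by algebra
    then show False using assms by simp
  qed
  have "w $ 1 * (e $ 1 * \<tau> $ 2 - e $ 2 * \<tau> $ 1) = (w \<bullet> e) * \<tau> $ 2 - (w \<bullet> \<tau>) * e $ 2"
    "w $ 2 * (e $ 1 * \<tau> $ 2 - e $ 2 * \<tau> $ 1) = (w \<bullet> \<tau>) * e $ 1 - (w \<bullet> e) * \<tau> $ 1"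
    unfolding inner_real2 by algebra+
  then have "w = 0" using J w by (simp add: vec_eq_iff forall_2)
  then show ?thesis by (simp add: w_def)
qed

lemma plane_eqI:
  fixes v w \<tau> e :: "real^2"
  assumes et: "e \<bullet> \<tau> = 0" "e \<noteq> 0" "\<tau> \<noteq> 0" and eq: "v \<bullet> \<tau> = w \<bullet> \<tau>" "v \<bullet> e = w \<bullet> e"
  shows "v = w"
proof -
  note orthogonal_decomposition[OF et, of v]
  also have "(v \<bullet> \<tau> / (\<tau> \<bullet> \<tau>)) *\<^sub>R \<tau> + (v \<bullet> e / (e \<bullet> e)) *\<^sub>R e
      = (w \<bullet> \<tau> / (\<tau> \<bullet> \<tau>)) *\<^sub>R \<tau> + (w \<bullet> e / (e \<bullet> e)) *\<^sub>R e"
    by (simp only: eq)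
  also note orthogonal_decomposition[OF et, of w, symmetric]
  finally show ?thesis .
qed

lemma norm_ge_component:
  fixes v d :: "'a::real_inner"
  assumes "v \<bullet> d > R * norm d"
  shows "norm v > R"
proof (rule ccontr)
  assume "\<not> norm v > R"
  then have "norm v * norm d \<le> R * norm d" by (intro mult_right_mono) auto
  then show False using norm_cauchy_schwarz[of v d] assms by linarith
qed

text \<open>Outside a disc one can always reach a far point straight above \<open>p\<close> by moving
  sideways away from the disc, then up, then sideways again.\<close>

lemma outside_disc_connected_to_top:
  fixes c p q \<tau> e :: "real^2"
  assumes et: "e \<bullet> \<tau> = 0" "e \<noteq> 0" "\<tau> \<noteq> 0" and q: "q \<notin> cball c R" "e \<bullet> p < e \<bullet> q"
    and M: "R * norm e < (p + M *\<^sub>R e - c) \<bullet> e" "0 < M"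
  obtains S where "connected S" "S \<subseteq> {x. e \<bullet> p < e \<bullet> x} - cball c R" "q \<in> S" "p + M *\<^sub>R e \<in> S"
proof -
  \<comment> \<open>Sideways means the direction in which \<open>q\<close> already lies relative to
    \<open>c\<close>, so the first move never decreases the distance to the centre.\<close>
  define \<sigma> :: real where "\<sigma> = (if 0 \<le> (q - c) \<bullet> \<tau> then 1 else - 1)"
  have \<sigma>: "0 \<le> (q - c) \<bullet> (\<sigma> *\<^sub>R \<tau>)" "norm (\<sigma> *\<^sub>R \<tau>) = norm \<tau>" "\<sigma> * \<sigma> = 1" by (auto simp: \<sigma>_def)
  define \<tau>' where "\<tau>' = \<sigma> *\<^sub>R \<tau>"
  have \<tau>': "e \<bullet> \<tau>' = 0" "\<tau>' \<noteq> 0" "0 \<le> (q - c) \<bullet> \<tau>'"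
    using et \<sigma> by (auto simp: \<tau>'_def \<sigma>_def)
  have tt: "\<tau>' \<bullet> \<tau>' > 0" and ee: "e \<bullet> e > 0" using \<tau>' et by auto
  \<comment> \<open>Far enough that the component of \<open>q1 - c\<close> along
    \<open>\<tau>'\<close> alone exceeds the radius; the vertical move, which preserves this
    component, then stays outside the disc.\<close>
  define t1 where "t1 = (\<bar>R\<bar> * norm \<tau>' + 1) / (\<tau>' \<bullet> \<tau>')"
  have "t1 > 0" using tt by (simp add: t1_def add_nonneg_pos)
  define q1 where "q1 = q + t1 *\<^sub>R \<tau>'"
  have "R * norm \<tau>' \<le> \<bar>R\<bar> * norm \<tau>'" by (intro mult_right_mono) auto
  moreover have "t1 * (\<tau>' \<bullet> \<tau>') = \<bar>R\<bar> * norm \<tau>' + 1" using tt by (simp add: t1_def)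
  ultimately have q1: "R * norm \<tau>' < (q1 - c) \<bullet> \<tau>'"
    using \<tau>'(3) by (simp add: q1_def inner_diff_left inner_add_left)
  define s1 where "s1 = (p + M *\<^sub>R e - q) \<bullet> e / (e \<bullet> e)"
  define q2 where "q2 = q1 + s1 *\<^sub>R e"
  have q2: "q2 \<bullet> e = (p + M *\<^sub>R e) \<bullet> e"
  proof -
    have "s1 * (e \<bullet> e) = (p + M *\<^sub>R e - q) \<bullet> e" using ee by (simp add: s1_def)
    moreover have "\<tau>' \<bullet> e = 0" using \<tau>'(1) by (simp add: inner_commute)
    ultimately show ?thesis by (simp add: q2_def q1_def inner_add_left inner_diff_left)
  qed
  define S where "S = closed_segment q q1 \<union> closed_segment q1 q2 \<union> closed_segment q2 (p + M *\<^sub>R e)"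
  have "connected S" unfolding S_def
    by (intro connected_Un connected_segment) auto
  moreover have "closed_segment q q1 \<subseteq> {x. e \<bullet> p < e \<bullet> x} - cball c R"
  proof
    fix x assume "x \<in> closed_segment q q1"
    then obtain l where l: "0 \<le> l" "x = (1 - l) *\<^sub>R q + l *\<^sub>R q1" by (auto simp: in_segment)
    then have x: "x = q + (l * t1) *\<^sub>R \<tau>'" by (simp add: q1_def algebra_simps)
    have "(norm (q - c))\<^sup>2 \<le> (norm (x - c))\<^sup>2"
    proof -
      have "(norm (x - c))\<^sup>2 = (norm (q - c))\<^sup>2 + 2 * (l * t1) * ((q - c) \<bullet> \<tau>') + (l * t1)\<^sup>2 * (\<tau>' \<bullet> \<tau>')"
        unfolding power2_norm_eq_inner x
        by (simp add: algebra_simps inner_commute power2_eq_square)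
      then show ?thesis using l(1) \<open>t1 > 0\<close> \<tau>'(3) by simp
    qed
    then have "norm (q - c) \<le> norm (x - c)" by (simp add: power2_le_iff_abs_le)
    moreover have "e \<bullet> x = e \<bullet> q" using x \<tau>' by (simp add: inner_add_right)
    ultimately show "x \<in> {x. e \<bullet> p < e \<bullet> x} - cball c R"
      using q by (simp add: dist_norm norm_minus_commute)
  qed
  moreover have "closed_segment q1 q2 \<subseteq> {x. e \<bullet> p < e \<bullet> x} - cball c R"
  proof
    fix x assume "x \<in> closed_segment q1 q2"
    then obtain l where l: "0 \<le> l" "l \<le> 1" "x = (1 - l) *\<^sub>R q1 + l *\<^sub>R q2" by (auto simp: in_segment)
    then have x: "x = q1 + (l * s1) *\<^sub>R e" by (simp add: q2_def algebra_simps)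
    have "(x - c) \<bullet> \<tau>' = (q1 - c) \<bullet> \<tau>'" using x \<tau>' by (simp add: inner_add_left inner_diff_left)
    then have "norm (x - c) > R" using q1 norm_ge_component by metis
    moreover have "e \<bullet> p < e \<bullet> x"
    proof -
      have q1e: "e \<bullet> p < e \<bullet> q1" using q(2) \<tau>'(1) by (simp add: q1_def inner_add_right)
      have q2e: "e \<bullet> p < e \<bullet> q2" using q2 M(2) ee by (simp add: inner_commute inner_add_right inner_add_left)
      have "closed_segment q1 q2 \<subseteq> {x. e \<bullet> x > e \<bullet> p}"
        using q1e q2e by (intro closed_segment_subset convex_halfspace_gt) auto
      then show ?thesis using \<open>x \<in> closed_segment q1 q2\<close> by auto
    qed
    ultimately show "x \<in> {x. e \<bullet> p < e \<bullet> x} - cball c R"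
      by (simp add: dist_norm norm_minus_commute)
  qed
  moreover have "closed_segment q2 (p + M *\<^sub>R e) \<subseteq> {x. e \<bullet> p < e \<bullet> x} - cball c R"
  proof
    fix x assume "x \<in> closed_segment q2 (p + M *\<^sub>R e)"
    then obtain l where l: "x = (1 - l) *\<^sub>R q2 + l *\<^sub>R (p + M *\<^sub>R e)" by (auto simp: in_segment)
    have "x \<bullet> e = (1 - l) * (q2 \<bullet> e) + l * ((p + M *\<^sub>R e) \<bullet> e)"
      unfolding l by (simp only: inner_add_left inner_scaleR_left)
    also have "\<dots> = (p + M *\<^sub>R e) \<bullet> e" unfolding q2 by (simp add: algebra_simps)
    finally have x: "x \<bullet> e = (p + M *\<^sub>R e) \<bullet> e" .
    then have "R * norm e < (x - c) \<bullet> e" using M(1) by (simp add: inner_diff_left)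
    then have "norm (x - c) > R" by (rule norm_ge_component)
    moreover have "e \<bullet> p < e \<bullet> x"
      using x M(2) ee by (simp add: inner_commute inner_add_right inner_add_left)
    ultimately show "x \<in> {x. e \<bullet> p < e \<bullet> x} - cball c R"
      by (simp add: dist_norm norm_minus_commute)
  qed
  ultimately show ?thesis by (intro that[of S]) (auto simp: S_def)
qed

text \<open>All components that leave the disc on one side contain the same far points of the normal
  through \<open>p\<close>. This fixes where a curve through such a component can be made to
  end.\<close>

lemma reaches_top:
  fixes c p q \<tau> e :: "real^2"
  assumes et: "e \<bullet> \<tau> = 0" "e \<noteq> 0" "\<tau> \<noteq> 0" and "C \<subseteq> cball c R"
    and W: "W = connected_component_set ({x. e \<bullet> p < e \<bullet> x} - C) w" and q: "q \<in> W" "q \<notin> cball c R"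
    and M: "R * norm e < (p + M *\<^sub>R e - c) \<bullet> e" "0 < M"
  shows "p + M *\<^sub>R e \<in> W"
proof -
  have "e \<bullet> p < e \<bullet> q" using q(1) connected_component_subset unfolding W by fastforce
  then obtain S where S: "connected S" "S \<subseteq> {x. e \<bullet> p < e \<bullet> x} - cball c R" "q \<in> S" "p + M *\<^sub>R e \<in> S"
    using outside_disc_connected_to_top[OF et q(2) _ M] by blast
  have "connected_component ({x. e \<bullet> p < e \<bullet> x} - C) q (p + M *\<^sub>R e)"
    unfolding connected_component_def using S assms(4) by blast
  then show ?thesis using q(1) unfolding W by (auto intro: connected_component_trans)
qed


text \<open>If both components left the disc, they would contain all far points of the normal
  through \<open>p\<close>. Joined by a short segment through \<open>p\<close> they carry a crossing
  curve from below to above that avoids \<open>C\<close> and meets the line through \<open>p\<close>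
  along \<open>\<tau>\<close> only in \<open>p\<close>. On the other hand \<open>C\<close>, slightly
  thickened and prolonged along this line beyond its two given points, contains a crossing from left
  to right. The Fashoda theorem makes the two crossings meet, and there is no place for
  that.\<close>

lemma half_plane_component_in_disc:
  fixes C :: "(real^2) set" and \<tau> e p a b c :: "real^2"
  assumes et: "e \<bullet> \<tau> = 0" "e \<noteq> 0" "\<tau> \<noteq> 0" and C: "compact C" "connected C" "C \<subseteq> cball c R"
    and ab: "p - s1 *\<^sub>R \<tau> \<in> C" "p + s2 *\<^sub>R \<tau> \<in> C" "0 < s1" "0 < s2"
    and r: "0 < r" "\<And>s. \<bar>s\<bar> \<le> r \<Longrightarrow> p + s *\<^sub>R e \<notin> C"
  shows "connected_component_set ({x. e \<bullet> p < e \<bullet> x} - C) (p + r *\<^sub>R e) \<subseteq> cball c R \<or>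
    connected_component_set ({x. (- e) \<bullet> p < (- e) \<bullet> x} - C) (p + r *\<^sub>R (- e)) \<subseteq> cball c R"
proof (rule ccontr)
  assume no: "\<not> ?thesis"
  define W where "W = connected_component_set ({x. e \<bullet> p < e \<bullet> x} - C) (p + r *\<^sub>R e)"
  define W' where "W' = connected_component_set ({x. (- e) \<bullet> p < (- e) \<bullet> x} - C) (p + r *\<^sub>R (- e))"
  obtain q q' where q: "q \<in> W" "q \<notin> cball c R" "q' \<in> W'" "q' \<notin> cball c R"
    using no unfolding W_def W'_def by blast
  have ee: "e \<bullet> e > 0" and tt: "\<tau> \<bullet> \<tau> > 0" using et by auto
  have te: "\<tau> \<bullet> e = 0" using et(1) by (simp add: inner_commute)
  \<comment> \<open>From this height on, the component along \<open>e\<close> alone puts the points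
    \<open>p + M *\<^sub>R e\<close> and \<open>p - M *\<^sub>R e\<close> outside the disc.\<close>
  define M0 where "M0 = (\<bar>R\<bar> * norm e + \<bar>(p - c) \<bullet> e\<bar> + 1) / (e \<bullet> e)"
  have "M0 > 0" unfolding M0_def using ee by (intro divide_pos_pos) (auto intro: add_nonneg_pos)
  have M0: "R * norm e < (p + M *\<^sub>R e - c) \<bullet> e" "R * norm e < (p + M *\<^sub>R (- e) - c) \<bullet> (- e)" if "M \<ge> M0" for M
  proof -
    have "M0 * (e \<bullet> e) = \<bar>R\<bar> * norm e + \<bar>(p - c) \<bullet> e\<bar> + 1" using ee by (simp add: M0_def)
    moreover have "M0 * (e \<bullet> e) \<le> M * (e \<bullet> e)" using that ee by (intro mult_right_mono) auto
    moreover have "R * norm e \<le> \<bar>R\<bar> * norm e" by (intro mult_right_mono) auto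
    ultimately show "R * norm e < (p + M *\<^sub>R e - c) \<bullet> e" "R * norm e < (p + M *\<^sub>R (- e) - c) \<bullet> (- e)"
      by (simp_all add: inner_add_left inner_diff_left)
  qed
  have top: "p + M *\<^sub>R e \<in> W" "p - M *\<^sub>R e \<in> W'" if "M \<ge> M0" for M
    using reaches_top[OF et C(3) W_def q(1,2) M0(1)[OF that]]
      reaches_top[OF _ _ et(3) C(3) W'_def q(3,4) _ , of M] M0(2)[OF that] et \<open>M0 > 0\<close> that
    by auto
  define \<Gamma> where "\<Gamma> = W' \<union> closed_segment (p - r *\<^sub>R e) (p + r *\<^sub>R e) \<union> W"
  have Cc: "closed C" using C(1) compact_imp_closed by blast
  have openH: "open ({x. v \<bullet> p < v \<bullet> x} - C)" for v
    by (intro open_Diff open_Collect_less continuous_intros Cc)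
  have pW: "p + r *\<^sub>R e \<in> W" "p - r *\<^sub>R e \<in> W'"
    using top[OF order_refl] connected_component_in unfolding W_def W'_def
    by (auto simp: connected_component_refl_eq dest: connected_component_in)
  have sub: "W \<subseteq> {x. e \<bullet> p < e \<bullet> x} - C" "W' \<subseteq> {x. (- e) \<bullet> p < (- e) \<bullet> x} - C"
    unfolding W_def W'_def by (rule connected_component_subset)+
  have "path_connected W" "path_connected W'"
    unfolding W_def W'_def
    by (intro connected_open_path_connected open_connected_component openH connected_connected_component)+
  then have "path_connected \<Gamma>" unfolding \<Gamma>_def
    using pW by (intro path_connected_Un) auto
  have line: "x \<in> {p}" if "x \<in> \<Gamma>" "e \<bullet> x = e \<bullet> p" for x
  proof -
    have "x \<in> closed_segment (p - r *\<^sub>R e) (p + r *\<^sub>R e)" using that sub by (auto simp: \<Gamma>_def)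
    then obtain l where "x = (1 - l) *\<^sub>R (p - r *\<^sub>R e) + l *\<^sub>R (p + r *\<^sub>R e)" by (auto simp: in_segment)
    then have x: "x = p + ((2 * l - 1) * r) *\<^sub>R e" by (simp add: vec_eq_iff algebra_simps)
    then have "((2 * l - 1) * r) * (e \<bullet> e) = 0" using that(2) by (simp add: inner_add_right)
    then show ?thesis using x ee by simp
  qed
  have \<Gamma>C: "x \<notin> C" if "x \<in> \<Gamma>" for x
  proof (cases "x \<in> closed_segment (p - r *\<^sub>R e) (p + r *\<^sub>R e)")
    case True
    then obtain l where l: "0 \<le> l" "l \<le> 1" "x = (1 - l) *\<^sub>R (p - r *\<^sub>R e) + l *\<^sub>R (p + r *\<^sub>R e)"
      by (auto simp: in_segment)
    then have "x = p + ((2 * l - 1) * r) *\<^sub>R e" by (simp add: vec_eq_iff algebra_simps)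
    moreover have "\<bar>(2 * l - 1) * r\<bar> \<le> r" using l r(1)
      by (simp add: abs_mult)
    ultimately show ?thesis using r(2) by simp
  qed (use that sub in \<open>auto simp: \<Gamma>_def\<close>)
  obtain \<gamma> where \<gamma>: "path \<gamma>" "path_image \<gamma> \<subseteq> \<Gamma>" "pathstart \<gamma> = p - M0 *\<^sub>R e" "pathfinish \<gamma> = p + M0 *\<^sub>R e"
    using \<open>path_connected \<Gamma>\<close> top[OF order_refl] unfolding path_connected_def \<Gamma>_def by blast
  \<comment> \<open>A curve with its two vertical rays, in place of \<open>\<Gamma>\<close>: it is
    closed, so it has positive distance from the compact set \<open>C\<close>, while the open pieces
    of \<open>\<Gamma>\<close> may touch \<open>C\<close> with their closure.\<close>
  define T where "T = path_image \<gamma> \<union> (\<lambda>s. p + s *\<^sub>R e) ` ({..- M0} \<union> {M0..})"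
  have "closed ((\<lambda>s. p + s *\<^sub>R e) ` ({..- M0} \<union> {M0..}))"
  proof -
    have "closed ((\<lambda>s. s *\<^sub>R e) ` ({..- M0} \<union> {M0..}))"
      by (intro closed_injective_linear_image bounded_linear.linear[OF bounded_linear_scaleR_left] closed_Un) (use et(2) in \<open>auto intro: injI\<close>)
    then show ?thesis using closed_translation[of "(\<lambda>s. s *\<^sub>R e) ` ({..- M0} \<union> {M0..})" p]
      by (simp add: image_image)
  qed
  then have "closed T" unfolding T_def using \<gamma>(1) by (intro closed_Un closed_path_image)
  have "T \<subseteq> \<Gamma>"
  proof -
    have "p + s *\<^sub>R e \<in> \<Gamma>" if "s \<le> - M0 \<or> M0 \<le> s" for s
      using that top(1)[of s] top(2)[of "- s"] by (auto simp: \<Gamma>_def)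
    then show ?thesis using \<gamma>(2) by (auto simp: T_def)
  qed
  then have "T \<inter> C = {}" using \<Gamma>C by auto
  then obtain \<delta> where \<delta>: "\<delta> > 0" "\<And>x y. x \<in> C \<Longrightarrow> y \<in> T \<Longrightarrow> \<delta> \<le> dist x y"
    using separate_compact_closed[OF C(1) \<open>closed T\<close>] by (metis inf_commute)
  \<comment> \<open>A connected compact set need not be path connected, but its open
    \<open>\<delta>\<close>-neighbourhood is, and the choice of \<open>\<delta>\<close> keeps it off
    \<open>T\<close>.\<close>
  define N where "N = (\<Union>x\<in>C. ball x \<delta>)"
  have "connected (\<Union>x\<in>C. ball x \<delta> \<union> C)"
  proof (rule connected_Union)
    show "connected S" if "S \<in> (\<lambda>x. ball x \<delta> \<union> C) ` C" for S
    proof -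
      obtain x where "x \<in> C" "S = ball x \<delta> \<union> C" using \<open>S \<in> _\<close> by auto
      moreover then have "x \<in> ball x \<delta> \<inter> C" using \<delta>(1) by simp
      ultimately show ?thesis using C(2) by (metis connected_Un connected_ball emptyE)
    qed
    show "\<Inter> ((\<lambda>x. ball x \<delta> \<union> C) ` C) \<noteq> {}" using ab(1) by auto
  qed
  moreover have "(\<Union>x\<in>C. ball x \<delta> \<union> C) = N" using \<delta>(1) by (auto simp: N_def)
  ultimately have "path_connected N"
    by (simp add: connected_open_path_connected N_def open_UN)
  then obtain \<beta> where \<beta>: "path \<beta>" "path_image \<beta> \<subseteq> N" "pathstart \<beta> = p - s1 *\<^sub>R \<tau>" "pathfinish \<beta> = p + s2 *\<^sub>R \<tau>"
  proof -
    have "C \<subseteq> N" using \<delta>(1) centre_in_ball unfolding N_def by blast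
    then have "p - s1 *\<^sub>R \<tau> \<in> N" "p + s2 *\<^sub>R \<tau> \<in> N" using ab by auto
    then show ?thesis using \<open>path_connected N\<close> that unfolding path_connected_def by blast
  qed
  have NT: "N \<inter> T = {}" using \<delta>(2) by (force simp: N_def)
  \<comment> \<open>Linear coordinates with origin \<open>p\<close> in which \<open>\<tau>\<close>
    and \<open>e\<close> become the axes, as the coordinate form of the Fashoda theorem
    requires.\<close>
  define f :: "real^2 \<Rightarrow> real^2" where "f x = ((x - p) \<bullet> \<tau> / (\<tau> \<bullet> \<tau>)) *\<^sub>R axis 1 1 + ((x - p) \<bullet> e / (e \<bullet> e)) *\<^sub>R axis 2 1" for x
  have f12: "f x $ 1 = (x - p) \<bullet> \<tau> / (\<tau> \<bullet> \<tau>)" "f x $ 2 = (x - p) \<bullet> e / (e \<bullet> e)" for x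
    by (simp_all add: f_def axis_def)
  have fc: "continuous_on A f" for A
    unfolding f_def using tt ee by (intro continuous_intros) auto
  have finj: "x = y" if "f x = f y" for x y
  proof -
    have "z - p = (f z $ 1) *\<^sub>R \<tau> + (f z $ 2) *\<^sub>R e" for z
      unfolding f12 by (rule orthogonal_decomposition[OF et])
    from this[of x] this[of y] that have "x - p = y - p" by simp
    then show ?thesis by simp
  qed
  have f0: "f (p + x *\<^sub>R \<tau>) $ 1 = x" "f (p + x *\<^sub>R \<tau>) $ 2 = 0"
    "f (p + x *\<^sub>R e) $ 1 = 0" "f (p + x *\<^sub>R e) $ 2 = x" for x
    using ee tt te et(1) by (simp_all add: f12)
  have "bounded (f ` (path_image \<gamma> \<union> path_image \<beta>))"
    by (intro compact_imp_bounded compact_continuous_image fc compact_Un compact_path_image \<gamma> \<beta>)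
  then obtain B where B: "\<And>x. x \<in> path_image \<gamma> \<union> path_image \<beta> \<Longrightarrow> norm (f x) \<le> B"
    by (auto simp: bounded_iff)
  define M where "M = Max {\<bar>B\<bar>, M0, s1, s2}"
  have M: "\<bar>B\<bar> \<le> M" "M0 \<le> M" "s1 \<le> M" "s2 \<le> M" by (auto simp: M_def)
  define g where "g = linepath (p - M *\<^sub>R e) (p - M0 *\<^sub>R e) +++ \<gamma> +++ linepath (p + M0 *\<^sub>R e) (p + M *\<^sub>R e)"
  define h where "h = linepath (p - M *\<^sub>R \<tau>) (p - s1 *\<^sub>R \<tau>) +++ \<beta> +++ linepath (p + s2 *\<^sub>R \<tau>) (p + M *\<^sub>R \<tau>)"
  have seg: "closed_segment (p + x *\<^sub>R v) (p + y *\<^sub>R v) = (\<lambda>s. p + s *\<^sub>R v) ` {x..y}" if "x \<le> y" for x y :: real and v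
  proof -
    have "closed_segment (x *\<^sub>R v) (y *\<^sub>R v) = (\<lambda>s. s *\<^sub>R v) ` closed_segment x y"
      by (rule closed_segment_linear_image) (rule bounded_linear.linear[OF bounded_linear_scaleR_left])
    then have "closed_segment (p + x *\<^sub>R v) (p + y *\<^sub>R v) = (\<lambda>s. p + s *\<^sub>R v) ` closed_segment x y"
      by (simp add: closed_segment_translation image_image)
    then show ?thesis using that by (simp add: closed_segment_eq_real_ivl)
  qed
  have gi: "path_image g = (\<lambda>s. p + s *\<^sub>R e) ` {- M..- M0} \<union> (path_image \<gamma> \<union> (\<lambda>s. p + s *\<^sub>R e) ` {M0..M})"
    using seg[of "- M" "- M0" e] seg[of M0 M e] M \<gamma>(3,4) by (simp add: g_def path_image_join)
  have hi: "path_image h = (\<lambda>s. p + s *\<^sub>R \<tau>) ` {- M..- s1} \<union> (path_image \<beta> \<union> (\<lambda>s. p + s *\<^sub>R \<tau>) ` {s2..M})"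
    using seg[of "- M" "- s1" \<tau>] seg[of s2 M \<tau>] M \<beta>(3,4) by (simp add: h_def path_image_join)
  have gp: "path g" "path h" using \<gamma> \<beta> by (simp_all add: g_def h_def)
  define A :: "real^2" where "A = vector [- M, - M]"
  define B' :: "real^2" where "B' = vector [M, M]"
  have "M \<ge> 0" using M by linarith
  have inbox: "y \<in> cbox A B'" if "\<bar>y $ 1\<bar> \<le> M" "\<bar>y $ 2\<bar> \<le> M" for y
    using that by (auto simp: mem_box_cart forall_2 A_def B'_def)
  have inbox1: "\<bar>f x $ 1\<bar> \<le> M" "\<bar>f x $ 2\<bar> \<le> M" if "x \<in> path_image \<gamma> \<union> path_image \<beta>" for x
    using B[OF that] component_le_norm_cart[of "f x" 1] component_le_norm_cart[of "f x" 2] M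
    by linarith+
  obtain z where z: "z \<in> path_image (f \<circ> h)" "z \<in> path_image (f \<circ> g)"
  proof (rule fashoda[of "f \<circ> h" "f \<circ> g" A B'])
    show "path (f \<circ> h)" "path (f \<circ> g)" using gp fc by (auto intro: path_continuous_image)
    show "path_image (f \<circ> h) \<subseteq> cbox A B'" "path_image (f \<circ> g) \<subseteq> cbox A B'"
      unfolding path_image_compose hi gi
      using inbox1 M \<open>M0 > 0\<close> ab(3,4) by (auto simp: f0 intro!: inbox)
    have st: "pathstart h = p + (- M) *\<^sub>R \<tau>" "pathfinish h = p + M *\<^sub>R \<tau>"
      "pathstart g = p + (- M) *\<^sub>R e" "pathfinish g = p + M *\<^sub>R e"
      by (simp_all add: g_def h_def)
    show "pathstart (f \<circ> h) $ 1 = A $ 1" "pathfinish (f \<circ> h) $ 1 = B' $ 1"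
      "pathstart (f \<circ> g) $ 2 = A $ 2" "pathfinish (f \<circ> g) $ 2 = B' $ 2"
      unfolding pathstart_compose pathfinish_compose st f0 by (simp_all add: A_def B'_def)
  qed
  then obtain x where x: "x \<in> path_image h" "x \<in> path_image g"
    unfolding path_image_compose using finj by auto
  have "path_image g \<subseteq> T" unfolding gi T_def by auto
  then have "x \<in> T" using x by auto
  then have "x \<notin> path_image \<beta>" using NT \<beta>(2) by auto
  \<comment> \<open>What remains of the left-right crossing is its prolongation, which lies on the
    line through \<open>p\<close> and omits \<open>p\<close>; but \<open>p\<close> is the only point
    of \<open>\<Gamma>\<close> on that line.\<close>
  then obtain s where s: "x = p + s *\<^sub>R \<tau>" "s \<noteq> 0" using x(1) ab(3,4) unfolding hi by fastforce
  then have "e \<bullet> x = e \<bullet> p" using et(1) by (simp add: inner_add_right)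
  then have "x = p" using line \<open>x \<in> T\<close> \<open>T \<subseteq> \<Gamma>\<close> by auto
  then show False using s et(3) by simp
qed

section \<open>Level sets of the gradient\<close>

text \<open>The interface between analysis and geometry: the equation enters only through
  approximability on compact subsets of \<open>\<Omega>\<close>, while \<open>V\<close> and
  \<open>u\<close> live on the whole plane.\<close>

locale flat_gradient =
  fixes \<Omega> :: "(real^2) set" and V :: "real^2 \<Rightarrow> real" and u :: "real^2 \<Rightarrow> real^2"
  assumes grad_V: "has_grad2 V (u x $ 1) (u x $ 2) x"
    and cont_u: "continuous_on UNIV u"
    and approximable: "compact W \<Longrightarrow> W \<subseteq> \<Omega> \<Longrightarrow> det_approximable W u"
begin

text \<open>The one-sided principle for \<open>\<tau>\<close> and \<open>- \<tau>\<close>. Only the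
  component of \<open>u\<close> parallel to the edge of the half plane is controlled; the normal one
  has to be recovered otherwise.\<close>

lemma max_principle:
  assumes "open U" "bounded U" "closure U \<subseteq> \<Omega>" "e \<bullet> \<tau> = 0" "e \<noteq> 0"
    and "\<And>z. z \<in> frontier U \<Longrightarrow> s \<le> e \<bullet> z \<Longrightarrow> u z \<bullet> \<tau> = k" "x \<in> U" "s < e \<bullet> x"
  shows "u x \<bullet> \<tau> = k"
proof -
  have app: "det_approximable (closure U) u" using assms approximable by (simp add: compact_closure)
  have "u x \<bullet> \<tau> \<le> k"
    using half_plane_max_principle[OF app cont_u assms(1,2,4,5) _ assms(7,8), of k] assms(6) by auto
  moreover have "u x \<bullet> (- \<tau>) \<le> - k"
    using half_plane_max_principle[OF app cont_u assms(1,2) _ assms(5) _ assms(7,8), of "- \<tau>" "- k"] assms(4,6) by auto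
  ultimately show ?thesis by simp
qed

text \<open>Components are taken inside a closed disc, not in \<open>\<Omega>\<close>: the
  separation, limit and face arguments all rest on compactness.\<close>

definition level :: "real^2 \<Rightarrow> real \<Rightarrow> real^2 \<Rightarrow> (real^2) set" where
  "level c R x = connected_component_set {z \<in> cball c R. u z = u x} x"

lemma compact_level_set: "compact {z \<in> cball c R. u z = y}"
proof -
  have "{z \<in> cball c R. u z = y} = cball c R \<inter> {z. u z = y}" by auto
  moreover have "closed {z. u z = y}"
    by (intro closed_Collect_eq cont_u continuous_intros)
  ultimately show ?thesis by (simp add: compact_Int_closed)
qed

lemma level_props:
  assumes "x \<in> cball c R"
  shows "x \<in> level c R x" "connected (level c R x)" "compact (level c R x)"
    "level c R x \<subseteq> cball c R" "z \<in> level c R x \<Longrightarrow> u z = u x"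
proof -
  show "x \<in> level c R x" using assms by (simp add: level_def)
  show "connected (level c R x)" by (simp add: level_def)
  have "level c R x \<subseteq> {z \<in> cball c R. u z = u x}"
    unfolding level_def by (rule connected_component_subset)
  then show "level c R x \<subseteq> cball c R" "z \<in> level c R x \<Longrightarrow> u z = u x" by auto
  have "closed (level c R x)"
    unfolding level_def by (intro closed_connected_component compact_imp_closed compact_level_set)
  then show "compact (level c R x)"
    using \<open>level c R x \<subseteq> cball c R\<close> by (meson bounded_cball bounded_subset compact_eq_bounded_closed)
qed

text \<open>A component inside the open disc would, by the Sura-Bura theorem, sit in a compact
  relatively clopen piece \<open>K\<close> of the level set inside the disc. A thin neighbourhood of
  \<open>K\<close> then has no point of the level set on its frontier, against
  \<open>level_set_meets_frontier\<close>.\<close>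

lemma level_meets_sphere:
  assumes R: "cball c R \<subseteq> \<Omega>" and x: "x \<in> cball c R"
  shows "\<exists>z\<in>level c R x. z \<in> sphere c R"
proof (rule ccontr)
  assume no: "\<not> ?thesis"
  define S where "S = {z \<in> cball c R. u z = u x}"
  define C where "C = level c R x"
  note C = level_props[OF x, folded C_def]
  have S: "compact S" unfolding S_def by (rule compact_level_set)
  have "C \<in> components S" using x by (auto simp: C_def S_def level_def components_def)
  moreover have "C \<subseteq> ball c R"
    using no C(4) unfolding C_def[symmetric] by (auto simp: subset_iff less_le)
  ultimately obtain K where K: "openin (top_of_set S) K" "compact K" "C \<subseteq> K" "K \<subseteq> ball c R"
    using Sura_Bura_clopen_subset[OF closed_imp_locally_compact[OF compact_imp_closed[OF S]] _ C(3) open_ball]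
    by metis
  have "K \<subseteq> S" using K(1) by (rule openin_imp_subset)
  have "closedin (top_of_set S) (S - K)"
    using K(1) \<open>K \<subseteq> S\<close> by (simp add: closedin_def double_diff)
  then have "closed (S - K)" using S closedin_closed_trans compact_imp_closed by blast
  then have "closed ((S - K) \<union> - ball c R)" by (intro closed_Un) auto
  moreover have "K \<inter> ((S - K) \<union> - ball c R) = {}" using K(4) by auto
  ultimately obtain d where d: "d > 0" "\<forall>y\<in>K. \<forall>z\<in>(S - K) \<union> - ball c R. d \<le> dist y z"
    using separate_compact_closed[OF K(2)] by metis
  have "K \<noteq> {}" using C(1) K(3) by auto
  \<comment> \<open>At half the separation \<open>d\<close>, the closure of \<open>U\<close> reaches
    neither the rest of the level set nor the circle, and \<open>K\<close> itself lies inside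
    \<open>U\<close>.\<close>
  define U where "U = {y. infdist y K < d / 2}"
  have U: "open U" unfolding U_def by (intro open_Collect_less continuous_intros)
  have inU: "infdist z K \<le> d / 2 \<Longrightarrow> z \<notin> (S - K) \<union> - ball c R" for z
  proof
    assume z: "infdist z K \<le> d / 2" "z \<in> (S - K) \<union> - ball c R"
    obtain y where "infdist z K = dist z y" "y \<in> K"
      using infdist_attains_inf[OF compact_imp_closed[OF K(2)] \<open>K \<noteq> {}\<close>] by metis
    moreover have "d \<le> dist y z" using d(2) \<open>y \<in> K\<close> z(2) by blast
    ultimately show False using d(1) z(1) by (simp add: dist_commute)
  qed
  have "closure U \<subseteq> {y. infdist y K \<le> d / 2}"
    by (rule closure_minimal) (auto simp: U_def intro!: closed_Collect_le continuous_intros)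
  then have clU: "z \<in> closure U \<Longrightarrow> z \<notin> (S - K) \<union> - ball c R" for z using inU by auto
  then have cl: "closure U \<subseteq> ball c R" by auto
  have "bounded U" using bounded_subset[OF bounded_ball, of U c R] cl closure_subset[of U] by blast
  have app: "det_approximable (closure U) u"
  proof (rule approximable)
    show "closure U \<subseteq> \<Omega>" using cl R ball_subset_cball by blast
    show "compact (closure U)" using \<open>bounded U\<close> by (simp add: compact_closure)
  qed
  have "K \<subseteq> U" using d(1) by (auto simp: U_def)
  have "x \<in> U" using C(1) K(3) \<open>K \<subseteq> U\<close> by auto
  then obtain z where z: "z \<in> frontier U" "u z = u x"
    using level_set_meets_frontier[OF app cont_u U \<open>bounded U\<close>] by blast
  then have "z \<in> closure U" "z \<notin> U" using U by (auto simp: frontier_def interior_open)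
  then have "z \<in> S" using z(2) cl ball_subset_cball unfolding S_def by blast
  then show False using clU[OF \<open>z \<in> closure U\<close>] \<open>z \<notin> U\<close> \<open>K \<subseteq> U\<close> by auto
qed

text \<open>Above the line through \<open>p\<close> the frontier of the cap lies in
  \<open>C\<close>, so the maximum principle fixes \<open>u \<bullet> \<tau>\<close> in the cap.
  Since \<open>u\<close> is a gradient, a constant derivative of \<open>V\<close> along
  \<open>\<tau>\<close> makes the derivative along \<open>e\<close> constant on lines parallel to
  \<open>\<tau>\<close>. Such a line keeps its height and leaves the bounded cap through
  \<open>C\<close>, which fixes \<open>u \<bullet> e\<close>. Continuity carries the value to
  \<open>p\<close>.\<close>

lemma gradient_const_in_cap:
  assumes R: "cball c R \<subseteq> \<Omega>" and C: "closed C" "\<And>z. z \<in> C \<Longrightarrow> u z = y"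
    and et: "e \<bullet> \<tau> = 0" "e \<noteq> 0" "\<tau> \<noteq> 0"
    and r: "0 < r" "\<And>s. \<bar>s\<bar> \<le> r \<Longrightarrow> p + s *\<^sub>R e \<notin> C"
    and sub: "connected_component_set ({x. e \<bullet> p < e \<bullet> x} - C) (p + r *\<^sub>R e) \<subseteq> cball c R"
  shows "u p = y"
proof -
  define H where "H = {x. e \<bullet> p < e \<bullet> x} - C"
  define W where "W = connected_component_set H (p + r *\<^sub>R e)"
  have ee: "e \<bullet> e > 0" using et by simp
  have H: "open H" unfolding H_def by (intro open_Diff open_Collect_less continuous_intros C)
  have W: "open W" unfolding W_def by (intro open_connected_component H)
  have WR: "W \<subseteq> cball c R" using sub by (simp add: W_def H_def)
  have clW: "closure W \<subseteq> \<Omega>" using closure_minimal[OF WR closed_cball] R by (rule order_trans)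
  have bW: "bounded W" by (rule bounded_subset[OF bounded_cball WR])
  have WH: "W \<subseteq> H" unfolding W_def by (rule connected_component_subset)
  have up: "p + s *\<^sub>R e \<in> W" if "0 < s" "s \<le> r" for s
  proof -
    have inH: "p + t *\<^sub>R e \<in> H" if "0 < t" "t \<le> r" for t
      using that r(2)[of t] ee by (simp add: H_def inner_add_right)
    have "connected ((\<lambda>t. p + t *\<^sub>R e) ` {s..r})"
      by (intro connected_continuous_image continuous_intros) auto
    moreover have "(\<lambda>t. p + t *\<^sub>R e) ` {s..r} \<subseteq> H" using that inH by auto
    ultimately have "connected_component H (p + r *\<^sub>R e) (p + s *\<^sub>R e)"
      unfolding connected_component_def using that by (intro exI[of _ "(\<lambda>t. p + t *\<^sub>R e) ` {s..r}"]) auto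
    then show ?thesis by (simp add: W_def)
  qed
  have fr: "z \<in> C" if "z \<in> closure W" "z \<notin> W" "e \<bullet> p < e \<bullet> z" for z
  proof (rule ccontr)
    assume "z \<notin> C"
    then have "z \<in> H" using that by (simp add: H_def)
    then have "z \<in> connected_component_set H z \<inter> closure W" using that(1) by simp
    then have "connected_component_set H z \<inter> closure W \<noteq> {}" by (metis empty_iff)
    then have "connected_component_set H z \<inter> W \<noteq> {}"
      by (simp only: open_Int_closure_eq_empty[OF open_connected_component[OF H]] not_False_eq_True)
    then obtain w where "w \<in> W" "w \<in> connected_component_set H z" by (metis IntE ex_in_conv)
    then have 1: "connected_component H (p + r *\<^sub>R e) w" and "connected_component H z w"
      by (simp_all add: W_def)
    from connected_component_trans[OF 1 connected_component_sym[OF this(2)]]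
    have "z \<in> W" by (simp add: W_def)
    then show False using that(2) by simp
  qed
  have tau: "u q \<bullet> \<tau> = y \<bullet> \<tau>" if "q \<in> W" for q
  proof (rule max_principle[OF W bW clW et(1,2)])
    \<comment> \<open>The principle is applied to the half plane at the middle height between
      \<open>p\<close> and \<open>q\<close>, because frontier points of the cap on the line through
      \<open>p\<close> need not belong to \<open>C\<close>.\<close>
    have "e \<bullet> p < e \<bullet> q" using that WH by (auto simp: H_def)
    then show "(e \<bullet> q + e \<bullet> p) / 2 < e \<bullet> q" by simp
    fix z assume "z \<in> frontier W" "(e \<bullet> q + e \<bullet> p) / 2 \<le> e \<bullet> z"
    then have "z \<in> C" using fr[of z] W \<open>e \<bullet> p < e \<bullet> q\<close> by (auto simp: frontier_def interior_open)
    then show "u z \<bullet> \<tau> = y \<bullet> \<tau>" using C(2) by simp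
  qed (rule that)
  have slide: "u (q + t *\<^sub>R \<tau>) \<bullet> e = u q \<bullet> e"
    if "0 \<le> t" "\<And>t'. 0 \<le> t' \<Longrightarrow> t' \<le> t \<Longrightarrow> q + t' *\<^sub>R \<tau> \<in> W" for q t
  proof -
    define S where "S = (\<lambda>t'. q + t' *\<^sub>R \<tau>) ` {0..t}"
    have "compact S" unfolding S_def by (intro compact_continuous_image continuous_intros) auto
    moreover have "closed (- W)" "S \<inter> - W = {}" using W that(2) by (auto simp: S_def)
    ultimately obtain d where d: "d > 0" "\<forall>x\<in>S. \<forall>z\<in>- W. d \<le> dist x z"
      using separate_compact_closed by metis
    define d' where "d' = d / norm e"
    have "d' > 0" using d et by (simp add: d'_def)
    have inW: "q + t' *\<^sub>R \<tau> + s *\<^sub>R e \<in> W" if "0 \<le> t'" "t' \<le> t" "\<bar>s\<bar> < d'" for t' s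
    proof (rule ccontr)
      assume "q + t' *\<^sub>R \<tau> + s *\<^sub>R e \<notin> W"
      then have "d \<le> dist (q + t' *\<^sub>R \<tau>) (q + t' *\<^sub>R \<tau> + s *\<^sub>R e)" using d(2) that(1,2) by (auto simp: S_def)
      then have "d \<le> \<bar>s\<bar> * norm e" by (simp add: dist_norm)
      then show False using that(3) et(2) by (simp add: d'_def field_simps)
    qed
    have Vd: "((\<lambda>t'. V (q + t' *\<^sub>R \<tau> + s *\<^sub>R e)) has_real_derivative u (q + t' *\<^sub>R \<tau> + s *\<^sub>R e) \<bullet> \<tau>) (at t')" for t' s
      using has_grad2_line[of V _ _ "q + s *\<^sub>R e" t' \<tau>, OF grad_V] by (simp add: inner_real2 algebra_simps)
    have Ve: "((\<lambda>s. V (x + s *\<^sub>R e)) has_real_derivative u x \<bullet> e) (at 0)" for x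
      using has_grad2_line[of V _ _ x 0 e, OF grad_V] by (simp add: inner_real2)
    \<comment> \<open>The increment of \<open>V\<close> along \<open>\<tau>\<close> is the same at
      all nearby heights \<open>s\<close>; differentiating in \<open>s\<close> at 0 compares
      \<open>u \<bullet> e\<close> at the two ends.\<close>
    have const: "V (q + t *\<^sub>R \<tau> + s *\<^sub>R e) - V (q + s *\<^sub>R e) = t * (y \<bullet> \<tau>)" if "\<bar>s\<bar> < d'" for s
    proof (cases "t = 0")
      case False
      then have "0 < t" using \<open>0 \<le> t\<close> by simp
      then obtain \<xi> where "0 < \<xi>" "\<xi> < t"
        "V (q + t *\<^sub>R \<tau> + s *\<^sub>R e) - V (q + 0 *\<^sub>R \<tau> + s *\<^sub>R e) = (t - 0) * (u (q + \<xi> *\<^sub>R \<tau> + s *\<^sub>R e) \<bullet> \<tau>)"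
        using MVT2[of 0 t "\<lambda>t'. V (q + t' *\<^sub>R \<tau> + s *\<^sub>R e)" "\<lambda>t'. u (q + t' *\<^sub>R \<tau> + s *\<^sub>R e) \<bullet> \<tau>"] Vd by auto
      then show ?thesis using tau[OF inW[of \<xi> s]] that by simp
    qed simp
    have "((\<lambda>s. V (q + t *\<^sub>R \<tau> + s *\<^sub>R e) - V (q + s *\<^sub>R e)) has_real_derivative u (q + t *\<^sub>R \<tau>) \<bullet> e - u q \<bullet> e) (at 0)"
      by (intro DERIV_diff Ve)
    moreover have "((\<lambda>s. V (q + t *\<^sub>R \<tau> + s *\<^sub>R e) - V (q + s *\<^sub>R e)) has_real_derivative 0) (at 0)"
      by (rule has_field_derivative_transform_within_open[of "\<lambda>_. t * (y \<bullet> \<tau>)" _ _ "{-d'<..<d'}"])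
         (use \<open>d' > 0\<close> const in auto)
    ultimately show ?thesis using DERIV_unique by fastforce
  qed
  have e: "u q \<bullet> e = y \<bullet> e" if q: "q \<in> W" for q
  proof -
    define T where "T = {0..} \<inter> (\<lambda>t. q + t *\<^sub>R \<tau>) -` (- W)"
    have "closed T" unfolding T_def
      by (intro closed_Int closed_atLeast closed_vimage continuous_intros) (use W in auto)
    have "T \<noteq> {}"
    proof
      assume "T = {}"
      then have "q + t *\<^sub>R \<tau> \<in> W" if "0 \<le> t" for t using that by (auto simp: T_def)
      moreover obtain B where B: "\<And>z. z \<in> W \<Longrightarrow> norm z \<le> B" using bW by (auto simp: bounded_iff)
      ultimately have le: "norm (q + t *\<^sub>R \<tau>) \<le> B" if "0 \<le> t" for t using that by auto
      have "0 \<le> B" using le[of 0] norm_ge_zero order_trans by (metis order_refl)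
      define t where "t = (B + norm q + 1) / norm \<tau>"
      have t: "0 \<le> t" "t * norm \<tau> = B + norm q + 1" using et(3) \<open>0 \<le> B\<close> by (auto simp: t_def)
      have "t * norm \<tau> = norm ((q + t *\<^sub>R \<tau>) - q)" using t(1) by simp
      also have "\<dots> \<le> norm (q + t *\<^sub>R \<tau>) + norm q" by (rule norm_triangle_ineq4)
      finally show False using le[OF t(1)] t(2) by linarith
    qed
    \<comment> \<open>The first exit of the line from the cap; up to there the line is inside, so
      sliding is allowed, and the exit point lies in \<open>C\<close>.\<close>
    define t1 where "t1 = Inf T"
    have "bdd_below T" by (auto simp: T_def intro: bdd_belowI[of _ 0])
    then have t1: "t1 \<in> T" unfolding t1_def by (intro closed_contains_Inf \<open>T \<noteq> {}\<close> \<open>closed T\<close>)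
    have below: "q + t *\<^sub>R \<tau> \<in> W" if "0 \<le> t" "t < t1" for t
      using that cInf_lower[OF _ \<open>bdd_below T\<close>, of t] by (force simp: T_def t1_def)
    have "t1 > 0" using t1 q by (cases "t1 = 0") (auto simp: T_def)
    have cl: "t1 \<in> closure {0..<t1}" using \<open>t1 > 0\<close> by simp
    have "q + t1 *\<^sub>R \<tau> \<in> closure W"
    proof -
      have "(\<lambda>t. q + t *\<^sub>R \<tau>) ` closure {0..<t1} \<subseteq> closure W"
        by (rule image_closure_subset) (use below in \<open>auto intro!: continuous_intros subsetD[OF closure_subset[of W]]\<close>)
      then show ?thesis using cl by auto
    qed
    moreover have "e \<bullet> p < e \<bullet> (q + t1 *\<^sub>R \<tau>)" using q WH et(1) by (auto simp: H_def inner_add_right)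
    moreover have "q + t1 *\<^sub>R \<tau> \<notin> W" using t1 by (simp add: T_def)
    ultimately have "u (q + t1 *\<^sub>R \<tau>) = y" using fr C(2) by blast
    moreover have "u (q + t1 *\<^sub>R \<tau>) \<bullet> e = u q \<bullet> e"
    proof (rule continuous_constant_on_closure[OF _ _ cl, of "\<lambda>t. u (q + t *\<^sub>R \<tau>) \<bullet> e"])
      show "continuous_on (closure {0..<t1}) (\<lambda>t. u (q + t *\<^sub>R \<tau>) \<bullet> e)"
        by (intro continuous_intros continuous_on_compose2[OF cont_u]) auto
      show "u (q + t *\<^sub>R \<tau>) \<bullet> e = u q \<bullet> e" if "t \<in> {0..<t1}" for t
        using that below by (intro slide) auto
    qed
    ultimately show ?thesis by simp
  qed
  have uW: "u q = y" if "q \<in> W" for q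
    by (rule plane_eqI[OF et tau[OF that] e[OF that]])
  have cl: "0 \<in> closure {0<..<r}" using r(1) by simp
  have "u (p + 0 *\<^sub>R e) = y"
  proof (rule continuous_constant_on_closure[OF _ _ cl, of "\<lambda>t. u (p + t *\<^sub>R e)"])
    show "continuous_on (closure {0<..<r}) (\<lambda>t. u (p + t *\<^sub>R e))"
      by (intro continuous_intros continuous_on_compose2[OF cont_u]) auto
    show "u (p + t *\<^sub>R e) = y" if "t \<in> {0<..<r}" for t using that by (intro uW up) auto
  qed
  then show ?thesis by simp
qed

text \<open>If \<open>p\<close> is not in \<open>C\<close>, then \<open>a\<close> and
  \<open>b\<close> are points of the connected set \<open>C\<close> on both sides of
  \<open>p\<close>, so on one side of their line the component next to \<open>p\<close> is enclosed
  in the disc and forms a cap.\<close>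

lemma level_segment:
  assumes R: "cball c R \<subseteq> \<Omega>" and C: "compact C" "connected C" "C \<subseteq> cball c R"
    and y: "\<And>z. z \<in> C \<Longrightarrow> u z = y" and ab: "a \<in> C" "b \<in> C" and p: "p \<in> closed_segment a b"
  shows "u p = y"
proof (cases "p \<in> C")
  case False
  obtain t where t: "0 \<le> t" "t \<le> 1" "p = (1 - t) *\<^sub>R a + t *\<^sub>R b" using p by (auto simp: in_segment)
  have "a \<noteq> p" "b \<noteq> p" using False ab by auto
  then have t01: "0 < t" "t < 1" using t by (auto simp: less_le)
  define \<tau> where "\<tau> = b - a"
  have a: "a = p - t *\<^sub>R \<tau>" and b: "b = p + (1 - t) *\<^sub>R \<tau>"
    using t(3) by (simp_all add: \<tau>_def algebra_simps)
  have "\<tau> \<noteq> 0" using a \<open>a \<noteq> p\<close> by auto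
  define e :: "real^2" where "e = vector [- (\<tau> $ 2), \<tau> $ 1]"
  have et: "e \<bullet> \<tau> = 0" "e \<noteq> 0"
    using \<open>\<tau> \<noteq> 0\<close> by (auto simp: e_def inner_real2 vec_eq_iff forall_2)
  have "open (- C)" "p \<in> - C" using C(1) False compact_imp_closed by auto
  then obtain d where d: "d > 0" "ball p d \<subseteq> - C" using open_contains_ball by blast
  define r where "r = d / (2 * norm e)"
  have r: "r > 0" using d et by (simp add: r_def)
  have rC: "p + s *\<^sub>R e \<notin> C" if "\<bar>s\<bar> \<le> r" for s
  proof -
    have "\<bar>s\<bar> * norm e \<le> r * norm e" using that by (intro mult_right_mono) auto
    also have "\<dots> < d" using d et by (simp add: r_def)
    finally show ?thesis using d(2) by (auto simp: dist_norm subset_iff)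
  qed
  consider "connected_component_set ({x. e \<bullet> p < e \<bullet> x} - C) (p + r *\<^sub>R e) \<subseteq> cball c R"
    | "connected_component_set ({x. (- e) \<bullet> p < (- e) \<bullet> x} - C) (p + r *\<^sub>R (- e)) \<subseteq> cball c R"
    using half_plane_component_in_disc[OF et \<open>\<tau> \<noteq> 0\<close> C, of p t "1 - t" r] ab a b t01 r rC by auto
  then show ?thesis
  proof cases
    case 1
    show ?thesis
      by (rule gradient_const_in_cap[OF R compact_imp_closed[OF C(1)] y et \<open>\<tau> \<noteq> 0\<close> r rC 1])
  next
    case 2
    show ?thesis
    proof (rule gradient_const_in_cap[OF R compact_imp_closed[OF C(1)] y _ _ \<open>\<tau> \<noteq> 0\<close> r _ 2])
      show "p + s *\<^sub>R (- e) \<notin> C" if "\<bar>s\<bar> \<le> r" for s using rC[of "- s"] that by simp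
    qed (use et in auto)
  qed
qed (use y in auto)

lemma convex_level:
  assumes R: "cball c R \<subseteq> \<Omega>" and x: "x \<in> cball c R"
  shows "convex (level c R x)"
  unfolding convex_contains_segment
proof (intro ballI)
  fix a b assume ab: "a \<in> level c R x" "b \<in> level c R x"
  note L = level_props[OF x]
  have "u p = u x" if "p \<in> closed_segment a b" for p
    by (rule level_segment[OF R L(3,2,4,5) ab that])
  moreover have "closed_segment a b \<subseteq> cball c R" using ab L(4) by (intro closed_segment_subset) auto
  ultimately have "closed_segment a b \<subseteq> {z \<in> cball c R. u z = u x}" by auto
  then have "closed_segment a b \<subseteq> connected_component_set {z \<in> cball c R. u z = u x} a"
    by (intro connected_component_maximal) auto
  moreover have "connected_component_set {z \<in> cball c R. u z = u x} a = level c R x"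
    using connected_component_eq[OF ab(1)[unfolded level_def]] by (simp add: level_def)
  ultimately show "closed_segment a b \<subseteq> level c R x" by simp
qed

end

text \<open>Level sets may be mere segments, so empty interior has to be covered: then the set lies
  in a hyperplane, which supports it. Otherwise the point is separated from the interior, whose
  closure contains \<open>C\<close>.\<close>

lemma supporting_hyperplane_not_interior:
  fixes C :: "'a::euclidean_space set"
  assumes "convex C" "x \<in> C" "x \<notin> interior C"
  obtains a where "a \<noteq> 0" "\<And>z. z \<in> C \<Longrightarrow> a \<bullet> x \<le> a \<bullet> z"
proof (cases "interior C = {}")
  case True
  obtain a b where ab: "a \<noteq> 0" "C \<subseteq> {x. a \<bullet> x = b}"
    using empty_interior_subset_hyperplane[OF assms(1) True] by metis
  have "a \<bullet> z = b" if "z \<in> C" for z using ab(2) that by blast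
  from ab(1) show ?thesis by (rule that) (simp add: \<open>\<And>z. z \<in> C \<Longrightarrow> a \<bullet> z = b\<close> assms(2))
next
  case False
  have "{x} \<inter> interior C = {}" using assms(3) by simp
  then obtain a b where ab: "a \<noteq> 0" "\<forall>z\<in>{x}. a \<bullet> z \<le> b" "\<forall>z\<in>interior C. b \<le> a \<bullet> z"
    using separating_hyperplane_sets[OF convex_singleton convex_interior[OF assms(1)] _ False] by blast
  have "interior C \<subseteq> {z. a \<bullet> z \<ge> b}" using ab(3) by blast
  then have "closure (interior C) \<subseteq> {z. a \<bullet> z \<ge> b}" by (rule closure_minimal[OF _ closed_halfspace_ge])
  moreover have "C \<subseteq> closure (interior C)"
    unfolding convex_closure_interior[OF assms(1) False] by (rule closure_subset)
  ultimately have "b \<le> a \<bullet> z" if "z \<in> C" for z using that by blast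
  moreover have "a \<bullet> x \<le> b" using ab(2) by simp
  ultimately have "a \<bullet> x \<le> a \<bullet> z" if "z \<in> C" for z using that order_trans by metis
  with ab(1) show ?thesis by (rule that)
qed

section \<open>Level components as hulls of their points on the circle\<close>

context flat_gradient
begin

text \<open>Convexity turns membership in a component into a closed condition on a single segment,
  which is the form that passes to limits.\<close>

lemma level_iff_segment:
  assumes R: "cball c R \<subseteq> \<Omega>" and x: "x \<in> cball c R"
  shows "z \<in> level c R x \<longleftrightarrow> closed_segment x z \<subseteq> {z \<in> cball c R. u z = u x}"
proof
  assume "z \<in> level c R x"
  then have "closed_segment x z \<subseteq> level c R x"
    using convex_level[OF R x] level_props(1)[OF x] by (simp add: closed_segment_subset)
  then show "closed_segment x z \<subseteq> {z \<in> cball c R. u z = u x}" using level_props(4,5)[OF x] by auto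
next
  assume s: "closed_segment x z \<subseteq> {z \<in> cball c R. u z = u x}"
  have "closed_segment x z \<subseteq> level c R x"
    unfolding level_def by (intro connected_component_maximal s) auto
  then show "z \<in> level c R x" by auto
qed

text \<open>Upper semicontinuity of the component in its base point: limits of segments are
  segments, and \<open>u\<close> is continuous along them.\<close>

lemma level_limit:
  assumes R: "cball c R \<subseteq> \<Omega>" and x: "\<And>n. X n \<in> cball c R" "\<And>n. Z n \<in> level c R (X n)"
    and lim: "X \<longlonglongrightarrow> x" "Z \<longlonglongrightarrow> z"
  shows "x \<in> cball c R" "z \<in> level c R x"
proof -
  show xc: "x \<in> cball c R" using closed_sequentially[OF closed_cball x(1) lim(1)] .
  have "closed_segment x z \<subseteq> {z \<in> cball c R. u z = u x}"
  proof
    fix w assume "w \<in> closed_segment x z"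
    then obtain l where l: "0 \<le> l" "l \<le> 1" "w = (1 - l) *\<^sub>R x + l *\<^sub>R z" by (auto simp: in_segment)
    define Y where "Y n = (1 - l) *\<^sub>R X n + l *\<^sub>R Z n" for n
    have "Y \<longlonglongrightarrow> w" unfolding Y_def l by (intro tendsto_intros lim)
    have Y: "Y n \<in> cball c R" "u (Y n) = u (X n)" for n
    proof -
      have "Y n \<in> closed_segment (X n) (Z n)" using l by (auto simp: Y_def in_segment)
      then show "Y n \<in> cball c R" "u (Y n) = u (X n)"
        using x(2)[of n] unfolding level_iff_segment[OF R x(1)] by auto
    qed
    have "w \<in> cball c R" by (rule closed_sequentially[OF closed_cball Y(1) \<open>Y \<longlonglongrightarrow> w\<close>])
    have uc: "isCont u y" for y using cont_u by (simp add: continuous_on_eq_continuous_at)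
    have "(\<lambda>n. u (Y n)) \<longlonglongrightarrow> u w" by (rule isCont_tendsto_compose[OF uc \<open>Y \<longlonglongrightarrow> w\<close>])
    moreover have "(\<lambda>n. u (Y n)) \<longlonglongrightarrow> u x" unfolding Y(2) by (rule isCont_tendsto_compose[OF uc lim(1)])
    ultimately have "u w = u x" by (rule LIMSEQ_unique)
    then show "w \<in> {z \<in> cball c R. u z = u x}" using \<open>w \<in> cball c R\<close> by simp
  qed
  then show "z \<in> level c R x" unfolding level_iff_segment[OF R xc] .
qed

lemma level_eq:
  assumes "z \<in> level c R x" "z \<in> level c R y" "x \<in> cball c R" "y \<in> cball c R"
  shows "level c R x = level c R y"
proof -
  have "u x = u y" using level_props(5)[OF assms(3,1)] level_props(5)[OF assms(4,2)] by simp
  then show ?thesis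
    using connected_component_eq[OF assms(1)[unfolded level_def]] connected_component_eq[OF assms(2)[unfolded level_def]]
    by (simp add: level_def)
qed

text \<open>Otherwise some direction \<open>e\<close> has a lowest face \<open>F\<close> of the
  component \<open>C\<close> strictly below all points of \<open>C\<close> on the circle. A curve
  \<open>\<Gamma>\<close> passes around \<open>F\<close> from below, from just left of it to just
  right of it. Each point of \<open>\<Gamma>\<close> has its own convex component, disjoint from
  \<open>C\<close>, which by semicontinuity leaves the disc above the height
  \<open>\<sigma>\<close>. It thus crosses this height either to the left or to the right of the
  point \<open>i0\<close> of \<open>C\<close>. The two alternatives are closed and exclusive along
  \<open>\<Gamma>\<close>, yet one end is left and the other right, against connectedness.\<close>

lemma level_subset_hull:
  assumes R: "cball c R \<subseteq> \<Omega>" and x0: "x0 \<in> cball c R"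
  shows "level c R x0 \<subseteq> convex hull (level c R x0 \<inter> sphere c R)"
proof (rule ccontr)
  define C where "C = level c R x0"
  define Q where "Q = convex hull (C \<inter> sphere c R)"
  note C = level_props[OF x0, folded C_def]
  have conv: "convex C" unfolding C_def by (rule convex_level[OF R x0])
  assume "\<not> ?thesis"
  then obtain y0 where y0: "y0 \<in> C" "y0 \<notin> Q" by (auto simp: C_def Q_def)
  have "compact Q" unfolding Q_def by (intro compact_convex_hull compact_Int C) simp
  moreover have "convex Q" by (simp add: Q_def)
  ultimately obtain e b where eb: "e \<bullet> y0 < b" "\<And>x. x \<in> Q \<Longrightarrow> b < e \<bullet> x"
    using separating_hyperplane_closed_point[of Q y0] y0(2) compact_imp_closed by metis
  have sQ: "b < e \<bullet> s" if "s \<in> C" "s \<in> sphere c R" for s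
    using that by (intro eb(2)) (auto simp: Q_def hull_inc)
  obtain s0 where s0: "s0 \<in> C" "s0 \<in> sphere c R"
    using level_meets_sphere[OF R x0] unfolding C_def by auto
  have "e \<noteq> 0" using sQ[OF s0] eb(1) by auto
  define \<tau> :: "real^2" where "\<tau> = vector [- (e $ 2), e $ 1]"
  have et: "e \<bullet> \<tau> = 0" "\<tau> \<noteq> 0"
    using \<open>e \<noteq> 0\<close> by (auto simp: \<tau>_def inner_real2 vec_eq_iff forall_2)
  have te: "\<tau> \<bullet> e = 0" using et(1) by (simp add: inner_commute)
  have ee: "e \<bullet> e > 0" and tt: "\<tau> \<bullet> \<tau> > 0" using \<open>e \<noteq> 0\<close> et by auto
  have "continuous_on C (\<lambda>x. e \<bullet> x)" by (intro continuous_intros)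
  then obtain f where f: "f \<in> C" "\<And>x. x \<in> C \<Longrightarrow> e \<bullet> f \<le> e \<bullet> x"
    using continuous_attains_inf[OF C(3)] y0(1) by (metis empty_iff)
  define m where "m = e \<bullet> f"
  have "m < b" using f(2)[OF y0(1)] eb(1) by (simp add: m_def)
  define \<sigma> where "\<sigma> = (m + b) / 2"
  have \<sigma>: "m < \<sigma>" "\<sigma> < b" using \<open>m < b\<close> by (auto simp: \<sigma>_def)
  define F where "F = C \<inter> {x. e \<bullet> x = m}"
  have F: "compact F" unfolding F_def by (intro compact_Int_closed C closed_hyperplane)
  have convF: "convex F" unfolding F_def by (intro convex_Int conv convex_hyperplane)
  have "f \<in> F" using f by (simp add: F_def m_def)
  have "continuous_on F (\<lambda>x. \<tau> \<bullet> x)" by (intro continuous_intros)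
  \<comment> \<open>The left and right ends of the lowest face; they coincide if the face is a
    point.\<close>
  then obtain f1 f2 where f12: "f1 \<in> F" "\<And>x. x \<in> F \<Longrightarrow> \<tau> \<bullet> f1 \<le> \<tau> \<bullet> x" "f2 \<in> F" "\<And>x. x \<in> F \<Longrightarrow> \<tau> \<bullet> x \<le> \<tau> \<bullet> f2"
    using continuous_attains_inf[OF F, of "\<lambda>x. \<tau> \<bullet> x"] continuous_attains_sup[OF F, of "\<lambda>x. \<tau> \<bullet> x"] \<open>f \<in> F\<close>
    by (metis empty_iff)
  \<comment> \<open>level sets of points near the lowest face \<open>F\<close> leave the disc above the line \<open>e \<bullet> x = \<sigma>\<close>\<close>
  have "\<exists>\<kappa>>0. \<forall>x w s. x \<in> cball c R \<longrightarrow> w \<in> F \<longrightarrow> dist x w \<le> \<kappa> \<longrightarrow> s \<in> level c R x \<longrightarrow>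
      s \<in> sphere c R \<longrightarrow> \<sigma> < e \<bullet> s"
  proof (rule ccontr)
    assume neg0: "\<not> ?thesis"
    have neg: "\<exists>x w s. x \<in> cball c R \<and> w \<in> F \<and> dist x w \<le> \<kappa> \<and> s \<in> level c R x \<and> s \<in> sphere c R \<and> e \<bullet> s \<le> \<sigma>"
      if "\<kappa> > 0" for \<kappa>
      using that neg0 by (meson not_le)
    have "\<exists>x w s. x \<in> cball c R \<and> w \<in> F \<and> dist x w \<le> inverse (real (Suc n)) \<and> s \<in> level c R x \<and> s \<in> sphere c R \<and> e \<bullet> s \<le> \<sigma>" for n
      by (rule neg) simp
    then obtain X Y Z where XYZ: "\<And>n. X n \<in> cball c R" "\<And>n. Y n \<in> F" "\<And>n. dist (X n) (Y n) \<le> inverse (real (Suc n))"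
      "\<And>n. Z n \<in> level c R (X n)" "\<And>n. Z n \<in> sphere c R" "\<And>n. e \<bullet> Z n \<le> \<sigma>" by metis
    have "seq_compact (F \<times> sphere c R)" by (intro compact_imp_seq_compact compact_Times F) simp
    moreover have "\<forall>n. (Y n, Z n) \<in> F \<times> sphere c R" using XYZ by auto
    ultimately obtain l r where lr: "l \<in> F \<times> sphere c R" "strict_mono r" "((\<lambda>n. (Y n, Z n)) \<circ> r) \<longlonglongrightarrow> l"
      by (rule seq_compactE)
    obtain w s where l: "l = (w, s)" by (cases l)
    have lim: "(\<lambda>n. Y (r n)) \<longlonglongrightarrow> w" "(\<lambda>n. Z (r n)) \<longlonglongrightarrow> s"
      using tendsto_fst[OF lr(3)] tendsto_snd[OF lr(3)] by (simp_all add: l o_def)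
    have "(\<lambda>n. X (r n) - Y (r n)) \<longlonglongrightarrow> 0"
    proof (rule Lim_null_comparison)
      show "\<forall>\<^sub>F n in sequentially. norm (X (r n) - Y (r n)) \<le> inverse (real (Suc (r n)))"
        using XYZ(3) by (simp add: dist_norm)
      show "(\<lambda>n. inverse (real (Suc (r n)))) \<longlonglongrightarrow> 0"
        using LIMSEQ_subseq_LIMSEQ[OF LIMSEQ_inverse_real_of_nat lr(2)] by (simp add: o_def)
    qed
    from tendsto_add[OF this lim(1)] have limX: "(\<lambda>n. X (r n)) \<longlonglongrightarrow> w" by simp
    have "s \<in> level c R w" by (rule level_limit(2)[OF R XYZ(1) XYZ(4) limX lim(2)])
    moreover have "w \<in> C" using lr(1) l by (simp add: F_def)
    then have wc: "w \<in> cball c R" using C(4) by blast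
    have "level c R w = C"
      unfolding C_def by (rule level_eq[OF level_props(1)[OF wc] \<open>w \<in> C\<close>[unfolded C_def] wc x0])
    ultimately have "b < e \<bullet> s" using sQ lr(1) l by auto
    moreover have "e \<bullet> s \<le> \<sigma>"
      by (rule LIMSEQ_le_const2[OF tendsto_inner[OF tendsto_const lim(2)]]) (use XYZ(6) in auto)
    ultimately show False using \<sigma> by simp
  qed
  then obtain \<kappa> where \<kappa>: "\<kappa> > 0" "\<And>x w s. x \<in> cball c R \<Longrightarrow> w \<in> F \<Longrightarrow> dist x w \<le> \<kappa> \<Longrightarrow> s \<in> level c R x \<Longrightarrow>
      s \<in> sphere c R \<Longrightarrow> \<sigma> < e \<bullet> s" by metis
  have "F \<inter> - ball c R = {}"
    using sQ C(4) \<sigma> by (fastforce simp: F_def)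
  then obtain \<kappa>0 where \<kappa>0: "\<kappa>0 > 0" "\<forall>x\<in>F. \<forall>y\<in>- ball c R. \<kappa>0 \<le> dist x y"
    using separate_compact_closed[OF F, of "- ball c R"] by auto
  \<comment> \<open>The size of the detour: every point of \<open>\<Gamma>\<close> is within
    \<open>k * (norm e + norm \<tau>)\<close> of \<open>F\<close>, close enough for the
    semicontinuity bound and for staying in the open disc.\<close>
  define k where "k = min \<kappa> (\<kappa>0 / 2) / (norm e + norm \<tau>)"
  have net: "norm e + norm \<tau> > 0" using \<open>e \<noteq> 0\<close> by (simp add: add_pos_nonneg)
  have k: "k > 0" using \<kappa>(1) \<kappa>0(1) net by (simp add: k_def)
  have kk: "k * (norm e + norm \<tau>) \<le> \<kappa>" "k * (norm e + norm \<tau>) < \<kappa>0" using net \<kappa>0(1) by (auto simp: k_def)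
  \<comment> \<open>The polygon through \<open>f1 - k *\<^sub>R \<tau>\<close>,
    \<open>f1 - k *\<^sub>R e\<close>, \<open>f2 - k *\<^sub>R e\<close> and
    \<open>f2 + k *\<^sub>R \<tau>\<close>.\<close>
  define \<Gamma> where "\<Gamma> = closed_segment (f1 - k *\<^sub>R \<tau>) (f1 - k *\<^sub>R e) \<union> closed_segment (f1 - k *\<^sub>R e) (f2 - k *\<^sub>R e)
    \<union> closed_segment (f2 - k *\<^sub>R e) (f2 + k *\<^sub>R \<tau>)"
  \<comment> \<open>A point of \<open>\<Gamma>\<close> either lies strictly below the minimal height
    of \<open>C\<close>, or lies at that height strictly beyond an end of the face. Either way it is
    off \<open>C\<close>.\<close>
  have \<Gamma>_form: "\<exists>w\<in>F. \<exists>p q. x = w + p *\<^sub>R \<tau> - q *\<^sub>R e \<and> \<bar>p\<bar> \<le> k \<and> 0 \<le> q \<and> q \<le> k \<and>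
      (0 < q \<or> (q = 0 \<and> p < 0 \<and> w = f1) \<or> (q = 0 \<and> 0 < p \<and> w = f2))" if "x \<in> \<Gamma>" for x
  proof -
    consider l where "0 \<le> l" "l \<le> 1" "x = (1 - l) *\<^sub>R (f1 - k *\<^sub>R \<tau>) + l *\<^sub>R (f1 - k *\<^sub>R e)"
      | l where "0 \<le> l" "l \<le> 1" "x = (1 - l) *\<^sub>R (f1 - k *\<^sub>R e) + l *\<^sub>R (f2 - k *\<^sub>R e)"
      | l where "0 \<le> l" "l \<le> 1" "x = (1 - l) *\<^sub>R (f2 - k *\<^sub>R e) + l *\<^sub>R (f2 + k *\<^sub>R \<tau>)"
      using \<open>x \<in> \<Gamma>\<close> unfolding \<Gamma>_def in_segment Un_iff by blast
    then show ?thesis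
    proof cases
      case 1
      have "x = f1 + (- (1 - l) * k) *\<^sub>R \<tau> - (l * k) *\<^sub>R e" using 1(3) by (simp add: vec_eq_iff algebra_simps)
      moreover have "\<bar>- (1 - l) * k\<bar> \<le> k" "l * k \<le> k" using 1 k by (auto simp: abs_mult mult_left_le_one_le)
      moreover have "0 < l * k \<or> (l * k = 0 \<and> - (1 - l) * k < 0)"
      proof (cases "l = 0")
        case False
        then show ?thesis using 1(1) k by simp
      qed (use k in simp)
      moreover have "0 \<le> l * k" using 1(1) k by simp
      ultimately show ?thesis using f12(1) by blast
    next
      case 2
      have "x = ((1 - l) *\<^sub>R f1 + l *\<^sub>R f2) + 0 *\<^sub>R \<tau> - k *\<^sub>R e" using 2(3) by (simp add: vec_eq_iff algebra_simps)
      moreover have "(1 - l) *\<^sub>R f1 + l *\<^sub>R f2 \<in> F" using convF f12(1,3) 2 by (simp add: convex_alt)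
      ultimately show ?thesis using k
        by (intro bexI[of _ "(1 - l) *\<^sub>R f1 + l *\<^sub>R f2"] exI[of _ 0] exI[of _ k]) auto
    next
      case 3
      have "x = f2 + (l * k) *\<^sub>R \<tau> - ((1 - l) * k) *\<^sub>R e" using 3(3) by (simp add: vec_eq_iff algebra_simps)
      moreover have "\<bar>l * k\<bar> \<le> k" "(1 - l) * k \<le> k" using 3 k by (auto simp: abs_mult mult_left_le_one_le)
      moreover have "0 < (1 - l) * k \<or> ((1 - l) * k = 0 \<and> 0 < l * k)"
      proof (cases "l = 1")
        case False
        then show ?thesis using 3(2) k by simp
      qed (use k in simp)
      moreover have "0 \<le> (1 - l) * k" using 3(2) k by simp
      ultimately show ?thesis using f12(3) by blast
    qed
  qed
  have \<Gamma>_props: "x \<in> cball c R" "x \<notin> C" "\<exists>z\<in>level c R x. e \<bullet> z = \<sigma>" if "x \<in> \<Gamma>" for x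
  proof -
    obtain w p q where w: "w \<in> F" "x = w + p *\<^sub>R \<tau> - q *\<^sub>R e" "\<bar>p\<bar> \<le> k" "0 \<le> q" "q \<le> k"
      "0 < q \<or> (q = 0 \<and> p < 0 \<and> w = f1) \<or> (q = 0 \<and> 0 < p \<and> w = f2)" using \<Gamma>_form[OF \<open>x \<in> \<Gamma>\<close>] by blast
    have "dist x w \<le> \<bar>p\<bar> * norm \<tau> + \<bar>q\<bar> * norm e"
    proof -
      have "x - w = p *\<^sub>R \<tau> - q *\<^sub>R e" using w(2) by simp
      then show ?thesis using norm_triangle_ineq4[of "p *\<^sub>R \<tau>" "q *\<^sub>R e"] by (simp add: dist_norm)
    qed
    also have "\<dots> \<le> k * norm \<tau> + k * norm e" using w by (intro add_mono mult_right_mono) auto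
    also have "\<dots> = k * (norm e + norm \<tau>)" by (simp add: algebra_simps)
    finally have d: "dist x w \<le> k * (norm e + norm \<tau>)" .
    have "x \<in> ball c R"
    proof (rule ccontr)
      assume "x \<notin> ball c R"
      then have "\<kappa>0 \<le> dist w x" using \<kappa>0(2) w(1) by auto
      then show False using d kk(2) by (simp add: dist_commute)
    qed
    then show xc: "x \<in> cball c R" by auto
    have em: "e \<bullet> x = m - q * (e \<bullet> e)" using w(1,2) et(1) by (simp add: F_def inner_diff_right inner_add_right)
    show "x \<notin> C"
    proof
      assume "x \<in> C"
      then have "m \<le> m - q * (e \<bullet> e)" using f(2)[of x] em by (simp add: m_def)
      then have "q * (e \<bullet> e) \<le> 0" by simp
      then have "q = 0" using ee w(4) by (simp add: mult_le_0_iff)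
      then have "x \<in> F" "x = w + p *\<^sub>R \<tau>" using \<open>x \<in> C\<close> em w(2) by (auto simp: F_def)
      then have "\<tau> \<bullet> f1 \<le> \<tau> \<bullet> w + p * (\<tau> \<bullet> \<tau>)" "\<tau> \<bullet> w + p * (\<tau> \<bullet> \<tau>) \<le> \<tau> \<bullet> f2"
        using f12(2)[of x] f12(4)[of x] by (simp_all add: inner_add_right)
      then show False
        using w(6) \<open>q = 0\<close> mult_neg_pos[OF _ tt, of p] mult_pos_pos[OF _ tt, of p] by (smt (verit))
    qed
    obtain s where s: "s \<in> level c R x" "s \<in> sphere c R" using level_meets_sphere[OF R xc] by auto
    then have "\<sigma> < e \<bullet> s" using \<kappa>(2)[OF xc w(1) order_trans[OF d kk(1)]] by blast
    moreover have "e \<bullet> x \<le> m" using em w(4) ee by simp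
    ultimately have es: "e \<bullet> x < \<sigma>" "\<sigma> < e \<bullet> s" using \<sigma> by auto
    define l where "l = (\<sigma> - e \<bullet> x) / (e \<bullet> s - e \<bullet> x)"
    have l: "0 \<le> l" "l \<le> 1" "l * (e \<bullet> s - e \<bullet> x) = \<sigma> - e \<bullet> x" using es by (auto simp: l_def divide_le_eq_1)
    have "(1 - l) *\<^sub>R x + l *\<^sub>R s \<in> level c R x"
      using convex_level[OF R xc] level_props(1)[OF xc] s(1) l by (simp add: convex_alt)
    moreover have "e \<bullet> ((1 - l) *\<^sub>R x + l *\<^sub>R s) = \<sigma>"
      using l(3) by (simp add: inner_add_right algebra_simps)
    ultimately show "\<exists>z\<in>level c R x. e \<bullet> z = \<sigma>" by blast
  qed
  have disj: "z \<notin> C" if "x \<in> \<Gamma>" "z \<in> level c R x" for x z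
  proof
    assume "z \<in> C"
    then have "level c R x = C"
      using level_eq[OF that(2) _ \<Gamma>_props(1)[OF that(1)] x0] by (simp add: C_def)
    then show False using level_props(1)[OF \<Gamma>_props(1)[OF that(1)]] \<Gamma>_props(2)[OF that(1)] by simp
  qed
  obtain i0 where i0: "i0 \<in> C" "e \<bullet> i0 = \<sigma>"
  proof -
    have es: "e \<bullet> f < \<sigma>" "\<sigma> < e \<bullet> s0" using \<sigma> sQ[OF s0] by (auto simp: m_def)
    define l where "l = (\<sigma> - e \<bullet> f) / (e \<bullet> s0 - e \<bullet> f)"
    have l: "0 \<le> l" "l \<le> 1" "l * (e \<bullet> s0 - e \<bullet> f) = \<sigma> - e \<bullet> f" using es by (auto simp: l_def divide_le_eq_1)
    have "(1 - l) *\<^sub>R f + l *\<^sub>R s0 \<in> C" using conv f(1) s0(1) l by (simp add: convex_alt)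
    moreover have "e \<bullet> ((1 - l) *\<^sub>R f + l *\<^sub>R s0) = \<sigma>"
      using l(3) by (simp add: inner_add_right algebra_simps)
    ultimately show ?thesis using that by blast
  qed
  have crossing: "z \<in> C" if "e \<bullet> z = \<sigma>" "\<tau> \<bullet> z = \<tau> \<bullet> i0" for z
  proof -
    have "z = i0" by (rule plane_eqI[OF et(1) \<open>e \<noteq> 0\<close> et(2)]) (use that i0 in \<open>auto simp: inner_commute\<close>)
    then show ?thesis using i0 by simp
  qed
  \<comment> \<open>If \<open>z\<close> were on the other side of \<open>i0\<close> than the
    displacement \<open>p\<close>, the segment from \<open>w + p *\<^sub>R \<tau>\<close> to
    \<open>z\<close> would meet the segment from \<open>w\<close> to \<open>i0\<close>, which lies
    in \<open>C\<close>. Both segments run between the same two heights, so one parameter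
    \<open>l\<close> serves for both and is found from the coordinate along
    \<open>\<tau>\<close>.\<close>
  have side: "\<not> p * (\<tau> \<bullet> z - \<tau> \<bullet> i0) < 0" if x: "w + p *\<^sub>R \<tau> \<in> \<Gamma>" "w \<in> F" and z: "z \<in> level c R (w + p *\<^sub>R \<tau>)" "e \<bullet> z = \<sigma>" for w p z
  proof
    define A B where AB: "A = p * (\<tau> \<bullet> \<tau>)" "B = \<tau> \<bullet> z - \<tau> \<bullet> i0"
    assume "p * (\<tau> \<bullet> z - \<tau> \<bullet> i0) < 0"
    then have "(p * (\<tau> \<bullet> z - \<tau> \<bullet> i0)) * (\<tau> \<bullet> \<tau>) < 0" by (rule mult_neg_pos[OF _ tt])
    then have "A * B < 0" by (simp add: AB algebra_simps)
    then have sgn: "(0 < A \<and> B < 0) \<or> (A < 0 \<and> 0 < B)" by (simp add: mult_less_0_iff)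
    define l where "l = A / (A - B)"
    have l: "0 \<le> l" "l \<le> 1" "l * (A - B) = A"
      using sgn by (auto simp: l_def zero_le_divide_iff divide_le_eq_1)
    let ?x = "w + p *\<^sub>R \<tau>"
    have "(1 - l) *\<^sub>R ?x + l *\<^sub>R z \<in> level c R ?x"
      using convex_level[OF R \<Gamma>_props(1)[OF x(1)]] level_props(1)[OF \<Gamma>_props(1)[OF x(1)]] z(1) l by (simp add: convex_alt)
    moreover have "(1 - l) *\<^sub>R ?x + l *\<^sub>R z = (1 - l) *\<^sub>R w + l *\<^sub>R i0"
    proof (rule plane_eqI[OF et(1) \<open>e \<noteq> 0\<close> et(2)])
      have "z \<bullet> e = i0 \<bullet> e" using z(2) i0(2) by (simp add: inner_commute)
      then show "((1 - l) *\<^sub>R ?x + l *\<^sub>R z) \<bullet> e = ((1 - l) *\<^sub>R w + l *\<^sub>R i0) \<bullet> e"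
        by (simp add: inner_add_left te)
      have zB: "z \<bullet> \<tau> = i0 \<bullet> \<tau> + B" by (simp add: AB inner_commute)
      have "((1 - l) *\<^sub>R ?x + l *\<^sub>R z) \<bullet> \<tau> - ((1 - l) *\<^sub>R w + l *\<^sub>R i0) \<bullet> \<tau> = A - l * (A - B)"
        by (simp add: AB(1) inner_add_left zB algebra_simps)
      then show "((1 - l) *\<^sub>R ?x + l *\<^sub>R z) \<bullet> \<tau> = ((1 - l) *\<^sub>R w + l *\<^sub>R i0) \<bullet> \<tau>"
        using l(3) by simp
    qed
    moreover have "(1 - l) *\<^sub>R w + l *\<^sub>R i0 \<in> C" using conv x(2) i0(1) l by (simp add: convex_alt F_def)
    ultimately show False using disj[OF x(1)] by metis
  qed
  \<comment> \<open>\<open>S 1\<close> collects the points whose component crosses to the left of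
    \<open>i0\<close>, \<open>S (- 1)\<close> those crossing to the right.\<close>
  define S where "S t = {x \<in> \<Gamma>. \<exists>z\<in>level c R x. e \<bullet> z = \<sigma> \<and> t * (\<tau> \<bullet> z) \<le> t * (\<tau> \<bullet> i0)}" for t :: real
  have "compact \<Gamma>" unfolding \<Gamma>_def by (intro compact_Un compact_segment)
  have closedS: "closed (S t)" for t
    unfolding closed_sequential_limits
  proof (intro allI impI)
    fix X x assume "(\<forall>n. X n \<in> S t) \<and> X \<longlonglongrightarrow> x"
    then have X: "\<And>n. X n \<in> S t" "X \<longlonglongrightarrow> x" by auto
    then have XG: "\<And>n. X n \<in> \<Gamma>" by (auto simp: S_def)
    have "x \<in> \<Gamma>" using closed_sequentially[OF compact_imp_closed[OF \<open>compact \<Gamma>\<close>] XG X(2)] .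
    obtain Z where Z: "\<And>n. Z n \<in> level c R (X n)" "\<And>n. e \<bullet> Z n = \<sigma>" "\<And>n. t * (\<tau> \<bullet> Z n) \<le> t * (\<tau> \<bullet> i0)"
      using X(1) unfolding S_def by simp metis
    have "\<forall>n. Z n \<in> cball c R" using Z(1) level_props(4)[OF \<Gamma>_props(1)[OF XG]] by blast
    then obtain z r where zr: "strict_mono r" "(Z \<circ> r) \<longlonglongrightarrow> z"
      using seq_compactE[OF compact_imp_seq_compact[OF compact_cball[of c R]]] by metis
    have lim: "(\<lambda>n. Z (r n)) \<longlonglongrightarrow> z" "(\<lambda>n. X (r n)) \<longlonglongrightarrow> x"
      using zr(2) LIMSEQ_subseq_LIMSEQ[OF X(2) zr(1)] by (simp_all add: o_def)
    have "z \<in> level c R x" by (rule level_limit(2)[OF R \<Gamma>_props(1)[OF XG] Z(1) lim(2,1)])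
    moreover have "e \<bullet> z = \<sigma>"
      using LIMSEQ_unique[OF tendsto_inner[OF tendsto_const lim(1), of e]] Z(2) by simp
    moreover have "t * (\<tau> \<bullet> z) \<le> t * (\<tau> \<bullet> i0)"
      by (rule LIMSEQ_le_const2[OF tendsto_mult[OF tendsto_const tendsto_inner[OF tendsto_const lim(1)]]]) (use Z(3) in auto)
    ultimately show "x \<in> S t" using \<open>x \<in> \<Gamma>\<close> by (auto simp: S_def)
  qed
  have "connected \<Gamma>" unfolding \<Gamma>_def by (intro connected_Un connected_segment) auto
  moreover have "\<Gamma> \<subseteq> S 1 \<union> S (- 1)" using \<Gamma>_props(3) by (fastforce simp: S_def)
  moreover have "S 1 \<inter> S (- 1) \<inter> \<Gamma> = {}"
  proof (rule ccontr)
    assume "S 1 \<inter> S (- 1) \<inter> \<Gamma> \<noteq> {}"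
    then obtain x z1 z2 where x: "x \<in> \<Gamma>" and z: "z1 \<in> level c R x" "e \<bullet> z1 = \<sigma>" "\<tau> \<bullet> z1 \<le> \<tau> \<bullet> i0"
      "z2 \<in> level c R x" "e \<bullet> z2 = \<sigma>" "\<tau> \<bullet> i0 \<le> \<tau> \<bullet> z2" by (auto simp: S_def)
    have "\<tau> \<bullet> z1 \<noteq> \<tau> \<bullet> i0" "\<tau> \<bullet> z2 \<noteq> \<tau> \<bullet> i0" using crossing disj[OF x] z by blast+
    then have lt: "\<tau> \<bullet> z1 < \<tau> \<bullet> i0" "\<tau> \<bullet> i0 < \<tau> \<bullet> z2" using z by auto
    define l where "l = (\<tau> \<bullet> i0 - \<tau> \<bullet> z1) / (\<tau> \<bullet> z2 - \<tau> \<bullet> z1)"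
    have l: "0 \<le> l" "l \<le> 1" "l * (\<tau> \<bullet> z2 - \<tau> \<bullet> z1) = \<tau> \<bullet> i0 - \<tau> \<bullet> z1"
      using lt by (auto simp: l_def divide_le_eq_1)
    have "(1 - l) *\<^sub>R z1 + l *\<^sub>R z2 \<in> level c R x"
      using convex_level[OF R \<Gamma>_props(1)[OF x]] z l by (simp add: convex_alt)
    moreover have "(1 - l) *\<^sub>R z1 + l *\<^sub>R z2 \<in> C"
      by (rule crossing) (use z l(3) in \<open>simp_all add: inner_add_right algebra_simps\<close>)
    ultimately show False using disj[OF x] by blast
  qed
  moreover have "f1 + (- k) *\<^sub>R \<tau> \<in> S 1 \<inter> \<Gamma>"
  proof -
    have x: "f1 + (- k) *\<^sub>R \<tau> \<in> \<Gamma>" by (simp add: \<Gamma>_def)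
    obtain z where z: "z \<in> level c R (f1 + (- k) *\<^sub>R \<tau>)" "e \<bullet> z = \<sigma>" using \<Gamma>_props(3)[OF x] by blast
    have "\<not> - k * (\<tau> \<bullet> z - \<tau> \<bullet> i0) < 0" by (rule side[OF x f12(1) z])
    then have "\<tau> \<bullet> z \<le> \<tau> \<bullet> i0" using k by (simp add: zero_less_mult_iff)
    then show ?thesis using x z by (auto simp: S_def)
  qed
  moreover have "f2 + k *\<^sub>R \<tau> \<in> S (- 1) \<inter> \<Gamma>"
  proof -
    have x: "f2 + k *\<^sub>R \<tau> \<in> \<Gamma>" by (simp add: \<Gamma>_def)
    obtain z where z: "z \<in> level c R (f2 + k *\<^sub>R \<tau>)" "e \<bullet> z = \<sigma>" using \<Gamma>_props(3)[OF x] by blast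
    have "\<not> k * (\<tau> \<bullet> z - \<tau> \<bullet> i0) < 0" by (rule side[OF x f12(3) z])
    then have "\<tau> \<bullet> i0 \<le> \<tau> \<bullet> z" using k by (simp add: mult_less_0_iff)
    then show ?thesis using x z by (auto simp: S_def)
  qed
  ultimately show False
    unfolding connected_closed using closedS by (metis empty_iff)
qed


end

section \<open>Diameters of constant gradient and their prolongation to the boundary\<close>

context flat_gradient
begin

text \<open>At a point that is not interior the component has a supporting line, and the face it
  cuts out is again the hull of points on the circle. Since the disc is centred at \<open>x\<close>,
  the line meets the circle only in \<open>x + d\<close> and \<open>x - d\<close>; for
  \<open>x\<close> to be in the hull both are needed.\<close>

lemma level_chord:
  assumes R: "cball x R \<subseteq> \<Omega>" "0 < R" and x: "x \<notin> interior {z. u z = u x}"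
  obtains a d where "a \<noteq> 0" "norm d = R" "a \<bullet> d = 0" "\<And>z. z \<in> level x R x \<Longrightarrow> a \<bullet> x \<le> a \<bullet> z"
    "\<And>t. \<bar>t\<bar> \<le> 1 \<Longrightarrow> x + t *\<^sub>R d \<in> level x R x"
proof -
  have xc: "x \<in> cball x R" using R(2) by simp
  define C where "C = level x R x"
  note C = level_props[OF xc, folded C_def]
  have conv: "convex C" unfolding C_def by (rule convex_level[OF R(1) xc])
  have "interior C \<subseteq> interior {z. u z = u x}" using C(5) by (intro interior_mono) auto
  then obtain a where a: "a \<noteq> 0" "\<And>z. z \<in> C \<Longrightarrow> a \<bullet> x \<le> a \<bullet> z"
    using supporting_hyperplane_not_interior[OF conv C(1)] x by blast
  define S where "S = C \<inter> sphere x R"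
  have "compact S" unfolding S_def by (intro compact_Int C) simp
  have "convex hull S \<subseteq> C" by (rule hull_minimal) (auto simp: S_def conv)
  then have hull: "convex hull S = C" using level_subset_hull[OF R(1) xc] by (auto simp: S_def C_def)
  have "(C \<inter> {z. a \<bullet> z = a \<bullet> x}) face_of (convex hull S)"
    unfolding hull using a(2) by (intro face_of_Int_supporting_hyperplane_ge[OF conv]) auto
  then obtain S' where S': "S' \<subseteq> S" "C \<inter> {z. a \<bullet> z = a \<bullet> x} = convex hull S'"
    using face_of_convex_hull_subset[OF \<open>compact S\<close>] by metis
  have xS: "x \<in> convex hull S'" using S'(2) C(1) by blast
  define \<tau> :: "real^2" where "\<tau> = vector [- (a $ 2), a $ 1]"
  have at: "a \<bullet> \<tau> = 0" "\<tau> \<noteq> 0"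
    using a(1) by (auto simp: \<tau>_def inner_real2 vec_eq_iff forall_2)
  define d where "d = (R / norm \<tau>) *\<^sub>R \<tau>"
  have d: "norm d = R" "a \<bullet> d = 0" using at R(2) by (simp_all add: d_def)
  have "d \<noteq> 0" using d(1) R(2) by auto
  have S'd: "S' \<subseteq> {x + d, x - d}"
  proof
    fix s assume "s \<in> S'"
    then have "s \<in> C \<inter> {z. a \<bullet> z = a \<bullet> x}" unfolding S'(2) by (rule hull_inc)
    then have "a \<bullet> (s - x) = 0" by (simp add: inner_diff_right)
    define c where "c = (s - x) \<bullet> d / (d \<bullet> d)"
    have "d \<bullet> d > 0" using \<open>d \<noteq> 0\<close> by simp
    have "s - x = c *\<^sub>R d"
    proof (rule plane_eqI[OF d(2) a(1) \<open>d \<noteq> 0\<close>])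
      show "(s - x) \<bullet> d = c *\<^sub>R d \<bullet> d" using \<open>d \<bullet> d > 0\<close> by (simp add: c_def)
      show "(s - x) \<bullet> a = c *\<^sub>R d \<bullet> a" using \<open>a \<bullet> (s - x) = 0\<close> d(2)
        by (simp add: inner_commute)
    qed
    moreover have "norm (s - x) = R" using \<open>s \<in> S'\<close> S'(1) by (auto simp: S_def dist_norm norm_minus_commute)
    ultimately have "\<bar>c\<bar> * R = R" using d(1) by simp
    then have "c = 1 \<or> c = - 1" using R(2) by auto
    then have "s - x = d \<or> s - x = - d" using \<open>s - x = c *\<^sub>R d\<close> by auto
    then show "s \<in> {x + d, x - d}" by (auto simp: algebra_simps)
  qed
  have both: "x + t *\<^sub>R d \<in> S'" if "t = 1 \<or> t = - 1" for t
  proof (rule ccontr)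
    assume "x + t *\<^sub>R d \<notin> S'"
    then have "S' \<subseteq> {x - t *\<^sub>R d}" using S'd that by auto
    then have "convex hull S' \<subseteq> {x - t *\<^sub>R d}" by (intro hull_minimal) auto
    then show False using xS \<open>d \<noteq> 0\<close> that by auto
  qed
  have "x + t *\<^sub>R d \<in> C" if "\<bar>t\<bar> \<le> 1" for t
  proof -
    have "x + 1 *\<^sub>R d \<in> C" "x + (- 1) *\<^sub>R d \<in> C" using both[of 1] both[of "- 1"] S'(1) unfolding S_def by blast+
    moreover have "x + t *\<^sub>R d = ((1 + t) / 2) *\<^sub>R (x + 1 *\<^sub>R d) + ((1 - t) / 2) *\<^sub>R (x + (- 1) *\<^sub>R d)"
      by (simp add: vec_eq_iff field_simps)
    ultimately show ?thesis using conv that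
      by (simp only:) (rule convexD, auto simp: field_simps)
  qed
  then show ?thesis using that[OF a(1) d] a(2) by (simp add: C_def)
qed

text \<open>A short segment through \<open>x\<close> on which \<open>u\<close> is constant must lie
  in the supporting line, so it has the direction of the diameter and extends to it. The second
  claim renews the hypothesis at the other points of the diameter: a disc around one of them inside
  the level set would belong to the component and cross the supporting line.\<close>

lemma level_chord_extend:
  assumes R: "cball x R \<subseteq> \<Omega>" "0 < R" and x: "x \<notin> interior {z. u z = u x}"
    and w: "w \<noteq> 0" "0 < \<epsilon>" "\<And>t. \<bar>t\<bar> \<le> \<epsilon> \<Longrightarrow> u (x + t *\<^sub>R w) = u x"
  shows "\<bar>t\<bar> * norm w \<le> R \<Longrightarrow> u (x + t *\<^sub>R w) = u x"
    and "\<bar>t\<bar> * norm w < R \<Longrightarrow> x + t *\<^sub>R w \<notin> interior {z. u z = u x}"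
proof -
  have xc: "x \<in> cball x R" using R(2) by simp
  note L = level_props[OF xc]
  obtain a d where ad: "a \<noteq> 0" "norm d = R" "a \<bullet> d = 0" "\<And>z. z \<in> level x R x \<Longrightarrow> a \<bullet> x \<le> a \<bullet> z"
    "\<And>t. \<bar>t\<bar> \<le> 1 \<Longrightarrow> x + t *\<^sub>R d \<in> level x R x" by (rule level_chord[OF R x]) (rule that)
  have "d \<noteq> 0" using ad(2) R(2) by auto
  define \<delta> where "\<delta> = min \<epsilon> (R / norm w)"
  have \<delta>: "\<delta> > 0" using w R(2) by (simp add: \<delta>_def)
  have inL: "x + s *\<^sub>R w \<in> level x R x" if "\<bar>s\<bar> \<le> \<delta>" for s
    unfolding level_iff_segment[OF R(1) xc]
  proof
    fix z assume "z \<in> closed_segment x (x + s *\<^sub>R w)"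
    then obtain l where l: "0 \<le> l" "l \<le> 1" "z = (1 - l) *\<^sub>R x + l *\<^sub>R (x + s *\<^sub>R w)" by (auto simp: in_segment)
    then have z: "z = x + (l * s) *\<^sub>R w" by (simp add: vec_eq_iff algebra_simps)
    have "\<bar>l * s\<bar> \<le> 1 * \<delta>" unfolding abs_mult using l that by (intro mult_mono) auto
    then have ls: "\<bar>l * s\<bar> \<le> \<epsilon>" "\<bar>l * s\<bar> \<le> R / norm w" by (auto simp: \<delta>_def)
    then have "\<bar>l * s\<bar> * norm w \<le> R" using w(1) by (simp add: le_divide_eq)
    then show "z \<in> {z \<in> cball x R. u z = u x}" using w(3)[OF ls(1)] by (simp add: z dist_norm)
  qed
  have "0 \<le> \<delta> * (a \<bullet> w)" "0 \<le> (- \<delta>) * (a \<bullet> w)"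
    using ad(4)[OF inL[of \<delta>]] ad(4)[OF inL[of "- \<delta>"]] \<delta> by (simp_all add: inner_add_right inner_diff_right)
  then have aw: "a \<bullet> w = 0" using \<delta> by (simp add: zero_le_mult_iff mult_le_0_iff)
  define c where "c = w \<bullet> d / (d \<bullet> d)"
  have wc: "w = c *\<^sub>R d"
  proof (rule plane_eqI[OF ad(3,1) \<open>d \<noteq> 0\<close>])
    show "w \<bullet> d = c *\<^sub>R d \<bullet> d" using \<open>d \<noteq> 0\<close> by (simp add: c_def)
    show "w \<bullet> a = c *\<^sub>R d \<bullet> a" using aw ad(3) by (simp add: inner_commute)
  qed
  have inR: "x + t *\<^sub>R w \<in> level x R x" if "\<bar>t\<bar> * norm w \<le> R" for t
  proof -
    have "\<bar>t * c\<bar> * R \<le> 1 * R" using that ad(2) unfolding wc by (simp add: abs_mult)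
    then have "\<bar>t * c\<bar> \<le> 1" using R(2) by (rule mult_right_le_imp_le)
    then show ?thesis using ad(5)[of "t * c"] by (simp add: wc)
  qed
  show "u (x + t *\<^sub>R w) = u x" if "\<bar>t\<bar> * norm w \<le> R" using L(5)[OF inR[OF that]] .
  show "x + t *\<^sub>R w \<notin> interior {z. u z = u x}" if t: "\<bar>t\<bar> * norm w < R"
  proof
    let ?y = "x + t *\<^sub>R w"
    assume "?y \<in> interior {z. u z = u x}"
    moreover have "?y \<in> ball x R" using t by (simp add: dist_norm)
    ultimately have "?y \<in> interior {z. u z = u x} \<inter> ball x R" by blast
    moreover have "open (interior {z. u z = u x} \<inter> ball x R)" by (intro open_Int open_interior open_ball)
    ultimately obtain \<rho> where \<rho>: "\<rho> > 0" "cball ?y \<rho> \<subseteq> interior {z. u z = u x} \<inter> ball x R"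
      using open_contains_cball by blast
    have "cball ?y \<rho> \<subseteq> {z \<in> cball x R. u z = u x}"
      using \<rho>(2) interior_subset ball_subset_cball by blast
    then have "cball ?y \<rho> \<subseteq> connected_component_set {z \<in> cball x R. u z = u x} ?y"
      using \<rho>(1) by (intro connected_component_maximal connected_cball) auto
    moreover have yL: "?y \<in> level x R x" using t by (intro inR) simp
    ultimately have sub: "cball ?y \<rho> \<subseteq> level x R x"
      using connected_component_eq[OF yL[unfolded level_def]] by (simp add: level_def)
    define z where "z = ?y - (\<rho> / norm a) *\<^sub>R a"
    have "z \<in> cball ?y \<rho>" using \<rho>(1) ad(1) by (simp add: z_def dist_norm)
    then have "a \<bullet> x \<le> a \<bullet> z" using sub ad(4) by blast
    moreover have "a \<bullet> z = a \<bullet> x - (\<rho> / norm a) * (a \<bullet> a)"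
      using aw by (simp add: z_def inner_add_right inner_diff_right)
    moreover have "(\<rho> / norm a) * (a \<bullet> a) > 0" using \<rho>(1) ad(1) by simp
    ultimately show False by linarith
  qed
qed

text \<open>The compact piece of the ray has positive distance from the complement of
  \<open>\<Omega>\<close>, so one radius \<open>R\<close> serves at all its points and finitely many
  steps of fixed length suffice. The invariant \<open>good\<close> collects what
  \<open>level_chord_extend\<close> needs at the next point.\<close>

lemma gradient_const_on_ray:
  assumes "open \<Omega>" and x: "x \<notin> interior {z. u z = u x}" and w: "w \<noteq> 0" "0 < \<epsilon>" "\<And>t. \<bar>t\<bar> \<le> \<epsilon> \<Longrightarrow> u (x + t *\<^sub>R w) = u x"
    and T: "0 \<le> T" "\<And>t. 0 \<le> t \<Longrightarrow> t \<le> T \<Longrightarrow> x + t *\<^sub>R w \<in> \<Omega>"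
  shows "u (x + T *\<^sub>R w) = u x"
proof -
  define S where "S = (\<lambda>t. x + t *\<^sub>R w) ` {0..T}"
  have "compact S" unfolding S_def by (intro compact_continuous_image continuous_intros) auto
  moreover have "S \<inter> - \<Omega> = {}" "closed (- \<Omega>)" using T(2) assms(1) by (auto simp: S_def)
  ultimately obtain \<rho> where \<rho>: "\<rho> > 0" "\<forall>y\<in>S. \<forall>z\<in>- \<Omega>. \<rho> \<le> dist y z"
    using separate_compact_closed by metis
  define R where "R = \<rho> / 2"
  have R: "0 < R" using \<rho> by (simp add: R_def)
  have ball: "cball (x + t *\<^sub>R w) R \<subseteq> \<Omega>" if "0 \<le> t" "t \<le> T" for t
  proof
    fix z assume "z \<in> cball (x + t *\<^sub>R w) R"
    then have "dist (x + t *\<^sub>R w) z < \<rho>" using \<rho>(1) by (simp add: R_def)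
    then show "z \<in> \<Omega>" using \<rho>(2) that by (force simp: S_def)
  qed
  \<comment> \<open>Half a radius: after a step of length at most \<open>h\<close> the diameter
    still reaches \<open>h\<close> further in both directions, which is the margin the invariant
    asks for.\<close>
  define h where "h = R / (2 * norm w)"
  have h: "0 < h" "h * norm w < R" using R w(1) by (simp_all add: h_def)
  define good where "good t \<longleftrightarrow> u (x + t *\<^sub>R w) = u x \<and> x + t *\<^sub>R w \<notin> interior {z. u z = u x} \<and>
      (\<exists>\<epsilon>>0. \<forall>r. \<bar>r\<bar> \<le> \<epsilon> \<longrightarrow> u (x + t *\<^sub>R w + r *\<^sub>R w) = u x)" for t
  have "good 0" using x w(2,3) by (auto simp: good_def)
  have step: "good (t + r)" if t: "good t" "0 \<le> t" "t \<le> T" and r: "\<bar>r\<bar> \<le> h" for t r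
  proof -
    let ?y = "x + t *\<^sub>R w"
    obtain \<epsilon> where g: "u ?y = u x" "?y \<notin> interior {z. u z = u x}" "\<epsilon> > 0"
      "\<And>r. \<bar>r\<bar> \<le> \<epsilon> \<Longrightarrow> u (?y + r *\<^sub>R w) = u x" using t(1) by (auto simp: good_def)
    have ext: "\<bar>s\<bar> * norm w \<le> R \<Longrightarrow> u (?y + s *\<^sub>R w) = u x"
      "\<bar>s\<bar> * norm w < R \<Longrightarrow> ?y + s *\<^sub>R w \<notin> interior {z. u z = u x}" for s
      using level_chord_extend[OF ball[OF t(2,3)] R, of w \<epsilon> s] g w(1) by auto
    have rw: "\<bar>r\<bar> * norm w \<le> h * norm w" using r by (intro mult_right_mono) auto
    have rr: "x + (t + r) *\<^sub>R w = ?y + r *\<^sub>R w" by (simp add: algebra_simps)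
    have "u (?y + r *\<^sub>R w + s *\<^sub>R w) = u x" if "\<bar>s\<bar> \<le> h" for s
    proof -
      have "\<bar>r + s\<bar> * norm w \<le> (h + h) * norm w" using r that by (intro mult_right_mono) auto
      also have "\<dots> = R" using w(1) by (simp add: h_def)
      finally show ?thesis using ext(1)[of "r + s"] by (simp add: algebra_simps)
    qed
    then show ?thesis unfolding good_def rr using ext[of r] rw h by (auto intro!: exI[of _ h])
  qed
  have "\<forall>t. 0 \<le> t \<longrightarrow> t \<le> T \<longrightarrow> t \<le> real n * h \<longrightarrow> good t" for n
  proof (induction n)
    case 0
    then show ?case using \<open>good 0\<close> by (auto dest: antisym)
  next
    case (Suc n)
    show ?case
    proof (intro allI impI)
      fix t assume t: "0 \<le> t" "t \<le> T" "t \<le> real (Suc n) * h"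
      define t' where "t' = max 0 (t - h)"
      have "good t'" using Suc.IH[rule_format, of t'] t h(1) by (auto simp: t'_def max_def algebra_simps)
      then have "good (t' + (t - t'))" by (rule step) (use t h(1) in \<open>auto simp: t'_def max_def\<close>)
      then show "good t" by simp
    qed
  qed
  moreover obtain n where "T \<le> real n * h" using reals_Archimedean3[OF h(1)] less_imp_le by metis
  ultimately have "good T" using T(1) by blast
  then show ?thesis by (simp add: good_def)
qed

lemma ray_to_frontier_const:
  assumes "open \<Omega>" "bounded \<Omega>" and x: "x \<in> \<Omega>" "x \<notin> interior {z. u z = u x}"
    and w: "w \<noteq> 0" "0 < \<epsilon>" "\<And>t. \<bar>t\<bar> \<le> \<epsilon> \<Longrightarrow> u (x + t *\<^sub>R w) = u x"
  obtains T where "0 < T" "x + T *\<^sub>R w \<in> frontier \<Omega>"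
    "\<And>t. 0 \<le> t \<Longrightarrow> t < T \<Longrightarrow> x + t *\<^sub>R w \<in> \<Omega> \<and> u (x + t *\<^sub>R w) = u x"
proof -
  define S where "S = {0..} \<inter> (\<lambda>t. x + t *\<^sub>R w) -` (- \<Omega>)"
  have "closed S" unfolding S_def
    by (intro closed_Int closed_atLeast closed_vimage continuous_intros) (use assms(1) in auto)
  obtain B where B: "\<And>z. z \<in> \<Omega> \<Longrightarrow> norm z \<le> B" using assms(2) by (auto simp: bounded_iff)
  define t where "t = (B + norm x + 1) / norm w"
  have "0 \<le> B" using B[OF x(1)] norm_ge_zero[of x] by linarith
  have t: "0 \<le> t" "t * norm w = B + norm x + 1" using w(1) \<open>0 \<le> B\<close> by (auto simp: t_def)
  have "t * norm w = norm ((x + t *\<^sub>R w) - x)" using t(1) by simp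
  also have "\<dots> \<le> norm (x + t *\<^sub>R w) + norm x" by (rule norm_triangle_ineq4)
  finally have "\<not> norm (x + t *\<^sub>R w) \<le> B" using t(2) by linarith
  then have "t \<in> S" using B t(1) by (auto simp: S_def)
  define T where "T = Inf S"
  have "bdd_below S" by (auto simp: S_def intro: bdd_belowI[of _ 0])
  then have T: "T \<in> S" unfolding T_def using \<open>t \<in> S\<close> by (intro closed_contains_Inf \<open>closed S\<close>) auto
  have below: "x + t *\<^sub>R w \<in> \<Omega>" if "0 \<le> t" "t < T" for t
    using that cInf_lower[OF _ \<open>bdd_below S\<close>, of t] by (force simp: S_def T_def)
  have "T > 0" using T x(1) by (cases "T = 0") (auto simp: S_def)
  have "x + T *\<^sub>R w \<in> closure \<Omega>"
  proof -
    have "(\<lambda>t. x + t *\<^sub>R w) ` closure {0..<T} \<subseteq> closure \<Omega>"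
      by (rule image_closure_subset) (use below in \<open>auto intro!: continuous_intros subsetD[OF closure_subset[of \<Omega>]]\<close>)
    then show ?thesis using \<open>T > 0\<close> by (auto simp: image_subset_iff)
  qed
  moreover have "x + T *\<^sub>R w \<notin> \<Omega>" using T by (simp add: S_def)
  ultimately have "x + T *\<^sub>R w \<in> frontier \<Omega>" using assms(1) by (simp add: frontier_def interior_open)
  moreover have "u (x + t *\<^sub>R w) = u x" if "0 \<le> t" "t < T" for t
    by (rule gradient_const_on_ray[OF assms(1) x(2) w that(1)]) (use that below in auto)
  ultimately show ?thesis using that[OF \<open>T > 0\<close>] below by blast
qed

text \<open>The diameter at \<open>x\<close> supplies a direction in which \<open>u\<close> is
  constant nearby; the rays in both senses are followed to their first boundary points.\<close>

lemma interior_or_segment: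
  assumes "open \<Omega>" "bounded \<Omega>" and x: "x \<in> \<Omega>" "x \<notin> interior {z. u z = u x}"
  obtains p q where "p \<in> frontier \<Omega>" "q \<in> frontier \<Omega>" "x \<in> open_segment p q"
    "open_segment p q \<subseteq> \<Omega>" "\<And>z. z \<in> open_segment p q \<Longrightarrow> u z = u x"
proof -
  obtain R where R: "0 < R" "cball x R \<subseteq> \<Omega>" using assms(1) x(1) open_contains_cball by blast
  obtain a d where "a \<noteq> 0" and ad1: "norm d = R" and "a \<bullet> d = 0" "\<And>z. z \<in> level x R x \<Longrightarrow> a \<bullet> x \<le> a \<bullet> z"
    and ad2: "\<And>t. \<bar>t\<bar> \<le> 1 \<Longrightarrow> x + t *\<^sub>R d \<in> level x R x"
    by (rule level_chord[OF R(2,1) x(2)]) (rule that)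
  have "d \<noteq> 0" using ad1 R(1) by auto
  have ud: "u (x + t *\<^sub>R d) = u x" if "\<bar>t\<bar> \<le> 1" for t
    using level_props(5)[OF _ ad2[OF that]] R(1) by simp
  have ud': "u (x + t *\<^sub>R (- d)) = u x" if "\<bar>t\<bar> \<le> 1" for t using ud[of "- t"] that by simp
  obtain T where T: "0 < T" "x + T *\<^sub>R d \<in> frontier \<Omega>"
    "\<And>t. 0 \<le> t \<Longrightarrow> t < T \<Longrightarrow> x + t *\<^sub>R d \<in> \<Omega> \<and> u (x + t *\<^sub>R d) = u x"
    by (rule ray_to_frontier_const[OF assms(1,2) x \<open>d \<noteq> 0\<close> zero_less_one ud]) (assumption, rule that)
  have d': "- d \<noteq> 0" using \<open>d \<noteq> 0\<close> by simp
  obtain T' where T': "0 < T'" "x + T' *\<^sub>R (- d) \<in> frontier \<Omega>"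
    "\<And>t. 0 \<le> t \<Longrightarrow> t < T' \<Longrightarrow> x + t *\<^sub>R (- d) \<in> \<Omega> \<and> u (x + t *\<^sub>R (- d)) = u x"
    by (rule ray_to_frontier_const[OF assms(1,2) x d' zero_less_one ud']) (assumption, rule that)
  define p q where p_q_def: "p = x + T' *\<^sub>R (- d)" "q = x + T *\<^sub>R d"
  have pq: "p \<noteq> q"
  proof
    assume "p = q"
    then have "(T + T') *\<^sub>R d = 0" by (simp add: p_q_def algebra_simps)
    then show False using T(1) T'(1) \<open>d \<noteq> 0\<close> by simp
  qed
  have seg: "\<exists>t. - T' < t \<and> t < T \<and> z = x + t *\<^sub>R d" if "z \<in> open_segment p q" for z
  proof -
    obtain l where l: "0 < l" "l < 1" "z = (1 - l) *\<^sub>R p + l *\<^sub>R q"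
      using \<open>z \<in> open_segment p q\<close> by (auto simp: in_segment)
    have "z = x + (l * T - (1 - l) * T') *\<^sub>R d" using l(3) by (simp add: p_q_def vec_eq_iff algebra_simps)
    moreover have "l * T < 1 * T" "(1 - l) * T' < 1 * T'" "0 < l * T" "0 < (1 - l) * T'"
      using l T(1) T'(1) by (auto intro!: mult_strict_right_mono)
    ultimately show ?thesis by (intro exI[of _ "l * T - (1 - l) * T'"]) auto
  qed
  have seg_props: "z \<in> \<Omega> \<and> u z = u x" if z: "z \<in> open_segment p q" for z
  proof -
    obtain t where t: "- T' < t" "t < T" "z = x + t *\<^sub>R d" using seg[OF z] by blast
    show ?thesis
    proof (cases "0 \<le> t")
      case True
      then show ?thesis using T(3) t by blast
    next
      case False
      then show ?thesis using T'(3)[of "- t"] t by simp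
    qed
  qed
  have "x \<in> open_segment p q"
  proof -
    define l where "l = T' / (T + T')"
    have "l * (T + T') = T'" using T(1) T'(1) by (simp add: l_def)
    have l: "0 < l" "l < 1" using T(1) T'(1) by (simp_all add: l_def)
    have l3: "l * T = (1 - l) * T'" using \<open>l * (T + T') = T'\<close> by (simp add: algebra_simps)
    have "(1 - l) *\<^sub>R p + l *\<^sub>R q = x + (l * T - (1 - l) * T') *\<^sub>R d" by (simp add: p_q_def vec_eq_iff algebra_simps)
    also have "\<dots> = x" unfolding l3 by simp
    finally have "x = (1 - l) *\<^sub>R p + l *\<^sub>R q" by (rule sym)
    then show ?thesis unfolding in_segment using pq l by blast
  qed
  moreover have "p \<in> frontier \<Omega>" "q \<in> frontier \<Omega>" unfolding p_q_def by (fact T'(2) T(2))+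
  moreover have "open_segment p q \<subseteq> \<Omega>" using seg_props by blast
  ultimately show ?thesis using that[of p q] seg_props by blast
qed

end

section \<open>Bump functions\<close>

text \<open>Smoothness of order \<open>k\<close> on the line with derivatives as witnesses, so that
  closure properties are inductions without computing \<open>deriv\<close>.\<close>

primrec diff1 :: "nat \<Rightarrow> (real \<Rightarrow> real) \<Rightarrow> bool" where
  "diff1 0 f \<longleftrightarrow> continuous_on UNIV f"
| "diff1 (Suc k) f \<longleftrightarrow> (\<exists>f'. (\<forall>x. (f has_real_derivative f' x) (at x)) \<and> diff1 k f')"

lemma diff1_SucI:
  assumes "\<And>x. (f has_real_derivative f' x) (at x)" "diff1 k f'"
  shows "diff1 (Suc k) f"
  unfolding diff1.simps using assms by (intro exI[of _ f'] conjI allI)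

lemma diff1_SucE:
  assumes "diff1 (Suc k) f"
  obtains f' where "\<And>x. (f has_real_derivative f' x) (at x)" "diff1 k f'"
  using assms by auto

lemma continuous_on_if_deriv:
  fixes f :: "real \<Rightarrow> real"
  assumes "\<And>x. (f has_real_derivative f' x) (at x)"
  shows "continuous_on S f"
  using DERIV_isCont[OF assms] continuous_at_imp_continuous_on by blast

lemma diff1_cont: "diff1 k f \<Longrightarrow> continuous_on UNIV f"
  by (cases k) (auto intro: continuous_on_if_deriv)

lemma diff1_Suc_D: "diff1 (Suc k) f \<Longrightarrow> diff1 k f"
proof (induction k arbitrary: f)
  case 0
  then show ?case using diff1_cont[of "Suc 0" f] by simp
next
  case (Suc k)
  obtain f' where f': "\<And>x. (f has_real_derivative f' x) (at x)" "diff1 (Suc k) f'"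
    using Suc.prems by (rule diff1_SucE) (rule that)
  show ?case by (rule diff1_SucI[OF f'(1) Suc.IH[OF f'(2)]])
qed

lemma diff1_add: "diff1 k f \<Longrightarrow> diff1 k g \<Longrightarrow> diff1 k (\<lambda>x. f x + g x)"
proof (induction k arbitrary: f g)
  case 0
  then show ?case by (auto intro: continuous_intros)
next
  case (Suc k)
  obtain f' where f': "\<And>x. (f has_real_derivative f' x) (at x)" "diff1 k f'"
    using Suc.prems(1) by (rule diff1_SucE) (rule that)
  obtain g' where g': "\<And>x. (g has_real_derivative g' x) (at x)" "diff1 k g'"
    using Suc.prems(2) by (rule diff1_SucE) (rule that)
  show ?case by (rule diff1_SucI[OF DERIV_add[OF f'(1) g'(1)] Suc.IH[OF f'(2) g'(2)]])
qed

lemma diff1_mult: "diff1 k f \<Longrightarrow> diff1 k g \<Longrightarrow> diff1 k (\<lambda>x. f x * g x)"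
proof (induction k arbitrary: f g)
  case 0
  then show ?case by (auto intro: continuous_intros)
next
  case (Suc k)
  obtain f' where f': "\<And>x. (f has_real_derivative f' x) (at x)" "diff1 k f'"
    using Suc.prems(1) by (rule diff1_SucE) (rule that)
  obtain g' where g': "\<And>x. (g has_real_derivative g' x) (at x)" "diff1 k g'"
    using Suc.prems(2) by (rule diff1_SucE) (rule that)
  have "diff1 k (\<lambda>x. f' x * g x + g' x * f x)"
    by (rule diff1_add[OF Suc.IH[OF f'(2) diff1_Suc_D[OF Suc.prems(2)]] Suc.IH[OF g'(2) diff1_Suc_D[OF Suc.prems(1)]]])
  then show ?case by (rule diff1_SucI[OF DERIV_mult[OF f'(1) g'(1)]])
qed

lemma diff1_const: "diff1 k (\<lambda>_. c)"
proof (induction k arbitrary: c)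
  case (Suc k)
  show ?case by (rule diff1_SucI[OF DERIV_const Suc.IH])
qed simp

lemma diff1_affine: "diff1 k f \<Longrightarrow> diff1 k (\<lambda>x. f (a * x + b))"
proof (induction k arbitrary: f)
  case 0
  then have "continuous_on UNIV f" by simp
  then have "continuous_on UNIV (\<lambda>x. f (a * x + b))"
    by (rule continuous_on_compose2) (auto intro!: continuous_intros)
  then show ?case by simp
next
  case (Suc k)
  obtain f' where f': "\<And>x. (f has_real_derivative f' x) (at x)" "diff1 k f'"
    using Suc.prems by (rule diff1_SucE) (rule that)
  have "((\<lambda>x. f (a * x + b)) has_real_derivative (f' (a * x + b) * a)) (at x)" for x
    by (rule DERIV_chain2[OF f'(1)]) (auto intro!: derivative_eq_intros)
  then show ?case by (rule diff1_SucI) (rule diff1_mult[OF Suc.IH[OF f'(2)] diff1_const])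
qed

text \<open>The powers of \<open>inverse t\<close> make the family closed under differentiation up
  to linear combinations, so that smoothness of \<open>flat_exp 0\<close> follows by one induction
  over all members.\<close>

definition flat_exp :: "nat \<Rightarrow> real \<Rightarrow> real" where
  "flat_exp n t = (if t > 0 then exp (- inverse t) * inverse t ^ n else 0)"

text \<open>This is the difference quotient at 0; the exponential beats every power of
  \<open>inverse t\<close>.\<close>

lemma flat_exp_lim: "((\<lambda>t. flat_exp n t / t) \<longlongrightarrow> 0) (at 0)"
proof -
  have "((\<lambda>x::real. x ^ (Suc n) / exp x) \<longlongrightarrow> 0) at_top"
    by (rule tendsto_power_div_exp_0)
  then have "((\<lambda>t::real. (inverse t) ^ (Suc n) / exp (inverse t)) \<longlongrightarrow> 0) (at_right 0)"
    by (rule filterlim_compose[OF _ filterlim_inverse_at_top_right])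
  then have r: "((\<lambda>t. flat_exp n t / t) \<longlongrightarrow> 0) (at_right 0)"
  proof (rule Lim_transform_eventually)
    show "\<forall>\<^sub>F t in at_right 0. (inverse t) ^ (Suc n) / exp (inverse t) = flat_exp n t / t"
      unfolding eventually_at_right_field
      by (intro exI[of _ 1]) (auto simp: flat_exp_def exp_minus divide_inverse)
  qed
  have "((\<lambda>t::real. 0) \<longlongrightarrow> 0) (at_left (0::real))" by simp
  then have l: "((\<lambda>t. flat_exp n t / t) \<longlongrightarrow> 0) (at_left 0)"
  proof (rule Lim_transform_eventually)
    show "\<forall>\<^sub>F t in at_left 0. 0 = flat_exp n t / t"
      unfolding eventually_at_left_field by (intro exI[of _ "-1"]) (auto simp: flat_exp_def)
  qed
  show ?thesis using l r by (simp add: filterlim_split_at)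
qed

lemma flat_exp_deriv:
  "(flat_exp n has_real_derivative (flat_exp (n + 2) t - real n * flat_exp (n + 1) t)) (at t)"
proof -
  consider "t < 0" | "t = 0" | "t > 0" by linarith
  then show ?thesis
  proof cases
    case 1
    have "((\<lambda>_. 0) has_real_derivative 0) (at t)" by simp
    then have "(flat_exp n has_real_derivative 0) (at t)"
      by (rule has_field_derivative_transform_within_open[where S="{..<0}"]) (use 1 in \<open>auto simp: flat_exp_def\<close>)
    then show ?thesis using 1 by (simp add: flat_exp_def)
  next
    case 2
    then show ?thesis using flat_exp_lim[of n] by (simp add: DERIV_def flat_exp_def)
  next
    case 3
    have 1: "((\<lambda>t. inverse t) has_real_derivative - (inverse t ^ 2)) (at t)"
      using DERIV_inverse[of t UNIV] 3 by (simp add: numeral_2_eq_2)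
    have "((\<lambda>t. exp (- inverse t) * inverse t ^ n) has_real_derivative
        (exp (- inverse t) * (- (- (inverse t ^ 2)))) * inverse t ^ n
        + (real n * (- (inverse t ^ 2) * inverse t ^ (n - Suc 0))) * exp (- inverse t)) (at t)"
      by (intro DERIV_mult DERIV_fun_exp DERIV_minus DERIV_power 1)
    moreover have "(exp (- inverse t) * (- (- (inverse t ^ 2)))) * inverse t ^ n
        + (real n * (- (inverse t ^ 2) * inverse t ^ (n - Suc 0))) * exp (- inverse t)
        = flat_exp (n + 2) t - real n * flat_exp (n + 1) t"
      using 3 by (cases n) (simp_all add: flat_exp_def power2_eq_square algebra_simps)
    ultimately have "((\<lambda>t. exp (- inverse t) * inverse t ^ n) has_real_derivative
        flat_exp (n + 2) t - real n * flat_exp (n + 1) t) (at t)" by simp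
    then show ?thesis
      by (rule has_field_derivative_transform_within_open[where S="{0<..}"]) (use 3 in \<open>auto simp: flat_exp_def\<close>)
  qed
qed

lemma diff1_flat_exp: "diff1 k (flat_exp n)"
proof (induction k arbitrary: n)
  case 0
  show ?case using continuous_on_if_deriv[OF flat_exp_deriv] by simp
next
  case (Suc k)
  have "diff1 k (\<lambda>t. flat_exp (n + 2) t + (- real n) * flat_exp (n + 1) t)"
    by (intro diff1_add diff1_mult diff1_const Suc.IH)
  then have "diff1 k (\<lambda>t. flat_exp (n + 2) t - real n * flat_exp (n + 1) t)" by simp
  then show ?case by (rule diff1_SucI[OF flat_exp_deriv])
qed

lemma flat_exp_0: "0 \<le> flat_exp 0 t" "flat_exp 0 t \<le> 1" "t \<le> 0 \<Longrightarrow> flat_exp 0 t = 0" "0 < t \<Longrightarrow> 0 < flat_exp 0 t"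
  by (auto simp: flat_exp_def)

text \<open>As \<open>flat_exp 0\<close> vanishes on the nonpositive axis, its rescalings tend
  pointwise to the indicator of the open half line.\<close>

lemma flat_exp_0_lim:
  assumes "0 < t" shows "(\<lambda>n. flat_exp 0 (real n * t)) \<longlonglongrightarrow> 1"
proof -
  have "(\<lambda>n. exp (- (inverse t * inverse (real n)))) \<longlonglongrightarrow> exp (- (inverse t * 0))"
    by (intro tendsto_intros lim_inverse_n)
  then have "(\<lambda>n. exp (- (inverse t * inverse (real n)))) \<longlonglongrightarrow> 1" by simp
  then show ?thesis
  proof (rule Lim_transform_eventually)
    show "\<forall>\<^sub>F n in sequentially. exp (- (inverse t * inverse (real n))) = flat_exp 0 (real n * t)"
      using eventually_gt_at_top[of 0]
      by eventually_elim (use assms in \<open>auto simp: flat_exp_def mult.commute\<close>)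
  qed
qed

lemma has_grad2_tensor:
  assumes "(f has_real_derivative f') (at (x $ 1))" "(g has_real_derivative g') (at (x $ 2))"
  shows "has_grad2 (\<lambda>x. f (x $ 1) * g (x $ 2)) (f' * g (x $ 2)) (f (x $ 1) * g') x"
  using has_grad2_mult[OF has_grad2_chain[where f="\<lambda>x. x $ 1", OF assms(1) has_grad2_coord1]
      has_grad2_chain[where f="\<lambda>x. x $ 2", OF assms(2) has_grad2_coord2]] by simp

lemma Ck_tensor:
  fixes f g :: "real \<Rightarrow> real"
  assumes "diff1 k f" "diff1 k g"
  shows "Ck k (\<lambda>x::real^2. f (x $ 1) * g (x $ 2))"
  using assms
proof (induction k arbitrary: f g)
  case 0
  then have c: "continuous_on UNIV f" "continuous_on UNIV g" by simp_all
  have "continuous_on UNIV (\<lambda>x::real^2. f (x $ 1) * g (x $ 2))"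
    by (intro continuous_on_mult continuous_on_compose2[OF c(1)] continuous_on_compose2[OF c(2)])
       (auto intro!: continuous_intros)
  then show ?case by simp
next
  case (Suc k)
  obtain f' where f': "\<And>x. (f has_real_derivative f' x) (at x)" "diff1 k f'"
    using Suc.prems(1) by (rule diff1_SucE) (rule that)
  obtain g' where g': "\<And>x. (g has_real_derivative g' x) (at x)" "diff1 k g'"
    using Suc.prems(2) by (rule diff1_SucE) (rule that)
  have G: "has_grad2 (\<lambda>x. f (x $ 1) * g (x $ 2)) (f' (x $ 1) * g (x $ 2)) (f (x $ 1) * g' (x $ 2)) x" for x
    by (rule has_grad2_tensor[OF f'(1) g'(1)])
  have "partial_deriv 1 (\<lambda>x::real^2. f (x $ 1) * g (x $ 2)) = (\<lambda>x. f' (x $ 1) * g (x $ 2))"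
    "partial_deriv 2 (\<lambda>x::real^2. f (x $ 1) * g (x $ 2)) = (\<lambda>x. f (x $ 1) * g' (x $ 2))"
    by (rule ext, rule has_grad2_partial_deriv[OF G])+
  moreover have "Ck k (\<lambda>x::real^2. f' (x $ 1) * g (x $ 2))" "Ck k (\<lambda>x::real^2. f (x $ 1) * g' (x $ 2))"
    by (rule Suc.IH[OF f'(2) diff1_Suc_D[OF Suc.prems(2)]], rule Suc.IH[OF diff1_Suc_D[OF Suc.prems(1)] g'(2)])
  moreover have "(\<lambda>x::real^2. f (x $ 1) * g (x $ 2)) differentiable (at x)" for x
    by (rule has_grad2_differentiable[OF G])
  ultimately show ?case unfolding Ck.simps forall_2 by simp
qed

lemma tensor_test_function:
  fixes f g :: "real \<Rightarrow> real" and a b :: "real^2"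
  assumes "\<And>k. diff1 k f" "\<And>k. diff1 k g" "cbox a b \<subseteq> \<Omega>"
    and "\<And>t. t \<notin> {a $ 1..b $ 1} \<Longrightarrow> f t = 0" "\<And>t. t \<notin> {a $ 2..b $ 2} \<Longrightarrow> g t = 0"
  shows "(\<lambda>x. f (x $ 1) * g (x $ 2)) \<in> test_functions \<Omega>"
proof -
  have "{x::real^2. f (x $ 1) * g (x $ 2) \<noteq> 0} \<subseteq> cbox a b"
  proof
    fix x assume "x \<in> {x::real^2. f (x $ 1) * g (x $ 2) \<noteq> 0}"
    then have "f (x $ 1) \<noteq> 0" "g (x $ 2) \<noteq> 0" by auto
    then have "x $ 1 \<in> {a $ 1..b $ 1}" "x $ 2 \<in> {a $ 2..b $ 2}" using assms(4,5) by blast+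
    then show "x \<in> cbox a b" by (simp add: mem_box_cart forall_2)
  qed
  then have sub: "closure {x::real^2. f (x $ 1) * g (x $ 2) \<noteq> 0} \<subseteq> cbox a b"
    by (rule closure_minimal[OF _ closed_cbox])
  then have "compact (closure {x::real^2. f (x $ 1) * g (x $ 2) \<noteq> 0})"
    using bounded_subset[OF bounded_cbox sub] by (simp add: compact_eq_bounded_closed)
  then show ?thesis unfolding test_functions_def mem_Collect_eq
    using Ck_tensor[OF assms(1,2)] order_trans[OF sub assms(3)] by blast
qed

definition bump :: "real \<Rightarrow> real" where "bump t = flat_exp 0 (1 - t) * flat_exp 0 (1 + t)"

lemma diff1_bump: "diff1 k bump"
proof -
  have "diff1 k (\<lambda>t. flat_exp 0 ((- 1) * t + 1) * flat_exp 0 (1 * t + 1))"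
    by (intro diff1_mult diff1_affine diff1_flat_exp)
  moreover have "(\<lambda>t. flat_exp 0 ((- 1) * t + 1) * flat_exp 0 (1 * t + 1)) = bump"
    by (auto simp: bump_def fun_eq_iff add.commute)
  ultimately show ?thesis by simp
qed

definition bumpd :: "nat \<Rightarrow> real \<Rightarrow> real" where "bumpd n = (deriv ^^ n) bump"

lemma diff1_all_deriv:
  assumes "\<And>k. diff1 k f"
  shows "(f has_real_derivative deriv f x) (at x)" "diff1 k (deriv f)"
proof -
  have *: "(f has_real_derivative deriv f x) (at x)" for x
  proof -
    obtain f' where "\<And>x. (f has_real_derivative f' x) (at x)" using assms[of "Suc 0"] by (rule diff1_SucE) (rule that)
    then show ?thesis using DERIV_imp_deriv by metis
  qed
  then show "(f has_real_derivative deriv f x) (at x)" .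
  obtain f' where f': "\<And>x. (f has_real_derivative f' x) (at x)" "diff1 k f'"
    using assms[of "Suc k"] by (rule diff1_SucE) (rule that)
  have "f' x = deriv f x" for x by (rule DERIV_unique[OF f'(1) *])
  then have "f' = deriv f" by (rule ext)
  then show "diff1 k (deriv f)" using f' by simp
qed

lemma bumpd_smooth: "diff1 k (bumpd n)"
proof (induction n arbitrary: k)
  case (Suc n)
  have "diff1 k (deriv (bumpd n))" by (rule diff1_all_deriv(2)[OF Suc.IH])
  then show ?case by (simp add: bumpd_def)
qed (simp add: bumpd_def diff1_bump)

lemma bumpd_deriv: "(bumpd n has_real_derivative bumpd (Suc n) t) (at t)"
proof -
  have "(bumpd n has_real_derivative deriv (bumpd n) t) (at t)" by (rule diff1_all_deriv(1)[OF bumpd_smooth])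
  then show ?thesis by (simp add: bumpd_def)
qed

lemma bumpd_cont: "continuous_on S (bumpd n)"
  by (rule continuous_on_subset[OF diff1_cont[OF bumpd_smooth[of 0 n]]]) simp

lemma bumpd_zero: "1 < \<bar>t\<bar> \<Longrightarrow> bumpd n t = 0"
proof (induction n arbitrary: t)
  case 0
  then show ?case by (auto simp: bumpd_def bump_def flat_exp_def)
next
  case (Suc n)
  have op: "open {t::real. 1 < \<bar>t\<bar>}" by (intro open_Collect_less continuous_intros)
  have z: "((\<lambda>_::real. 0::real) has_real_derivative 0) (at t)" by simp
  have "(bumpd n has_real_derivative 0) (at t)"
    by (rule has_field_derivative_transform_within_open[OF z op]) (use Suc.prems in simp, simp add: Suc.IH)
  from DERIV_unique[OF bumpd_deriv this] show ?case .
qed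

lemma bumpd_bounded: "\<exists>B. \<forall>t. \<bar>bumpd n t\<bar> \<le> B"
proof -
  have "compact (bumpd n ` {-1..1})" by (intro compact_continuous_image bumpd_cont) simp
  then have "bounded (bumpd n ` {-1..1})" by (rule compact_imp_bounded)
  then obtain B where B: "\<forall>y\<in>bumpd n ` {-1..1}. norm y \<le> B" unfolding bounded_iff by blast
  have "\<bar>bumpd n t\<bar> \<le> max B 0" for t
  proof (cases "1 < \<bar>t\<bar>")
    case True
    then show ?thesis by (simp add: bumpd_zero)
  next
    case False
    then have "t \<in> {-1..1}" by auto
    with B have "\<bar>bumpd n t\<bar> \<le> B" by auto
    then show ?thesis by simp
  qed
  then show ?thesis by blast
qed

lemma bump_props: "0 \<le> bumpd 0 t" "bumpd 0 (- t) = bumpd 0 t" "0 < bumpd 0 0"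
  by (auto simp: bumpd_def bump_def flat_exp_def mult.commute)

section \<open>The weak gradient\<close>

lemma differentiable_has_grad2:
  fixes f :: "real^2 \<Rightarrow> real"
  assumes "f differentiable (at x)"
  shows "has_grad2 f (partial_deriv 1 f x) (partial_deriv 2 f x) x"
proof -
  define f' where "f' = frechet_derivative f (at x)"
  have d: "(f has_derivative f') (at x)" using assms unfolding f'_def frechet_derivative_works .
  have lin: "linear f'" using d by (rule has_derivative_linear)
  have "f' h = partial_deriv 1 f x * h $ 1 + partial_deriv 2 f x * h $ 2" for h
  proof -
    have "h = (h $ 1) *\<^sub>R axis 1 1 + (h $ 2) *\<^sub>R axis 2 1"
      by (simp add: vec_eq_iff forall_2 axis_def)
    then have "f' h = f' ((h $ 1) *\<^sub>R axis 1 1 + (h $ 2) *\<^sub>R axis 2 1)" by simp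
    also have "\<dots> = (h $ 1) *\<^sub>R f' (axis 1 1) + (h $ 2) *\<^sub>R f' (axis 2 1)"
      by (simp only: linear_add[OF lin] linear_cmul[OF lin])
    finally show ?thesis by (simp add: partial_deriv_def f'_def mult.commute)
  qed
  then have "f' = (\<lambda>h. partial_deriv 1 f x * h $ 1 + partial_deriv 2 f x * h $ 2)" by (rule ext)
  then show ?thesis using d unfolding has_grad2_def by simp
qed

lemma test_function_props:
  fixes \<phi> :: "real^2 \<Rightarrow> real"
  assumes "\<phi> \<in> test_functions \<Omega>"
  shows "continuous_on S \<phi>" "has_grad2 \<phi> (partial_deriv 1 \<phi> x) (partial_deriv 2 \<phi> x) x"
    "compact (closure {x. \<phi> x \<noteq> 0})" "closure {x. \<phi> x \<noteq> 0} \<subseteq> \<Omega>"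
    "x \<notin> closure {x. \<phi> x \<noteq> 0} \<Longrightarrow> \<phi> x = 0"
    "partial_deriv i \<phi> \<in> test_functions \<Omega>"
proof -
  have Ck: "Ck k \<phi>" for k using assms by (simp add: test_functions_def)
  show "continuous_on S \<phi>" using Ck[of 0] continuous_on_subset by auto
  show G: "has_grad2 \<phi> (partial_deriv 1 \<phi> x) (partial_deriv 2 \<phi> x) x" for x
    using Ck[of "Suc 0"] by (intro differentiable_has_grad2) simp
  show K: "compact (closure {x. \<phi> x \<noteq> 0})" and KO: "closure {x. \<phi> x \<noteq> 0} \<subseteq> \<Omega>"
    using assms by (simp_all add: test_functions_def)
  show z: "\<phi> x = 0" if "x \<notin> closure {x. \<phi> x \<noteq> 0}" for x
    using that closure_subset[of "{x. \<phi> x \<noteq> 0}"] by auto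
  have "partial_deriv i \<phi> x = 0" if x: "x \<in> - closure {x. \<phi> x \<noteq> 0}" for x
  proof -
    have "open (- closure {x. \<phi> x \<noteq> 0})" by (intro open_Compl closed_closure)
    then have "has_grad2 \<phi> 0 0 x"
      by (rule has_grad2_cong[OF has_grad2_const[of 0] _ x]) (drule ComplD, rule z[symmetric], assumption)
    then have "partial_deriv 1 \<phi> x = 0" "partial_deriv 2 \<phi> x = 0" by (rule has_grad2_partial_deriv)+
    then show ?thesis using exhaust_2[of i] by (elim disjE) simp_all
  qed
  then have "{x. partial_deriv i \<phi> x \<noteq> 0} \<subseteq> closure {x. \<phi> x \<noteq> 0}" by auto
  then have sub: "closure {x. partial_deriv i \<phi> x \<noteq> 0} \<subseteq> closure {x. \<phi> x \<noteq> 0}"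
    by (rule closure_minimal[OF _ closed_closure])
  have "compact (closure {x. partial_deriv i \<phi> x \<noteq> 0})"
    using bounded_subset[OF compact_imp_bounded[OF K] sub] by (simp add: compact_eq_bounded_closed)
  moreover have "Ck k (partial_deriv i \<phi>)" for k using Ck[of "Suc k"] by simp
  ultimately show "partial_deriv i \<phi> \<in> test_functions \<Omega>"
    using order_trans[OF sub KO] by (simp add: test_functions_def)
qed

text \<open>The bridge from Lebesgue integrals over \<open>\<Omega>\<close> to integrals over a
  fixed box, in which the calculus is done; the test function vanishes outside
  \<open>\<Omega>\<close>.\<close>

lemma regular_distr_eq_integral:
  fixes f \<phi> :: "real^2 \<Rightarrow> real"
  assumes "continuous_on UNIV f" "\<phi> \<in> test_functions \<Omega>" "\<Omega> \<subseteq> cbox lo hi"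
  shows "regular_distr \<Omega> f \<phi> = integral (cbox lo hi) (\<lambda>x. f x * \<phi> x)"
proof -
  note T = test_function_props[OF assms(2)]
  have z: "\<phi> x = 0" if "x \<notin> \<Omega>" for x
    by (rule T(5)) (rule contra_subsetD[OF T(4) that])
  have "(\<lambda>x. indicat_real \<Omega> x *\<^sub>R (f x * \<phi> x)) = (\<lambda>x. indicat_real (cbox lo hi) x *\<^sub>R (f x * \<phi> x))"
  proof
    fix x show "indicat_real \<Omega> x *\<^sub>R (f x * \<phi> x) = indicat_real (cbox lo hi) x *\<^sub>R (f x * \<phi> x)"
      using z[of x] assms(3) by (cases "x \<in> \<Omega>") (auto simp: indicator_def)
  qed
  then have "regular_distr \<Omega> f \<phi> = (LINT x:cbox lo hi|lebesgue. f x * \<phi> x)"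
    unfolding regular_distr_def set_lebesgue_integral_def by simp
  also have "\<dots> = integral (cbox lo hi) (\<lambda>x. f x * \<phi> x)"
    by (intro set_lebesgue_integral_eq_integral(2) absolutely_integrable_continuous continuous_on_mult T(1)
        continuous_on_subset[OF assms(1)]) simp
  finally show ?thesis .
qed

lemma set_integrable_continuous_compact:
  fixes f :: "real^2 \<Rightarrow> real"
  assumes "continuous_on UNIV f" "compact K"
  shows "set_integrable lebesgue K f"
proof -
  obtain lo hi where "K \<subseteq> box lo hi" using bounded_subset_box[OF compact_imp_bounded[OF assms(2)]] .
  then have sub: "K \<subseteq> cbox lo hi" using box_subset_cbox by (rule order_trans)
  have "set_integrable lebesgue (cbox lo hi) f"
    by (rule absolutely_integrable_continuous[OF continuous_on_subset[OF assms(1)]]) simp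
  then show ?thesis using fmeasurableD[OF lmeasurable_compact[OF assms(2)]] sub by (rule set_integrable_subset)
qed

text \<open>Integrating the derivatives of \<open>V\<close> times a test function gives zero. The
  lemma also shows that the choice in \<open>weak_grad\<close> is made from a nonempty set.\<close>

lemma gradient_is_weak_grad:
  fixes V v :: "real^2 \<Rightarrow> real" and u :: "real^2 \<Rightarrow> real^2"
  assumes \<Omega>: "\<Omega> \<subseteq> box lo hi" and V: "\<And>x. has_grad2 V (u x $ 1) (u x $ 2) x" and uc: "continuous_on UNIV u"
    and v: "\<And>x. x \<in> \<Omega> \<Longrightarrow> v x = V x"
  shows "is_weak_grad \<Omega> v u"
  unfolding is_weak_grad_def
proof (intro allI conjI)
  fix i :: 2
  have c: "continuous_on UNIV (\<lambda>x. u x $ j)" for j by (intro continuous_intros uc)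
  have cV: "continuous_on UNIV V" using V by (rule has_grad2_continuous_on)
  have \<Omega>': "\<Omega> \<subseteq> cbox lo hi" using \<Omega> box_subset_cbox by (rule order_trans)
  show "(\<lambda>x. u x $ i) \<in> L2_loc \<Omega>"
    unfolding L2_loc_def mem_Collect_eq
  proof (intro allI impI)
    fix K assume K: "compact K \<and> K \<subseteq> \<Omega>"
    have "set_integrable lebesgue K (\<lambda>x. u x $ i)" using K by (intro set_integrable_continuous_compact c) simp
    then have "set_borel_measurable lebesgue K (\<lambda>x. u x $ i)"
      unfolding set_integrable_def set_borel_measurable_def by (rule borel_measurable_integrable)
    moreover have "set_integrable lebesgue K (\<lambda>x. (u x $ i)\<^sup>2)"
      using K by (intro set_integrable_continuous_compact continuous_on_power c) simp
    ultimately show "set_borel_measurable lebesgue K (\<lambda>x. u x $ i) \<and> set_integrable lebesgue K (\<lambda>x. (u x $ i)\<^sup>2)" ..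
  qed
  show "distr_eq \<Omega> (distr_deriv i (regular_distr \<Omega> v)) (regular_distr \<Omega> (\<lambda>x. u x $ i))"
    unfolding distr_eq_def distr_deriv_def
  proof
    fix \<phi> assume \<phi>: "\<phi> \<in> test_functions \<Omega>"
    note T = test_function_props[OF \<phi>]
    have vV: "regular_distr \<Omega> v \<psi> = regular_distr \<Omega> V \<psi>" for \<psi>
      unfolding regular_distr_def set_lebesgue_integral_def
      by (intro Bochner_Integration.integral_cong refl) (auto simp: indicator_def v)
    define F where "F x = V x * \<phi> x" for x
    have G: "has_grad2 F (u x $ 1 * \<phi> x + V x * partial_deriv 1 \<phi> x) (u x $ 2 * \<phi> x + V x * partial_deriv 2 \<phi> x) x" for x
      unfolding F_def by (rule has_grad2_mult[OF V T(2)])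
    have cp: "continuous_on S (partial_deriv j \<phi>)" for S j by (rule test_function_props(1)[OF T(6)])
    have c12: "continuous_on UNIV (\<lambda>x. u x $ j * \<phi> x + V x * partial_deriv j \<phi> x)" for j
      by (intro continuous_on_add continuous_on_mult c cV T(1) cp)
    have K: "closure {x. \<phi> x \<noteq> 0} \<subseteq> box lo hi" using T(4) \<Omega> by (rule order_trans)
    have F0: "F x = 0" if "x \<notin> closure {x. \<phi> x \<noteq> 0}" for x using T(5)[OF that] by (simp add: F_def)
    note D = integral_directional_derivative_zero[OF T(3) K F0 G c12 c12]
    have "integral (cbox lo hi) (\<lambda>x. u x $ i * \<phi> x + V x * partial_deriv i \<phi> x) = 0"
    proof -
      consider "i = 1" | "i = 2" using exhaust_2[of i] by blast
      then show ?thesis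
      proof cases
        case 1
        then show ?thesis using D[of "axis 1 1 :: real^2"] by (simp add: axis_def)
      next
        case 2
        then show ?thesis using D[of "axis 2 1 :: real^2"] by (simp add: axis_def)
      qed
    qed
    moreover have "(\<lambda>x. u x $ i * \<phi> x) integrable_on cbox lo hi" "(\<lambda>x. V x * partial_deriv i \<phi> x) integrable_on cbox lo hi"
      by (intro integrable_continuous continuous_on_mult continuous_on_subset[OF c] continuous_on_subset[OF cV] T(1) cp subset_UNIV)+
    ultimately have "integral (cbox lo hi) (\<lambda>x. u x $ i * \<phi> x) + integral (cbox lo hi) (\<lambda>x. V x * partial_deriv i \<phi> x) = 0"
      by (simp add: integral_add)
    then show "- regular_distr \<Omega> v (partial_deriv i \<phi>) = regular_distr \<Omega> (\<lambda>x. u x $ i) \<phi>"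
      unfolding vV regular_distr_eq_integral[OF cV T(6) \<Omega>'] regular_distr_eq_integral[OF c \<phi> \<Omega>'] by linarith
  qed
qed

section \<open>Uniqueness of the weak gradient almost everywhere\<close>

lemma AE_zero_if_box_integrals_zero:
  fixes f :: "real^2 \<Rightarrow> real"
  assumes f: "integrable lebesgue f" and zero: "\<And>a b. (LINT x:box a b|lebesgue. f x) = 0"
    and univ: "integral\<^sup>L lebesgue f = 0"
  shows "AE x in lebesgue. f x = 0"
proof -
  have si: "set_integrable lebesgue A f" if "A \<in> sets borel" for A
    unfolding set_integrable_def by (rule integrable_mult_indicator[OF _ f]) (use that in simp)
  have all: "(LINT x:A|lebesgue. f x) = 0" if A: "A \<in> sets borel" for A
  proof -
    \<comment> \<open>Boxes form an intersection-stable generator of the Borel sets, so the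
      vanishing of integrals extends by a Dynkin argument. The whole space is not a box; its
      integral enters for complements.\<close>
    define G :: "(real^2) set set" where "G = range (\<lambda>(a, b). box a b)"
    have sb: "sets borel = sigma_sets UNIV G"
      unfolding borel_eq_box G_def by (rule sets_measure_of) simp
    have "A \<in> sigma_sets UNIV G" using A sb by simp
    have "Int_stable G"
    proof (rule Int_stableI)
      fix A B assume "A \<in> G" "B \<in> G"
      then obtain a b c d where AB: "A = box a b" "B = box c d" by (auto simp: G_def)
      obtain p q where "box a b \<inter> box c d = box p q" by (rule that[OF box_Int_box])
      then show "A \<inter> B \<in> G" unfolding AB G_def by (intro image_eqI[of _ _ "(p, q)"]) auto
    qed
    moreover have "G \<subseteq> Pow UNIV" by simp
    ultimately show ?thesis using \<open>A \<in> sigma_sets UNIV G\<close>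
    proof (induction rule: sigma_sets_induct_disjoint)
      case (basic A)
      then show ?case using zero by (auto simp: G_def)
    next
      case empty
      show ?case by (simp add: set_lebesgue_integral_def)
    next
      case (compl A)
      then have A: "A \<in> sets borel" using sb by simp
      have "(LINT x:A \<union> (UNIV - A)|lebesgue. f x) = (LINT x:A|lebesgue. f x) + (LINT x:UNIV - A|lebesgue. f x)"
        by (rule set_integral_Un[OF _ si si]) (use A in auto)
      moreover have "A \<union> (UNIV - A) = UNIV" by auto
      ultimately show ?case using compl(2) univ by (simp add: set_lebesgue_integral_def)
    next
      case (union A)
      have A: "A i \<in> sets borel" for i using union(2) sb by auto
      have "(LINT x:(\<Union>i. A i)|lebesgue. f x) = (\<Sum>i. (LINT x:(A i)|lebesgue. f x))"
      proof (rule lebesgue_integral_countable_add)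
        show "A i \<in> sets lebesgue" for i using A[of i] by simp
        show "A i \<inter> A j = {}" if "i \<noteq> j" for i j using union(1) that by (auto simp: disjoint_family_on_def)
        show "set_integrable lebesgue (\<Union>i. A i) f" using A by (intro si sets.countable_UN) auto
      qed
      then show ?case using union(3) by simp
    qed
  qed
  obtain f' where f': "f' \<in> borel_measurable lborel" "AE x in lborel. f x = f' x"
    using completion_ex_borel_measurable_real[OF borel_measurable_integrable[OF f]] by blast
  have f'm: "f' \<in> borel_measurable lebesgue" using f'(1) by (rule measurable_completion)
  have ae: "AE x in lebesgue. f x = f' x" using f'(2) by (rule AE_completion)
  have "integrable lebesgue f'"
    using integrable_cong_AE[OF borel_measurable_integrable[OF f] f'm ae] f by simp
  then have f'i: "integrable lborel f'" using integrable_completion[OF f'(1)] by simp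
  have "AE x in lborel. f' x = (\<lambda>_. 0) x"
  proof (rule density_unique_real[OF f'i])
    fix A :: "(real^2) set" assume "A \<in> sets lborel"
    then have A: "A \<in> sets borel" by simp
    have m: "(\<lambda>x. indicat_real A x *\<^sub>R f' x) \<in> borel_measurable lborel"
      using f'(1) A by (intro borel_measurable_scaleR borel_measurable_indicator) auto
    have "(LINT x:A|lborel. f' x) = (LINT x:A|lebesgue. f' x)"
      unfolding set_lebesgue_integral_def by (rule integral_completion[OF m, symmetric])
    also have "\<dots> = (LINT x:A|lebesgue. f x)"
      unfolding set_lebesgue_integral_def
    proof (rule integral_cong_AE)
      show "(\<lambda>x. indicat_real A x *\<^sub>R f' x) \<in> borel_measurable lebesgue" using m by (rule measurable_completion)
      show "(\<lambda>x. indicat_real A x *\<^sub>R f x) \<in> borel_measurable lebesgue"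
        using si[OF A] unfolding set_integrable_def by (rule borel_measurable_integrable)
      show "AE x in lebesgue. indicat_real A x *\<^sub>R f' x = indicat_real A x *\<^sub>R f x"
        using ae by eventually_elim simp
    qed
    also have "\<dots> = 0" by (rule all[OF A])
    finally show "(LINT x:A|lborel. f' x) = (LINT x:A|lborel. 0)" by (simp add: set_lebesgue_integral_def)
  qed simp
  then have "AE x in lebesgue. f' x = 0" by (intro AE_completion) simp
  with ae show ?thesis by eventually_elim simp
qed

text \<open>Test functions with values in the unit interval that tend pointwise to the indicator of
  the open box as \<open>n\<close> grows.\<close>

definition box_bump :: "real^2 \<Rightarrow> real^2 \<Rightarrow> nat \<Rightarrow> real^2 \<Rightarrow> real" where
  "box_bump c d n x = (flat_exp 0 (real n * (x $ 1 - c $ 1)) * flat_exp 0 (real n * (d $ 1 - x $ 1)))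
    * (flat_exp 0 (real n * (x $ 2 - c $ 2)) * flat_exp 0 (real n * (d $ 2 - x $ 2)))"

lemma box_bump_props:
  assumes "cbox c d \<subseteq> \<Omega>"
  shows "box_bump c d n \<in> test_functions \<Omega>" "0 \<le> box_bump c d n x" "box_bump c d n x \<le> 1"
    "x \<notin> box c d \<Longrightarrow> box_bump c d n x = 0" "x \<in> box c d \<Longrightarrow> (\<lambda>n. box_bump c d n x) \<longlonglongrightarrow> 1"
proof -
  define f where "f c d t = flat_exp 0 (real n * (t - c)) * flat_exp 0 (real n * (d - t))" for c d t
  have "diff1 k (\<lambda>t. flat_exp 0 (real n * t + (- real n * c)) * flat_exp 0 ((- real n) * t + real n * d))" for k c d
    by (intro diff1_mult diff1_affine diff1_flat_exp)
  moreover have "(\<lambda>t. flat_exp 0 (real n * t + (- real n * c)) * flat_exp 0 ((- real n) * t + real n * d)) = f c d" for c d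
    by (simp add: fun_eq_iff f_def right_diff_distrib)
  ultimately have sm: "diff1 k (f c d)" for k c d by simp
  have f0: "f c d t = 0" if "t \<notin> {c..d}" for c d t
  proof -
    have "real n * (t - c) \<le> 0 \<or> real n * (d - t) \<le> 0" using that by (auto simp: mult_le_0_iff)
    then show ?thesis unfolding f_def using flat_exp_0(3) by auto
  qed
  have eq: "box_bump c d n = (\<lambda>x. f (c $ 1) (d $ 1) (x $ 1) * f (c $ 2) (d $ 2) (x $ 2))"
    by (simp add: fun_eq_iff box_bump_def f_def)
  show "box_bump c d n \<in> test_functions \<Omega>"
    unfolding eq by (rule tensor_test_function[OF sm sm assms f0 f0])
  show "0 \<le> box_bump c d n x" unfolding box_bump_def by (intro mult_nonneg_nonneg flat_exp_0(1))
  show "box_bump c d n x \<le> 1" unfolding box_bump_def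
    by (intro mult_le_one mult_nonneg_nonneg flat_exp_0(1,2))
  show "box_bump c d n x = 0" if "x \<notin> box c d"
  proof -
    have "x $ 1 - c $ 1 \<le> 0 \<or> d $ 1 - x $ 1 \<le> 0 \<or> x $ 2 - c $ 2 \<le> 0 \<or> d $ 2 - x $ 2 \<le> 0"
      using that by (auto simp: mem_box_cart forall_2)
    then have "real n * (x $ 1 - c $ 1) \<le> 0 \<or> real n * (d $ 1 - x $ 1) \<le> 0 \<or>
        real n * (x $ 2 - c $ 2) \<le> 0 \<or> real n * (d $ 2 - x $ 2) \<le> 0"
      by (auto intro: mult_nonneg_nonpos)
    then show ?thesis unfolding box_bump_def using flat_exp_0(3) by auto
  qed
  show "(\<lambda>n. box_bump c d n x) \<longlonglongrightarrow> 1" if "x \<in> box c d"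
  proof -
    have p: "0 < x $ 1 - c $ 1" "0 < d $ 1 - x $ 1" "0 < x $ 2 - c $ 2" "0 < d $ 2 - x $ 2"
      using that by (auto simp: mem_box_cart forall_2)
    have "(\<lambda>n. box_bump c d n x) \<longlonglongrightarrow> (1 * 1) * (1 * 1)"
      unfolding box_bump_def by (intro tendsto_mult flat_exp_0_lim p)
    then show ?thesis by simp
  qed
qed

lemma regular_distr_box_bump_limit:
  fixes f :: "real^2 \<Rightarrow> real"
  assumes f: "set_integrable lebesgue (cbox c d) f" and sub: "cbox c d \<subseteq> \<Omega>"
  shows "(\<lambda>n. regular_distr \<Omega> f (box_bump c d n)) \<longlonglongrightarrow> (LINT x:box c d|lebesgue. f x)"
  unfolding regular_distr_def set_lebesgue_integral_def
proof (rule integral_dominated_convergence[where w="\<lambda>x. norm (indicat_real (cbox c d) x *\<^sub>R f x)"])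
  note B = box_bump_props[OF sub]
  have fm: "(\<lambda>x. indicat_real (cbox c d) x *\<^sub>R f x) \<in> borel_measurable lebesgue"
    using f unfolding set_integrable_def by (rule borel_measurable_integrable)
  show "integrable lebesgue (\<lambda>x. norm (indicat_real (cbox c d) x *\<^sub>R f x))"
    using f unfolding set_integrable_def by (rule integrable_norm)
  have "(\<lambda>x. indicat_real (box c d) x *\<^sub>R f x) = (\<lambda>x. indicat_real (box c d) x *\<^sub>R (indicat_real (cbox c d) x *\<^sub>R f x))"
    using box_subset_cbox[of c d] by (auto simp: fun_eq_iff indicator_def)
  moreover have "(\<lambda>x. indicat_real (box c d) x *\<^sub>R (indicat_real (cbox c d) x *\<^sub>R f x)) \<in> borel_measurable lebesgue"
    by (intro borel_measurable_scaleR borel_measurable_indicator fm) simp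
  ultimately show "(\<lambda>x. indicat_real (box c d) x *\<^sub>R f x) \<in> borel_measurable lebesgue" by simp
  have e: "indicat_real \<Omega> x *\<^sub>R (f x * box_bump c d n x) = box_bump c d n x * (indicat_real (cbox c d) x *\<^sub>R f x)" for n x
  proof (cases "x \<in> box c d")
    case True
    then have "x \<in> cbox c d" "x \<in> \<Omega>" using box_subset_cbox sub by auto
    then show ?thesis by simp
  qed (simp add: B(4))
  have bm: "box_bump c d n \<in> borel_measurable lebesgue" for n
  proof -
    have "continuous_on UNIV (box_bump c d n)" by (rule test_function_props(1)[OF B(1)])
    then have "box_bump c d n \<in> borel_measurable lborel"
      using borel_measurable_continuous_onI by simp
    then show ?thesis by (rule measurable_completion)
  qed
  show "(\<lambda>x. indicat_real \<Omega> x *\<^sub>R (f x * box_bump c d n x)) \<in> borel_measurable lebesgue" for n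
    unfolding e by (intro borel_measurable_times bm fm)
  show "AE x in lebesgue. (\<lambda>n. indicat_real \<Omega> x *\<^sub>R (f x * box_bump c d n x)) \<longlonglongrightarrow> indicat_real (box c d) x *\<^sub>R f x"
  proof (rule AE_I2)
    fix x
    show "(\<lambda>n. indicat_real \<Omega> x *\<^sub>R (f x * box_bump c d n x)) \<longlonglongrightarrow> indicat_real (box c d) x *\<^sub>R f x"
    proof (cases "x \<in> box c d")
      case True
      then have "x \<in> \<Omega>" using box_subset_cbox sub by auto
      have "(\<lambda>n. 1 *\<^sub>R (f x * box_bump c d n x)) \<longlonglongrightarrow> 1 *\<^sub>R (f x * 1)"
        by (intro tendsto_intros B(5) True)
      then show ?thesis using True \<open>x \<in> \<Omega>\<close> by simp
    qed (simp add: B(4))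
  qed
  show "AE x in lebesgue. norm (indicat_real \<Omega> x *\<^sub>R (f x * box_bump c d n x)) \<le> norm (indicat_real (cbox c d) x *\<^sub>R f x)" for n
    unfolding e norm_mult by (rule AE_I2) (use B(2,3) in \<open>simp add: mult_left_le_one_le\<close>)
qed

text \<open>The difference is cut off to \<open>box a b\<close>; its integral over any box is then
  an integral over a box inside, where it is a limit of pairings with
  \<open>box_bump\<close>.\<close>

lemma AE_eq_on_box:
  fixes g w :: "real^2 \<Rightarrow> real"
  assumes sub: "cbox a b \<subseteq> \<Omega>" and gi: "set_integrable lebesgue (cbox a b) g" and wi: "set_integrable lebesgue (cbox a b) w"
    and eq: "\<And>\<phi>. \<phi> \<in> test_functions \<Omega> \<Longrightarrow> regular_distr \<Omega> g \<phi> = regular_distr \<Omega> w \<phi>"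
  shows "AE x in lebesgue. x \<in> box a b \<longrightarrow> g x = w x"
proof -
  define f where "f x = indicat_real (box a b) x *\<^sub>R (g x - w x)" for x
  have si: "set_integrable lebesgue (cbox a b) (\<lambda>x. g x - w x)" by (rule set_integral_diff(1)[OF gi wi])
  have "set_integrable lebesgue (box a b) (\<lambda>x. g x - w x)"
    by (rule set_integrable_subset[OF si _ box_subset_cbox]) simp
  then have fi: "integrable lebesgue f" unfolding set_integrable_def f_def .
  have zero: "(LINT x:box c d|lebesgue. f x) = 0" for c d
  proof -
    obtain p q where pq: "box c d \<inter> box a b = box p q" by (rule that[OF box_Int_box])
    have "(\<lambda>x. indicat_real (box c d) x *\<^sub>R f x) = (\<lambda>x. indicat_real (box p q) x *\<^sub>R (g x - w x))"
      unfolding f_def pq[symmetric] by (auto simp: fun_eq_iff indicator_def)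
    then have e: "(LINT x:box c d|lebesgue. f x) = (LINT x:box p q|lebesgue. g x - w x)"
      unfolding set_lebesgue_integral_def by simp
    show ?thesis
    proof (cases "box p q = {}")
      case True
      then show ?thesis unfolding e by (simp add: set_lebesgue_integral_def)
    next
      case False
      have "closure (box p q) \<subseteq> closure (box a b)" using pq by (intro closure_mono) blast
      moreover have "closure (box a b) \<subseteq> cbox a b" by (rule closure_minimal[OF box_subset_cbox closed_cbox])
      ultimately have c: "cbox p q \<subseteq> cbox a b" using closure_box[OF False] by simp
      have gi': "set_integrable lebesgue (cbox p q) g" by (rule set_integrable_subset[OF gi _ c]) simp
      have wi': "set_integrable lebesgue (cbox p q) w" by (rule set_integrable_subset[OF wi _ c]) simp
      note c\<Omega> = order_trans[OF c sub]
      have "(\<lambda>n. regular_distr \<Omega> g (box_bump p q n)) = (\<lambda>n. regular_distr \<Omega> w (box_bump p q n))"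
        by (intro ext eq box_bump_props(1)[OF c\<Omega>])
      then have "(LINT x:box p q|lebesgue. g x) = (LINT x:box p q|lebesgue. w x)"
        using regular_distr_box_bump_limit[OF gi' c\<Omega>] regular_distr_box_bump_limit[OF wi' c\<Omega>]
        by (metis LIMSEQ_unique)
      moreover have "set_integrable lebesgue (box p q) g" "set_integrable lebesgue (box p q) w"
        by (rule set_integrable_subset[OF gi' _ box_subset_cbox], simp, rule set_integrable_subset[OF wi' _ box_subset_cbox], simp)
      ultimately show ?thesis unfolding e by (simp add: set_integral_diff(2))
    qed
  qed
  have "(LINT x:box a b|lebesgue. f x) = integral\<^sup>L lebesgue f"
    unfolding set_lebesgue_integral_def f_def
    by (intro Bochner_Integration.integral_cong refl) (simp add: indicator_def)
  then have "AE x in lebesgue. f x = 0" using zero by (intro AE_zero_if_box_integrals_zero[OF fi zero]) simp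
  then show ?thesis by (rule eventually_mono) (auto simp: f_def indicator_def split: if_splits)
qed

lemma L2_loc_set_integrable:
  fixes f :: "real^2 \<Rightarrow> real"
  assumes "f \<in> L2_loc \<Omega>" "cbox a b \<subseteq> \<Omega>"
  shows "set_integrable lebesgue (cbox a b) f"
proof -
  have m: "set_borel_measurable lebesgue (cbox a b) f" and s: "set_integrable lebesgue (cbox a b) (\<lambda>x. (f x)\<^sup>2)"
    using assms by (auto simp: L2_loc_def)
  have "set_integrable lebesgue (cbox a b) (\<lambda>x. 1 + (f x)\<^sup>2)"
    by (intro set_integral_add(1) s set_integrable_continuous_compact) auto
  then show ?thesis unfolding set_integrable_def
  proof (rule Bochner_Integration.integrable_bound)
    show "(\<lambda>x. indicat_real (cbox a b) x *\<^sub>R f x) \<in> borel_measurable lebesgue"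
      using m unfolding set_borel_measurable_def .
    have "\<bar>f x\<bar> \<le> 1 + (f x)\<^sup>2" for x
      using zero_le_power2[of "\<bar>f x\<bar> - 1"] by (simp add: power2_diff)
    then show "AE x in lebesgue. norm (indicat_real (cbox a b) x *\<^sub>R f x) \<le> norm (indicat_real (cbox a b) x *\<^sub>R (1 + (f x)\<^sup>2))"
      by (intro AE_I2) (simp add: indicator_def)
  qed
qed

text \<open>\<open>\<Omega>\<close> is a countable union of closed boxes. Equality holds almost
  everywhere in each open box, and the frontiers of the boxes are null sets.\<close>

lemma weak_grad_props:
  fixes V v :: "real^2 \<Rightarrow> real" and u :: "real^2 \<Rightarrow> real^2"
  assumes "open \<Omega>" "\<Omega> \<subseteq> box lo hi" and V: "\<And>x. has_grad2 V (u x $ 1) (u x $ 2) x" and uc: "continuous_on UNIV u"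
    and v: "\<And>x. x \<in> \<Omega> \<Longrightarrow> v x = V x"
  shows "AE x in lebesgue. x \<in> \<Omega> \<longrightarrow> weak_grad \<Omega> v x = u x" "(\<lambda>x. weak_grad \<Omega> v x $ i) \<in> L2_loc \<Omega>"
    "(\<lambda>x. u x $ i) \<in> L2_loc \<Omega>"
proof -
  have wu: "is_weak_grad \<Omega> v u" by (rule gradient_is_weak_grad[OF assms(2) V uc v])
  then have wg: "is_weak_grad \<Omega> v (weak_grad \<Omega> v)" unfolding weak_grad_def by (rule someI[of "is_weak_grad \<Omega> v"])
  show L: "(\<lambda>x. weak_grad \<Omega> v x $ i) \<in> L2_loc \<Omega>" "(\<lambda>x. u x $ i) \<in> L2_loc \<Omega>" for i
    using wu wg unfolding is_weak_grad_def by blast+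
  have eq: "regular_distr \<Omega> (\<lambda>x. weak_grad \<Omega> v x $ i) \<phi> = regular_distr \<Omega> (\<lambda>x. u x $ i) \<phi>"
    if "\<phi> \<in> test_functions \<Omega>" for i \<phi>
  proof -
    have "distr_eq \<Omega> (distr_deriv i (regular_distr \<Omega> v)) (regular_distr \<Omega> (\<lambda>x. u x $ i))"
      "distr_eq \<Omega> (distr_deriv i (regular_distr \<Omega> v)) (regular_distr \<Omega> (\<lambda>x. weak_grad \<Omega> v x $ i))"
      using wu wg unfolding is_weak_grad_def by blast+
    then show ?thesis using that unfolding distr_eq_def by metis
  qed
  obtain D where D: "countable D" "D \<subseteq> Pow \<Omega>" "\<And>X. X \<in> D \<Longrightarrow> \<exists>a b. X = cbox a b" "\<Union>D = \<Omega>"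
    using open_countable_Union_open_cbox[OF assms(1)] by blast
  have AEX: "AE x in lebesgue. x \<in> X \<longrightarrow> weak_grad \<Omega> v x = u x" if X: "X \<in> D" for X
  proof -
    obtain a b where ab: "X = cbox a b" using D(3)[OF X] by blast
    have sub: "cbox a b \<subseteq> \<Omega>" using D(2) X ab by blast
    have c: "AE x in lebesgue. x \<in> box a b \<longrightarrow> weak_grad \<Omega> v x $ i = u x $ i" for i
      by (rule AE_eq_on_box[OF sub L2_loc_set_integrable[OF L(1) sub] L2_loc_set_integrable[OF L(2) sub] eq])
    have n: "AE x in lebesgue. x \<notin> cbox a b - box a b"
      using negligible_frontier_interval[of a b] by (intro AE_not_in) (simp add: negligible_iff_null_sets)
    show ?thesis using c[of 1] c[of 2] n unfolding ab
      by eventually_elim (auto simp: vec_eq_iff forall_2)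
  qed
  have "AE x in lebesgue. \<forall>X\<in>D. x \<in> X \<longrightarrow> weak_grad \<Omega> v x = u x"
    unfolding AE_ball_countable[OF D(1)] by (intro ballI AEX)
  then show "AE x in lebesgue. x \<in> \<Omega> \<longrightarrow> weak_grad \<Omega> v x = u x"
    by (rule eventually_mono) (use D(4) in blast)
qed

text \<open>The chosen weak gradient is replaced by the continuous \<open>u\<close>. Composed
  distributional derivatives reach the test function in reverse order, whence the form of the mixed
  term.\<close>

lemma weak_det_integral_zero:
  fixes V v :: "real^2 \<Rightarrow> real" and u :: "real^2 \<Rightarrow> real^2"
  assumes \<Omega>: "open \<Omega>" "\<Omega> \<subseteq> box lo hi" and V: "\<And>x. has_grad2 V (u x $ 1) (u x $ 2) x" and uc: "continuous_on UNIV u"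
    and v: "\<And>x. x \<in> \<Omega> \<Longrightarrow> v x = V x" and eq: "distr_eq \<Omega> (very_weak_det_hessian \<Omega> v) (\<lambda>_. 0)"
    and \<phi>: "\<phi> \<in> test_functions \<Omega>"
  shows "integral (cbox lo hi) (\<lambda>x. (u x $ 1 * u x $ 1) * partial_deriv 2 (partial_deriv 2 \<phi>) x)
    + integral (cbox lo hi) (\<lambda>x. (u x $ 2 * u x $ 2) * partial_deriv 1 (partial_deriv 1 \<phi>) x)
    - 2 * integral (cbox lo hi) (\<lambda>x. (u x $ 1 * u x $ 2) * partial_deriv 2 (partial_deriv 1 \<phi>) x) = 0"
proof -
  define G where "G = weak_grad \<Omega> v"
  have AEG: "AE x in lebesgue. x \<in> \<Omega> \<longrightarrow> G x = u x"
    unfolding G_def by (rule weak_grad_props(1)[OF \<Omega> V uc v])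
  have LG: "(\<lambda>x. G x $ i) \<in> L2_loc \<Omega>" for i
    unfolding G_def by (rule weak_grad_props(2)[OF \<Omega> V uc v])
  have Lu: "(\<lambda>x. u x $ i) \<in> L2_loc \<Omega>" for i
    by (rule weak_grad_props(3)[OF \<Omega> V uc v])
  \<comment> \<open>Members of \<open>L2_loc\<close> are measurable only on compact subsets of
    \<open>\<Omega>\<close>; the support of the test function is one, and this suffices for the
    product.\<close>
  have meas: "(\<lambda>x. indicat_real \<Omega> x *\<^sub>R (f x * h x * \<psi> x)) \<in> borel_measurable lebesgue"
    if \<psi>: "\<psi> \<in> test_functions \<Omega>" and fh: "f \<in> L2_loc \<Omega>" "h \<in> L2_loc \<Omega>" for f h \<psi> :: "real^2 \<Rightarrow> real"
  proof -
    note T = test_function_props[OF \<psi>]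
    define K where "K = closure {x. \<psi> x \<noteq> 0}"
    have K: "compact K" "K \<subseteq> \<Omega>" using T(3,4) by (simp_all add: K_def)
    have m: "(\<lambda>x. indicat_real K x *\<^sub>R f x) \<in> borel_measurable lebesgue" "(\<lambda>x. indicat_real K x *\<^sub>R h x) \<in> borel_measurable lebesgue"
      using fh K unfolding L2_loc_def set_borel_measurable_def by blast+
    have "\<psi> \<in> borel_measurable lborel" using borel_measurable_continuous_onI[OF T(1)] by simp
    then have "\<psi> \<in> borel_measurable lebesgue" by (rule measurable_completion)
    then have "(\<lambda>x. (indicat_real K x *\<^sub>R f x) * (indicat_real K x *\<^sub>R h x) * \<psi> x) \<in> borel_measurable lebesgue"
      by (intro borel_measurable_times m)
    moreover have "(\<lambda>x. indicat_real \<Omega> x *\<^sub>R (f x * h x * \<psi> x)) = (\<lambda>x. (indicat_real K x *\<^sub>R f x) * (indicat_real K x *\<^sub>R h x) * \<psi> x)"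
    proof
      fix x
      show "indicat_real \<Omega> x *\<^sub>R (f x * h x * \<psi> x) = (indicat_real K x *\<^sub>R f x) * (indicat_real K x *\<^sub>R h x) * \<psi> x"
      proof (cases "x \<in> K")
        case True
        then show ?thesis using K(2) by (auto simp: indicator_def)
      next
        case False
        then have "\<psi> x = 0" unfolding K_def by (rule T(5))
        then show ?thesis by simp
      qed
    qed
    ultimately show ?thesis by simp
  qed
  have R: "regular_distr \<Omega> (\<lambda>x. G x $ i * G x $ j) \<psi> = integral (cbox lo hi) (\<lambda>x. (u x $ i * u x $ j) * \<psi> x)"
    if \<psi>: "\<psi> \<in> test_functions \<Omega>" for i j \<psi>
  proof -
    have "regular_distr \<Omega> (\<lambda>x. G x $ i * G x $ j) \<psi> = regular_distr \<Omega> (\<lambda>x. u x $ i * u x $ j) \<psi>"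
      unfolding regular_distr_def set_lebesgue_integral_def
    proof (rule integral_cong_AE)
      show "(\<lambda>x. indicat_real \<Omega> x *\<^sub>R (G x $ i * G x $ j * \<psi> x)) \<in> borel_measurable lebesgue"
        by (rule meas[OF \<psi> LG LG])
      show "(\<lambda>x. indicat_real \<Omega> x *\<^sub>R (u x $ i * u x $ j * \<psi> x)) \<in> borel_measurable lebesgue"
        by (rule meas[OF \<psi> Lu Lu])
      show "AE x in lebesgue. indicat_real \<Omega> x *\<^sub>R (G x $ i * G x $ j * \<psi> x) = indicat_real \<Omega> x *\<^sub>R (u x $ i * u x $ j * \<psi> x)"
        using AEG by (rule eventually_mono) (auto simp: indicator_def)
    qed
    also have "\<dots> = integral (cbox lo hi) (\<lambda>x. (u x $ i * u x $ j) * \<psi> x)"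
    proof (rule regular_distr_eq_integral[OF _ \<psi>])
      show "continuous_on UNIV (\<lambda>x. u x $ i * u x $ j)" by (intro continuous_intros uc)
      show "\<Omega> \<subseteq> cbox lo hi" using \<Omega>(2) box_subset_cbox by (rule order_trans)
    qed
    finally show ?thesis .
  qed
  have pd: "partial_deriv i \<psi> \<in> test_functions \<Omega>" if "\<psi> \<in> test_functions \<Omega>" for i \<psi>
    using test_function_props(6)[OF that] .
  have "very_weak_det_hessian \<Omega> v \<phi> = 0" using eq \<phi> by (simp add: distr_eq_def)
  then have "regular_distr \<Omega> (\<lambda>x. G x $ 1 * G x $ 1) (partial_deriv 2 (partial_deriv 2 \<phi>))
    + regular_distr \<Omega> (\<lambda>x. G x $ 2 * G x $ 2) (partial_deriv 1 (partial_deriv 1 \<phi>))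
    - 2 * regular_distr \<Omega> (\<lambda>x. G x $ 1 * G x $ 2) (partial_deriv 2 (partial_deriv 1 \<phi>)) = 0"
    by (simp add: very_weak_det_hessian_def curl_curl_def distr_deriv_def tensor_def G_def)
  then show ?thesis unfolding R[OF pd[OF pd[OF \<phi>]]] .
qed

section \<open>Mollification\<close>

text \<open>The integral runs over a fixed box, so this is a convolution of \<open>f\<close> cut off
  outside the box. It behaves as a mollification of \<open>f\<close> only where the kernel centred
  at \<open>x\<close> fits into the box, hence the conditions on \<open>cube\<close> below.\<close>

definition conv :: "real^2 \<Rightarrow> real^2 \<Rightarrow> (real^2 \<Rightarrow> real) \<Rightarrow> (real^2 \<Rightarrow> real) \<Rightarrow> real^2 \<Rightarrow> real" where
  "conv lo hi f k x = integral (cbox lo hi) (\<lambda>y. f y * k (x - y))"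

lemma conv_integrable:
  fixes f k :: "real^2 \<Rightarrow> real"
  assumes "continuous_on UNIV f" "continuous_on UNIV k"
  shows "(\<lambda>y. f y * k (x - y)) integrable_on cbox lo hi"
  by (intro integrable_continuous continuous_on_mult continuous_on_subset[OF assms(1)]
      continuous_on_compose2[OF assms(2)] continuous_on_diff continuous_on_const continuous_on_id) auto

lemma conv_continuous:
  assumes "continuous_on UNIV f" "continuous_on UNIV k"
  shows "continuous_on S (conv lo hi f k)"
proof -
  have "continuous_on UNIV (\<lambda>x. integral (cbox lo hi) (\<lambda>y. f y * k (x - y)))"
  proof (rule integral_continuous_on_param)
    have "continuous_on (UNIV \<times> cbox lo hi) (\<lambda>z. f (snd z) * k (fst z - snd z))"
      by (intro continuous_on_mult continuous_on_compose2[OF assms(1)] continuous_on_compose2[OF assms(2)]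
          continuous_on_diff continuous_on_fst continuous_on_snd continuous_on_id) auto
    then show "continuous_on (UNIV \<times> cbox lo hi) (\<lambda>(x, y). f y * k (x - y))" by (simp add: split_beta)
  qed
  then show ?thesis unfolding conv_def by (rule continuous_on_subset) simp
qed

lemma conv_has_grad2:
  assumes f: "continuous_on UNIV f" and k: "\<And>z. has_grad2 k (k1 z) (k2 z) z"
    and c: "continuous_on UNIV k1" "continuous_on UNIV k2"
  shows "has_grad2 (conv lo hi f k) (conv lo hi f k1 x) (conv lo hi f k2 x) x"
proof -
  \<comment> \<open>The gradient of the kernel as a bounded linear map, the form in which
    \<open>leibniz_rule\<close> differentiates under the integral.\<close>
  define L :: "real^2 \<Rightarrow> (real^2) \<Rightarrow>\<^sub>L real" where
    "L z = k1 z *\<^sub>R blinfun_inner_left (axis 1 1 :: real^2) + k2 z *\<^sub>R blinfun_inner_left (axis 2 1 :: real^2)" for z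
  have L: "blinfun_apply (L z) h = k1 z * h $ 1 + k2 z * h $ 2" for z h
    by (simp add: L_def blinfun.add_left blinfun.scaleR_left inner_axis inner_commute)
  have ck: "continuous_on UNIV k" using k by (rule has_grad2_continuous_on)
  have cL: "continuous_on UNIV L" unfolding L_def
    by (intro continuous_on_add continuous_on_scaleR c continuous_on_const)
  have cF: "continuous_on S (\<lambda>y. f y *\<^sub>R L (x - y))" for S x
    by (intro continuous_on_scaleR continuous_on_subset[OF f] continuous_on_compose2[OF cL] continuous_on_diff
        continuous_on_const continuous_on_id) auto
  have "((\<lambda>x. integral (cbox lo hi) (\<lambda>y. f y * k (x - y))) has_derivative
      blinfun_apply (integral (cbox lo hi) (\<lambda>y. f y *\<^sub>R L (x - y)))) (at x within UNIV)"
  proof (rule leibniz_rule[where fx = "\<lambda>x y. f y *\<^sub>R L (x - y)"])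
    fix x y :: "real^2"
    have "has_grad2 (\<lambda>x. f y * k (x - y)) (f y * k1 (x - y)) (f y * k2 (x - y)) x"
      by (intro has_grad2_cmult has_grad2_shift k)
    moreover have "blinfun_apply (f y *\<^sub>R L (x - y)) = (\<lambda>h. f y * k1 (x - y) * h $ 1 + f y * k2 (x - y) * h $ 2)"
      by (simp add: fun_eq_iff blinfun.scaleR_left L algebra_simps)
    ultimately show "((\<lambda>x. f y * k (x - y)) has_derivative blinfun_apply (f y *\<^sub>R L (x - y))) (at x within UNIV)"
      by (simp add: has_grad2_def)
  next
    fix x show "(\<lambda>y. f y * k (x - y)) integrable_on cbox lo hi" by (rule conv_integrable[OF f ck])
  next
    have "continuous_on (UNIV \<times> cbox lo hi) (\<lambda>z. f (snd z) *\<^sub>R L (fst z - snd z))"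
      by (intro continuous_on_scaleR continuous_on_compose2[OF f] continuous_on_compose2[OF cL]
          continuous_on_diff continuous_on_fst continuous_on_snd continuous_on_id) auto
    then show "continuous_on (UNIV \<times> cbox lo hi) (\<lambda>(x, y). f y *\<^sub>R L (x - y))" by (simp add: split_beta)
  qed auto
  moreover have "blinfun_apply (integral (cbox lo hi) (\<lambda>y. f y *\<^sub>R L (x - y)))
      = (\<lambda>h. conv lo hi f k1 x * h $ 1 + conv lo hi f k2 x * h $ 2)"
  proof
    fix h :: "real^2"
    have i: "(\<lambda>y. f y *\<^sub>R L (x - y)) integrable_on cbox lo hi" by (rule integrable_continuous[OF cF])
    have "blinfun_apply (integral (cbox lo hi) (\<lambda>y. f y *\<^sub>R L (x - y))) h
        = integral (cbox lo hi) ((\<lambda>b. blinfun_apply b h) \<circ> (\<lambda>y. f y *\<^sub>R L (x - y)))"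
      by (rule integral_linear[OF i blinfun.bounded_linear_left, symmetric])
    also have "(\<lambda>b. blinfun_apply b h) \<circ> (\<lambda>y. f y *\<^sub>R L (x - y)) = (\<lambda>y. f y * k1 (x - y) * h $ 1 + f y * k2 (x - y) * h $ 2)"
      by (simp add: fun_eq_iff blinfun.scaleR_left L algebra_simps)
    also have "integral (cbox lo hi) (\<lambda>y. f y * k1 (x - y) * h $ 1 + f y * k2 (x - y) * h $ 2)
        = integral (cbox lo hi) (\<lambda>y. f y * k1 (x - y) * h $ 1) + integral (cbox lo hi) (\<lambda>y. f y * k2 (x - y) * h $ 2)"
      by (intro integral_add integrable_on_mult_left conv_integrable f c)
    also have "\<dots> = conv lo hi f k1 x * h $ 1 + conv lo hi f k2 x * h $ 2"
      by (simp add: conv_def)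
    finally show "blinfun_apply (integral (cbox lo hi) (\<lambda>y. f y *\<^sub>R L (x - y))) h
      = conv lo hi f k1 x * h $ 1 + conv lo hi f k2 x * h $ 2" .
  qed
  ultimately show ?thesis unfolding has_grad2_def conv_def by simp
qed

lemma conv_diff_const:
  fixes f k :: "real^2 \<Rightarrow> real"
  assumes "continuous_on UNIV f" "continuous_on UNIV k"
  shows "conv lo hi (\<lambda>y. f y - p) k x = conv lo hi f k x - p * conv lo hi (\<lambda>_. 1) k x"
proof -
  have "(\<lambda>y. (f y - p) * k (x - y)) = (\<lambda>y. f y * k (x - y) - p * (1 * k (x - y)))"
    by (simp add: fun_eq_iff algebra_simps)
  then show ?thesis unfolding conv_def
    by (simp only: integral_diff[OF conv_integrable[OF assms] integrable_on_mult_right[OF conv_integrable[OF continuous_on_const assms(2)]]]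
        integral_mult_right)
qed

lemma conv_diff_const_mult:
  fixes f g k :: "real^2 \<Rightarrow> real"
  assumes c: "continuous_on UNIV f" "continuous_on UNIV g" "continuous_on UNIV k"
  shows "conv lo hi (\<lambda>y. (f y - p) * (g y - q)) k x = conv lo hi (\<lambda>y. f y * g y) k x
    - q * conv lo hi f k x - p * conv lo hi g k x + p * q * conv lo hi (\<lambda>_. 1) k x"
proof -
  have cf: "continuous_on UNIV (\<lambda>y. f y * (g y - q))" "continuous_on UNIV (\<lambda>y. g y * f y)"
    by (intro continuous_intros c)+
  have "conv lo hi (\<lambda>y. (f y - p) * (g y - q)) k x
      = conv lo hi (\<lambda>y. f y * (g y - q)) k x - p * conv lo hi (\<lambda>y. g y - q) k x"
  proof -
    have "(\<lambda>y. (f y - p) * (g y - q) * k (x - y)) = (\<lambda>y. f y * (g y - q) * k (x - y) - p * ((g y - q) * k (x - y)))"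
      by (simp add: fun_eq_iff algebra_simps)
    moreover have "continuous_on UNIV (\<lambda>y. g y - q)" by (intro continuous_intros c)
    ultimately show ?thesis unfolding conv_def
      by (simp only: integral_diff[OF conv_integrable[OF cf(1) c(3)] integrable_on_mult_right[OF conv_integrable[OF _ c(3)]]]
          integral_mult_right)
  qed
  moreover have "conv lo hi (\<lambda>y. f y * (g y - q)) k x = conv lo hi (\<lambda>y. f y * g y) k x - q * conv lo hi f k x"
  proof -
    have "(\<lambda>y. f y * (g y - q) * k (x - y)) = (\<lambda>y. (f y * g y) * k (x - y) - q * (f y * k (x - y)))"
      by (simp add: fun_eq_iff algebra_simps)
    moreover have "continuous_on UNIV (\<lambda>y. f y * g y)" by (intro continuous_intros c)
    ultimately show ?thesis unfolding conv_def
      by (simp only: integral_diff[OF conv_integrable[OF _ c(3)] integrable_on_mult_right[OF conv_integrable[OF c(1,3)]]]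
          integral_mult_right)
  qed
  ultimately show ?thesis by (simp add: conv_diff_const[OF c(2,3)] algebra_simps)
qed

section \<open>Mollifying kernels and their derivatives\<close>

definition cube :: "real^2 \<Rightarrow> real \<Rightarrow> (real^2) set" where
  "cube x \<epsilon> = cbox (x - \<epsilon> *\<^sub>R 1) (x + \<epsilon> *\<^sub>R 1)"

lemma mem_cube: "y \<in> cube x \<epsilon> \<longleftrightarrow> \<bar>x $ 1 - y $ 1\<bar> \<le> \<epsilon> \<and> \<bar>x $ 2 - y $ 2\<bar> \<le> \<epsilon>"
  by (auto simp: cube_def mem_box_cart forall_2 abs_le_iff)

lemma content_cube: "0 \<le> \<epsilon> \<Longrightarrow> measure lborel (cube x \<epsilon>) = 4 * \<epsilon>\<^sup>2"
proof -
  assume "0 \<le> \<epsilon>"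
  then have "x \<in> cube x \<epsilon>" by (simp add: mem_cube)
  then have "cube x \<epsilon> \<noteq> {}" by auto
  then show ?thesis unfolding cube_def
    by (subst content_cbox_cart) (simp_all add: UNIV_2 power2_eq_square)
qed

lemma abs_conv_le:
  fixes f k :: "real^2 \<Rightarrow> real"
  assumes c: "continuous_on UNIV f" "continuous_on UNIV k" and S: "cube x \<epsilon> \<subseteq> cbox lo hi" and "0 < \<epsilon>"
    and k0: "\<And>z. \<not> (\<bar>z $ 1\<bar> \<le> \<epsilon> \<and> \<bar>z $ 2\<bar> \<le> \<epsilon>) \<Longrightarrow> k z = 0"
    and A: "\<And>y. y \<in> cube x \<epsilon> \<Longrightarrow> \<bar>f y\<bar> \<le> A" "0 \<le> A" and B: "\<And>z. \<bar>k z\<bar> \<le> B" "0 \<le> B"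
  shows "\<bar>conv lo hi f k x\<bar> \<le> A * B * (4 * \<epsilon>\<^sup>2)"
proof -
  have "conv lo hi f k x = integral (cube x \<epsilon>) (\<lambda>y. f y * k (x - y))"
    unfolding conv_def cube_def
  proof (rule integral_cbox_support[where K = "cube x \<epsilon>"])
    show "f y * k (x - y) = 0" if "y \<notin> cube x \<epsilon>" for y
      using k0[of "x - y"] that by (simp add: mem_cube)
  qed (use S in \<open>simp_all add: cube_def\<close>)
  moreover have "\<bar>integral (cube x \<epsilon>) (\<lambda>y. f y * k (x - y))\<bar> \<le> (A * B) * measure lborel (cube x \<epsilon>)"
  proof -
    have "((\<lambda>y. f y * k (x - y)) has_integral integral (cube x \<epsilon>) (\<lambda>y. f y * k (x - y))) (cube x \<epsilon>)"
      unfolding cube_def by (rule integrable_integral[OF conv_integrable[OF c]])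
    moreover have "norm (f y * k (x - y)) \<le> A * B" if "y \<in> cube x \<epsilon>" for y
      unfolding real_norm_def abs_mult by (rule mult_mono[OF A(1)[OF that] B(1) A(2)]) simp
    ultimately show ?thesis
      using has_integral_bound[of "A * B" "\<lambda>y. f y * k (x - y)"] A(2) B(2) unfolding cube_def by auto
  qed
  ultimately show ?thesis using \<open>0 < \<epsilon>\<close> by (simp add: content_cube)
qed

definition bump_mass :: real where
  "bump_mass = integral (cube 0 1) (\<lambda>z. bumpd 0 (z $ 1) * bumpd 0 (z $ 2))"

lemma continuous_on_bumpd_component: "continuous_on S (\<lambda>z::real^2. bumpd n (c * z $ i))"
  by (intro continuous_on_compose2[OF bumpd_cont[of UNIV]] continuous_intros) auto

lemma bump_mass_pos: "0 < bump_mass"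
proof -
  have c: "continuous_on S (\<lambda>z::real^2. bumpd 0 (z $ 1) * bumpd 0 (z $ 2))" for S
    using continuous_on_mult[OF continuous_on_bumpd_component[of S 0 1 1] continuous_on_bumpd_component[of S 0 1 2]] by simp
  have nn: "0 \<le> bumpd 0 (z $ 1) * bumpd 0 (z $ 2)" for z :: "real^2" by (intro mult_nonneg_nonneg bump_props(1))
  have i: "((\<lambda>z::real^2. bumpd 0 (z $ 1) * bumpd 0 (z $ 2)) has_integral bump_mass) (cube 0 1)"
    unfolding bump_mass_def cube_def by (rule integrable_integral[OF integrable_continuous[OF c]])
  have "0 \<le> bump_mass" by (rule has_integral_nonneg[OF i]) (rule nn)
  moreover have "bump_mass \<noteq> 0"
  proof
    assume "bump_mass = 0"
    then have "bumpd 0 ((0::real^2) $ 1) * bumpd 0 ((0::real^2) $ 2) = 0"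
      using i unfolding cube_def
      by (intro has_integral_0_cbox_imp_0[OF c nn, of "0 - 1 *\<^sub>R 1" "0 + 1 *\<^sub>R 1"])
         (auto simp: mem_box_cart interval_eq_empty_cart box_ne_empty inner_axis Basis_vec_def)
    then show False using bump_props(3) by simp
  qed
  ultimately show ?thesis by simp
qed

text \<open>The mixed derivative of orders \<open>m\<close> and \<open>n\<close> of a mollifier of
  width \<open>\<epsilon>\<close> and mass one. In the exponent, 2 normalises the integral in the
  plane and \<open>m + n\<close> comes from the chain rule.\<close>

definition ker :: "real \<Rightarrow> nat \<Rightarrow> nat \<Rightarrow> real^2 \<Rightarrow> real" where
  "ker \<epsilon> m n z = (1 / (bump_mass * \<epsilon> ^ (m + n + 2))) * (bumpd m (inverse \<epsilon> * z $ 1) * bumpd n (inverse \<epsilon> * z $ 2))"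

lemma ker_grad:
  assumes "0 < \<epsilon>"
  shows "has_grad2 (ker \<epsilon> m n) (ker \<epsilon> (Suc m) n z) (ker \<epsilon> m (Suc n) z) z"
proof -
  have d: "((\<lambda>t. bumpd m (inverse \<epsilon> * t)) has_real_derivative bumpd (Suc m) (inverse \<epsilon> * t) * inverse \<epsilon>) (at t)" for m t
    by (rule DERIV_chain2[OF bumpd_deriv]) (auto intro!: derivative_eq_intros)
  have "has_grad2 (ker \<epsilon> m n)
      ((1 / (bump_mass * \<epsilon> ^ (m + n + 2))) * (bumpd (Suc m) (inverse \<epsilon> * z $ 1) * inverse \<epsilon> * bumpd n (inverse \<epsilon> * z $ 2)))
      ((1 / (bump_mass * \<epsilon> ^ (m + n + 2))) * (bumpd m (inverse \<epsilon> * z $ 1) * (bumpd (Suc n) (inverse \<epsilon> * z $ 2) * inverse \<epsilon>))) z"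
    unfolding ker_def by (rule has_grad2_cmult, rule has_grad2_tensor[OF d d])
  then show ?thesis
    by (rule has_grad2_eq) (simp_all add: ker_def divide_inverse mult_ac)
qed

lemma ker_cont: "continuous_on S (ker \<epsilon> m n)"
  unfolding ker_def by (intro continuous_on_mult continuous_on_const continuous_on_bumpd_component)

lemma ker_zero:
  assumes "0 < \<epsilon>" "\<not> (\<bar>z $ 1\<bar> \<le> \<epsilon> \<and> \<bar>z $ 2\<bar> \<le> \<epsilon>)"
  shows "ker \<epsilon> m n z = 0"
proof -
  have "1 < \<bar>inverse \<epsilon> * z $ i\<bar>" if "\<epsilon> < \<bar>z $ i\<bar>" for i
    using assms(1) that by (simp add: abs_mult inverse_eq_divide)
  then have "bumpd m (inverse \<epsilon> * z $ 1) = 0 \<or> bumpd n (inverse \<epsilon> * z $ 2) = 0"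
    using assms(2) bumpd_zero by (meson not_le)
  then show ?thesis by (auto simp: ker_def)
qed

lemma ker_integral:
  assumes "0 < \<epsilon>" "cube x \<epsilon> \<subseteq> cbox lo hi"
  shows "conv lo hi (\<lambda>_. 1) (ker \<epsilon> 0 0) x = 1"
proof -
  define h :: "real^2 \<Rightarrow> real" where "h z = bumpd 0 (z $ 1) * bumpd 0 (z $ 2)" for z
  have c: "continuous_on S h" for S
    unfolding h_def
    using continuous_on_mult[OF continuous_on_bumpd_component[of S 0 1 1] continuous_on_bumpd_component[of S 0 1 2]] by simp
  have i: "(h has_integral bump_mass) (cbox (- 1) 1)"
    using integrable_integral[OF integrable_continuous[OF c[of "cbox (- 1) 1"]]] unfolding bump_mass_def cube_def h_def by simp
  have I1: "((\<lambda>y. h (inverse \<epsilon> *\<^sub>R y + - (inverse \<epsilon> *\<^sub>R x))) has_integral (bump_mass /\<^sub>R inverse \<epsilon> ^ DIM(real^2)))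
      (cbox ((- 1 - - (inverse \<epsilon> *\<^sub>R x)) /\<^sub>R inverse \<epsilon>) ((1 - - (inverse \<epsilon> *\<^sub>R x)) /\<^sub>R inverse \<epsilon>))"
    by (rule has_integral_affinity'[OF i]) (use assms in simp)
  have I2: "cbox ((- 1 - - (inverse \<epsilon> *\<^sub>R x)) /\<^sub>R inverse \<epsilon>) ((1 - - (inverse \<epsilon> *\<^sub>R x)) /\<^sub>R inverse \<epsilon>) = cube x \<epsilon>"
    unfolding cube_def using assms(1) by (simp add: scaleR_diff_right scaleR_add_right algebra_simps)
  have I3: "bump_mass /\<^sub>R inverse \<epsilon> ^ DIM(real^2) = bump_mass * \<epsilon>\<^sup>2"
    by (simp add: power_inverse mult.commute)
  \<comment> \<open>The affine substitution produces \<open>y - x\<close>, the convolution has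
    \<open>x - y\<close>; the bump is even.\<close>
  have I4: "(\<lambda>y. h (inverse \<epsilon> *\<^sub>R y + - (inverse \<epsilon> *\<^sub>R x))) = (\<lambda>y. h (inverse \<epsilon> *\<^sub>R (x - y)))"
  proof
    fix y
    have "bumpd 0 (inverse \<epsilon> * y $ j - inverse \<epsilon> * x $ j) = bumpd 0 (inverse \<epsilon> * x $ j - inverse \<epsilon> * y $ j)" for j
      using bump_props(2)[of "inverse \<epsilon> * x $ j - inverse \<epsilon> * y $ j"] by simp
    then show "h (inverse \<epsilon> *\<^sub>R y + - (inverse \<epsilon> *\<^sub>R x)) = h (inverse \<epsilon> *\<^sub>R (x - y))"
      unfolding h_def by (simp add: right_diff_distrib)
  qed
  have "((\<lambda>y. h (inverse \<epsilon> *\<^sub>R (x - y))) has_integral bump_mass * \<epsilon>\<^sup>2) (cube x \<epsilon>)"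
    using I1 unfolding I2 I3 I4 .
  from has_integral_mult_right[OF this, of "1 / (bump_mass * \<epsilon> ^ 2)"]
  have "((\<lambda>y. 1 * ker \<epsilon> 0 0 (x - y)) has_integral 1) (cube x \<epsilon>)"
    using assms(1) bump_mass_pos by (simp add: ker_def h_def numeral_2_eq_2)
  moreover have "conv lo hi (\<lambda>_. 1) (ker \<epsilon> 0 0) x = integral (cube x \<epsilon>) (\<lambda>y. 1 * ker \<epsilon> 0 0 (x - y))"
    unfolding conv_def cube_def
  proof (rule integral_cbox_support[where K = "cube x \<epsilon>"])
    show "1 * ker \<epsilon> 0 0 (x - y) = 0" if "y \<notin> cube x \<epsilon>" for y
      using ker_zero[OF assms(1), of "x - y"] that by (simp add: mem_cube)
  qed (use assms(2) in \<open>simp_all add: cube_def\<close>)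
  ultimately show ?thesis by (simp add: integral_unique)
qed

lemma ker_by_parts:
  assumes "0 < \<epsilon>" "cube x \<epsilon> \<subseteq> box lo hi" and V: "\<And>y. has_grad2 V (v1 y) (v2 y) y"
    and c: "continuous_on UNIV v1" "continuous_on UNIV v2"
  shows "conv lo hi v1 (ker \<epsilon> m n) x = conv lo hi V (ker \<epsilon> (Suc m) n) x"
    "conv lo hi v2 (ker \<epsilon> m n) x = conv lo hi V (ker \<epsilon> m (Suc n)) x"
proof -
  have cV: "continuous_on UNIV V" using V by (rule has_grad2_continuous_on)
  have G: "has_grad2 (\<lambda>y. V y * ker \<epsilon> m n (x - y))
      (v1 y * ker \<epsilon> m n (x - y) + V y * - ker \<epsilon> (Suc m) n (x - y))
      (v2 y * ker \<epsilon> m n (x - y) + V y * - ker \<epsilon> m (Suc n) (x - y)) y" for y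
    by (intro has_grad2_mult V has_grad2_reflect ker_grad assms(1))
  have ck: "continuous_on UNIV (\<lambda>y. ker \<epsilon> i j (x - y))" for i j
    by (intro continuous_on_compose2[OF ker_cont[of UNIV]] continuous_on_diff continuous_on_const continuous_on_id) auto
  have cc: "continuous_on UNIV (\<lambda>y. v1 y * ker \<epsilon> m n (x - y) + V y * - ker \<epsilon> (Suc m) n (x - y))"
    "continuous_on UNIV (\<lambda>y. v2 y * ker \<epsilon> m n (x - y) + V y * - ker \<epsilon> m (Suc n) (x - y))"
    by (intro continuous_on_add continuous_on_mult continuous_on_minus c cV ck)+
  have z: "V y * ker \<epsilon> m n (x - y) = 0" if "y \<notin> cube x \<epsilon>" for y
    using ker_zero[OF assms(1), of "x - y"] that by (simp add: mem_cube)
  have cube: "compact (cube x \<epsilon>)" by (simp add: cube_def)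
  note D = integral_directional_derivative_zero[OF cube assms(2) z G cc]
  have "integral (cbox lo hi) (\<lambda>y. v1 y * ker \<epsilon> m n (x - y) + V y * - ker \<epsilon> (Suc m) n (x - y)) = 0"
    using D[of "axis 1 1 :: real^2"] by (simp add: axis_def)
  then have "integral (cbox lo hi) (\<lambda>y. v1 y * ker \<epsilon> m n (x - y) - V y * ker \<epsilon> (Suc m) n (x - y)) = 0" by simp
  then show "conv lo hi v1 (ker \<epsilon> m n) x = conv lo hi V (ker \<epsilon> (Suc m) n) x"
    unfolding conv_def by (simp add: integral_diff conv_integrable c cV ker_cont)
  have "integral (cbox lo hi) (\<lambda>y. v2 y * ker \<epsilon> m n (x - y) + V y * - ker \<epsilon> m (Suc n) (x - y)) = 0"
    using D[of "axis 2 1 :: real^2"] by (simp add: axis_def)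
  then have "integral (cbox lo hi) (\<lambda>y. v2 y * ker \<epsilon> m n (x - y) - V y * ker \<epsilon> m (Suc n) (x - y)) = 0" by simp
  then show "conv lo hi v2 (ker \<epsilon> m n) x = conv lo hi V (ker \<epsilon> m (Suc n)) x"
    unfolding conv_def by (simp add: integral_diff conv_integrable c cV ker_cont)
qed

text \<open>Testing the equation with the kernel reflected at \<open>x\<close> turns it into an
  identity between mollified products at \<open>x\<close>. The signs from the reflection cancel in
  second derivatives.\<close>

lemma ker_test_function:
  assumes "0 < \<epsilon>" "cube x \<epsilon> \<subseteq> \<Omega>"
  defines "\<phi> \<equiv> \<lambda>y. ker \<epsilon> 0 0 (x - y)"
  shows "\<phi> \<in> test_functions \<Omega>"
    "partial_deriv 2 (partial_deriv 2 \<phi>) = (\<lambda>y. ker \<epsilon> 0 2 (x - y))"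
    "partial_deriv 1 (partial_deriv 1 \<phi>) = (\<lambda>y. ker \<epsilon> 2 0 (x - y))"
    "partial_deriv 2 (partial_deriv 1 \<phi>) = (\<lambda>y. ker \<epsilon> 1 1 (x - y))"
proof -
  define w where "w = 1 / (bump_mass * \<epsilon> ^ (0 + 0 + 2))"
  define f where "f t = w * bumpd 0 ((- inverse \<epsilon>) * t + inverse \<epsilon> * x $ 1)" for t
  define g where "g t = bumpd 0 ((- inverse \<epsilon>) * t + inverse \<epsilon> * x $ 2)" for t
  have "\<phi> = (\<lambda>y. f (y $ 1) * g (y $ 2))"
    by (simp add: fun_eq_iff \<phi>_def ker_def f_def g_def w_def right_diff_distrib)
  moreover have "(\<lambda>y. f (y $ 1) * g (y $ 2)) \<in> test_functions \<Omega>"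
  proof (rule tensor_test_function)
    show "diff1 k f" "diff1 k g" for k
      unfolding f_def g_def by (intro diff1_mult diff1_const diff1_affine bumpd_smooth)+
    show "cbox (x - \<epsilon> *\<^sub>R 1) (x + \<epsilon> *\<^sub>R 1) \<subseteq> \<Omega>" using assms(2) by (simp add: cube_def)
    have out: "bumpd 0 ((- inverse \<epsilon>) * t + inverse \<epsilon> * x $ i) = 0" if "t \<notin> {(x - \<epsilon> *\<^sub>R 1) $ i..(x + \<epsilon> *\<^sub>R 1) $ i}" for t i
    proof (rule bumpd_zero)
      have "\<epsilon> < \<bar>x $ i - t\<bar>" using that by auto
      then have "1 < inverse \<epsilon> * \<bar>x $ i - t\<bar>" using assms(1) by (simp add: inverse_eq_divide)
      also have "\<dots> = \<bar>(- inverse \<epsilon>) * t + inverse \<epsilon> * x $ i\<bar>"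
      proof -
        have "(- inverse \<epsilon>) * t + inverse \<epsilon> * x $ i = inverse \<epsilon> * (x $ i - t)" by (simp add: algebra_simps)
        then show ?thesis using assms(1) by (simp add: abs_mult)
      qed
      finally show "1 < \<bar>(- inverse \<epsilon>) * t + inverse \<epsilon> * x $ i\<bar>" .
    qed
    show "f t = 0" if "t \<notin> {(x - \<epsilon> *\<^sub>R 1) $ 1..(x + \<epsilon> *\<^sub>R 1) $ 1}" for t
      unfolding f_def using out[OF that] by simp
    show "g t = 0" if "t \<notin> {(x - \<epsilon> *\<^sub>R 1) $ 2..(x + \<epsilon> *\<^sub>R 1) $ 2}" for t
      unfolding g_def using out[OF that] by simp
  qed
  ultimately show "\<phi> \<in> test_functions \<Omega>" by simp
  have r: "has_grad2 (\<lambda>y. ker \<epsilon> m n (x - y)) (- ker \<epsilon> (Suc m) n (x - y)) (- ker \<epsilon> m (Suc n) (x - y)) y" for m n y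
    by (rule has_grad2_reflect[OF ker_grad[OF assms(1)]])
  have r': "has_grad2 (\<lambda>y. - ker \<epsilon> m n (x - y)) (ker \<epsilon> (Suc m) n (x - y)) (ker \<epsilon> m (Suc n) (x - y)) y" for m n y
    using has_grad2_cmult[OF r, of "-1"] by simp
  have p: "partial_deriv 1 \<phi> = (\<lambda>y. - ker \<epsilon> (Suc 0) 0 (x - y))" "partial_deriv 2 \<phi> = (\<lambda>y. - ker \<epsilon> 0 (Suc 0) (x - y))"
    unfolding \<phi>_def by (rule ext, rule has_grad2_partial_deriv[OF r])+
  show "partial_deriv 2 (partial_deriv 2 \<phi>) = (\<lambda>y. ker \<epsilon> 0 2 (x - y))"
    unfolding p numeral_2_eq_2 by (rule ext, rule has_grad2_partial_deriv(2)[OF r', unfolded numeral_2_eq_2])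
  show "partial_deriv 1 (partial_deriv 1 \<phi>) = (\<lambda>y. ker \<epsilon> 2 0 (x - y))"
    unfolding p numeral_2_eq_2 by (rule ext, rule has_grad2_partial_deriv(1)[OF r'])
  show "partial_deriv 2 (partial_deriv 1 \<phi>) = (\<lambda>y. ker \<epsilon> 1 1 (x - y))"
    unfolding p One_nat_def by (rule ext, rule has_grad2_partial_deriv(2)[OF r'])
qed

section \<open>Commutator estimates for the mollified gradient\<close>

lemma cube_norm_le:
  assumes "y \<in> cube x \<epsilon>"
  shows "norm (x - y) \<le> 2 * \<epsilon>"
proof -
  have "norm (x - y) \<le> (\<Sum>i\<in>UNIV. \<bar>(x - y) $ i\<bar>)" by (rule norm_le_l1_cart)
  then show ?thesis using assms by (simp add: mem_cube UNIV_2)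
qed

text \<open>\<open>A\<close> bounds the oscillation of \<open>u\<close> at scale
  \<open>\<epsilon>\<close>. \<open>B\<close> bounds the bump and its first derivative: higher
  derivatives are never estimated, since second derivatives of the products enter only through the
  exact equation.\<close>

locale mollified_gradient =
  fixes \<Omega> W :: "(real^2) set" and lo hi :: "real^2" and V :: "real^2 \<Rightarrow> real" and u :: "real^2 \<Rightarrow> real^2"
    and \<epsilon> A B :: real
  assumes box: "\<Omega> \<subseteq> box lo hi"
    and grad_V: "\<And>x. has_grad2 V (u x $ 1) (u x $ 2) x" and cont_u: "continuous_on UNIV u"
    and weak: "\<And>\<phi>. \<phi> \<in> test_functions \<Omega> \<Longrightarrow>
      integral (cbox lo hi) (\<lambda>x. (u x $ 1 * u x $ 1) * partial_deriv 2 (partial_deriv 2 \<phi>) x)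
      + integral (cbox lo hi) (\<lambda>x. (u x $ 2 * u x $ 2) * partial_deriv 1 (partial_deriv 1 \<phi>) x)
      - 2 * integral (cbox lo hi) (\<lambda>x. (u x $ 1 * u x $ 2) * partial_deriv 2 (partial_deriv 1 \<phi>) x) = 0"
    and eps: "0 < \<epsilon>" and cube_W: "\<And>x. x \<in> W \<Longrightarrow> cube x \<epsilon> \<subseteq> \<Omega>"
    and osc: "\<And>x y. y \<in> cube x \<epsilon> \<Longrightarrow> norm (u x - u y) \<le> A" and A: "0 \<le> A"
    and B: "\<And>n t. n \<le> 1 \<Longrightarrow> \<bar>bumpd n t\<bar> \<le> B"
begin

definition cv :: "(real^2 \<Rightarrow> real) \<Rightarrow> nat \<Rightarrow> nat \<Rightarrow> real^2 \<Rightarrow> real" where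
  "cv f m n = conv lo hi f (ker \<epsilon> m n)"

text \<open>The area \<open>4 * \<epsilon>^2\<close> of the square times the supremum bound for the
  kernel; up to the factor \<open>\<epsilon> ^ (m + n)\<close> it bounds the integral of the
  absolute value of \<open>ker \<epsilon> m n\<close> for orders at most one.\<close>

definition kernel_const :: real where "kernel_const = 4 * B\<^sup>2 / bump_mass"

lemma cont_u_nth: "continuous_on UNIV (\<lambda>y. u y $ i)"
  by (intro continuous_intros cont_u)

lemma cont_uu: "continuous_on UNIV (\<lambda>y. u y $ i * u y $ j)"
  by (intro continuous_intros cont_u)

lemma cv_grad:
  assumes "continuous_on UNIV f"
  shows "has_grad2 (cv f m n) (cv f (Suc m) n x) (cv f m (Suc n) x) x"
  unfolding cv_def by (rule conv_has_grad2[OF assms ker_grad[OF eps] ker_cont ker_cont])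

lemma cv_cont: "continuous_on UNIV f \<Longrightarrow> continuous_on S (cv f m n)"
  unfolding cv_def by (rule conv_continuous[OF _ ker_cont])

lemma cube_box: "x \<in> W \<Longrightarrow> cube x \<epsilon> \<subseteq> box lo hi" "x \<in> W \<Longrightarrow> cube x \<epsilon> \<subseteq> cbox lo hi"
  using cube_W box box_subset_cbox[of lo hi] by blast+

text \<open>Both sides are the same derivative of the mollified \<open>V\<close>. This is the
  symmetry of the smooth Hessian.\<close>

lemma cv_swap: "x \<in> W \<Longrightarrow> cv (\<lambda>y. u y $ 2) (Suc m) n x = cv (\<lambda>y. u y $ 1) m (Suc n) x"
  unfolding cv_def
  using ker_by_parts[OF eps cube_box(1) grad_V cont_u_nth cont_u_nth] by metis

lemma kernel_const_nonneg: "0 \<le> kernel_const"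
  using bump_mass_pos by (simp add: kernel_const_def)

lemma ker_bound:
  assumes "m \<le> 1" "n \<le> 1"
  shows "\<bar>ker \<epsilon> m n z\<bar> \<le> B\<^sup>2 / (bump_mass * \<epsilon> ^ (m + n + 2))"
proof -
  have "\<bar>bumpd m (inverse \<epsilon> * z $ 1)\<bar> * \<bar>bumpd n (inverse \<epsilon> * z $ 2)\<bar> \<le> B * B"
  proof (rule mult_mono[OF B[OF assms(1)] B[OF assms(2)]])
    show "0 \<le> B" using B[of 0 0] by simp
  qed simp
  then show ?thesis using bump_mass_pos eps
    by (simp add: ker_def abs_mult power2_eq_square divide_right_mono)
qed

lemma cv_bound:
  assumes mn: "m \<le> 1" "n \<le> 1" and f: "continuous_on UNIV f" and x: "x \<in> W"
    and a: "\<And>y. y \<in> cube x \<epsilon> \<Longrightarrow> \<bar>f y\<bar> \<le> a" "0 \<le> a"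
  shows "\<bar>cv f m n x\<bar> \<le> a * kernel_const / \<epsilon> ^ (m + n)"
proof -
  have "\<bar>cv f m n x\<bar> \<le> a * (B\<^sup>2 / (bump_mass * \<epsilon> ^ (m + n + 2))) * (4 * \<epsilon>\<^sup>2)"
    unfolding cv_def
  proof (rule abs_conv_le[OF f ker_cont cube_box(2)[OF x] eps _ a ker_bound[OF mn]])
    show "ker \<epsilon> m n z = 0" if "\<not> (\<bar>z $ 1\<bar> \<le> \<epsilon> \<and> \<bar>z $ 2\<bar> \<le> \<epsilon>)" for z by (rule ker_zero[OF eps that])
    show "0 \<le> B\<^sup>2 / (bump_mass * \<epsilon> ^ (m + n + 2))" using bump_mass_pos eps by simp
  qed
  also have "\<dots> = a * kernel_const / \<epsilon> ^ (m + n)"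
    using eps bump_mass_pos by (simp add: kernel_const_def power_add power2_eq_square field_simps)
  finally show ?thesis .
qed

lemma cv_const: "x \<in> W \<Longrightarrow> cv (\<lambda>_. 1) 0 0 x = 1"
  "x \<in> W \<Longrightarrow> cv (\<lambda>_. 1) (Suc m) n x = 0" "x \<in> W \<Longrightarrow> cv (\<lambda>_. 1) m (Suc n) x = 0"
proof -
  assume x: "x \<in> W"
  show "cv (\<lambda>_. 1) 0 0 x = 1" unfolding cv_def by (rule ker_integral[OF eps cube_box(2)[OF x]])
  have z: "conv lo hi (\<lambda>_. 0) k x = 0" for k by (simp add: conv_def)
  note K = ker_by_parts[OF eps cube_box(1)[OF x] has_grad2_const continuous_on_const continuous_on_const]
  have K1: "conv lo hi (\<lambda>_. 0) (ker \<epsilon> m n) x = conv lo hi (\<lambda>_. 1) (ker \<epsilon> (Suc m) n) x" for m n by (rule K(1))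
  have K2: "conv lo hi (\<lambda>_. 0) (ker \<epsilon> m n) x = conv lo hi (\<lambda>_. 1) (ker \<epsilon> m (Suc n)) x" for m n by (rule K(2))
  show "cv (\<lambda>_. 1) (Suc m) n x = 0" unfolding cv_def K1[symmetric] by (rule z)
  show "cv (\<lambda>_. 1) m (Suc n) x = 0" unfolding cv_def K2[symmetric] by (rule z)
qed

lemma osc_nth: "y \<in> cube x \<epsilon> \<Longrightarrow> \<bar>u y $ i - u x $ i\<bar> \<le> A"
  using osc[of y x] component_le_norm_cart[of "u x - u y" i] by (simp add: abs_minus_commute)

lemma cv_error:
  assumes "x \<in> W"
  shows "\<bar>cv (\<lambda>y. u y $ i) 0 0 x - u x $ i\<bar> \<le> A * kernel_const"
proof -
  have "cv (\<lambda>y. u y $ i - u x $ i) 0 0 x = cv (\<lambda>y. u y $ i) 0 0 x - u x $ i * cv (\<lambda>_. 1) 0 0 x"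
    unfolding cv_def by (rule conv_diff_const[OF cont_u_nth ker_cont])
  moreover have "\<bar>cv (\<lambda>y. u y $ i - u x $ i) 0 0 x\<bar> \<le> A * kernel_const / \<epsilon> ^ (0 + 0)"
    by (rule cv_bound[OF _ _ _ assms osc_nth A]) (auto intro!: continuous_on_diff cont_u_nth)
  ultimately show ?thesis by (simp add: cv_const[OF assms])
qed

text \<open>Kernels of positive order have mean zero, so \<open>u\<close> may be replaced by its
  deviation from \<open>u x\<close>, of size \<open>A\<close>.\<close>

lemma cv_deriv_bound:
  assumes x: "x \<in> W" and mn: "m + n = 1"
  shows "\<bar>cv (\<lambda>y. u y $ i) m n x\<bar> \<le> A * kernel_const / \<epsilon>"
proof -
  have z: "cv (\<lambda>_. 1) m n x = 0" using mn cv_const[OF x] by (cases m) auto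
  have "cv (\<lambda>y. u y $ i - u x $ i) m n x = cv (\<lambda>y. u y $ i) m n x - u x $ i * cv (\<lambda>_. 1) m n x"
    unfolding cv_def by (rule conv_diff_const[OF cont_u_nth ker_cont])
  moreover have "\<bar>cv (\<lambda>y. u y $ i - u x $ i) m n x\<bar> \<le> A * kernel_const / \<epsilon> ^ (m + n)"
    by (rule cv_bound[OF _ _ _ x osc_nth A]) (use mn in \<open>auto intro!: continuous_on_diff cont_u_nth\<close>)
  ultimately show ?thesis by (simp add: z mn)
qed

text \<open>Expanding the product of the deviations of both factors from their values at
  \<open>x\<close>, the constant term drops out because the kernel has mean zero. What is left is
  quadratic in \<open>A\<close>, and this gain is what the method lives on.\<close>

lemma cv_commutator_bound:
  assumes x: "x \<in> W" and mn: "m + n = 1"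
  shows "\<bar>cv (\<lambda>y. u y $ i * u y $ j) m n x - u x $ j * cv (\<lambda>y. u y $ i) m n x
    - u x $ i * cv (\<lambda>y. u y $ j) m n x\<bar> \<le> A\<^sup>2 * kernel_const / \<epsilon>"
proof -
  have z: "cv (\<lambda>_. 1) m n x = 0" using mn cv_const[OF x] by (cases m) auto
  have "cv (\<lambda>y. (u y $ i - u x $ i) * (u y $ j - u x $ j)) m n x = cv (\<lambda>y. u y $ i * u y $ j) m n x
      - u x $ j * cv (\<lambda>y. u y $ i) m n x - u x $ i * cv (\<lambda>y. u y $ j) m n x + u x $ i * u x $ j * cv (\<lambda>_. 1) m n x"
    unfolding cv_def by (rule conv_diff_const_mult[OF cont_u_nth cont_u_nth ker_cont])
  moreover have "\<bar>cv (\<lambda>y. (u y $ i - u x $ i) * (u y $ j - u x $ j)) m n x\<bar> \<le> A\<^sup>2 * kernel_const / \<epsilon> ^ (m + n)"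
  proof (rule cv_bound[OF _ _ _ x])
    show "\<bar>(u y $ i - u x $ i) * (u y $ j - u x $ j)\<bar> \<le> A\<^sup>2" if "y \<in> cube x \<epsilon>" for y
      unfolding abs_mult power2_eq_square by (rule mult_mono[OF osc_nth[OF that] osc_nth[OF that] A]) simp
  qed (use mn in \<open>auto intro!: continuous_on_mult continuous_on_diff cont_u_nth\<close>)
  ultimately show ?thesis by (simp add: z mn)
qed

lemma weak_at:
  assumes "x \<in> W"
  shows "cv (\<lambda>y. u y $ 1 * u y $ 1) 0 (Suc (Suc 0)) x + cv (\<lambda>y. u y $ 2 * u y $ 2) (Suc (Suc 0)) 0 x
    - 2 * cv (\<lambda>y. u y $ 1 * u y $ 2) (Suc 0) (Suc 0) x = 0"
  using weak[OF ker_test_function(1)[OF eps cube_W[OF assms]]]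
  unfolding ker_test_function(2-4)[OF eps cube_W[OF assms]]
  by (simp add: cv_def conv_def numeral_2_eq_2)

text \<open>The determinant of the smooth Hessian is minus half the double curl of the squared
  smooth gradient, and the double curl of the mollified square vanishes by \<open>weak_at\<close>.
  Half the difference is the divergence of \<open>(r, s)\<close>, where \<open>r\<close> and
  \<open>s\<close> are first-order commutators between squaring and mollifying.\<close>

lemma mollified_det_approx:
  assumes \<eta>: "A * kernel_const \<le> \<eta>" "(A\<^sup>2 * kernel_const * (kernel_const + 1) / \<epsilon>) * (1 + A * kernel_const / \<epsilon>) \<le> \<eta>"
  shows "\<exists>P Q a b c a1 a2 b2 c2 M \<rho> r s r1 r2 s1 s2. det_approx W u \<eta> P Q a b c a1 a2 b2 c2 M \<rho> r s r1 r2 s1 s2"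
proof -
  define P Q a b c a1 a2 b2 c2 where f:
    "P = cv (\<lambda>y. u y $ 1) 0 0" "Q = cv (\<lambda>y. u y $ 2) 0 0" "a = cv (\<lambda>y. u y $ 1) (Suc 0) 0"
    "b = cv (\<lambda>y. u y $ 1) 0 (Suc 0)" "c = cv (\<lambda>y. u y $ 2) 0 (Suc 0)"
    "a1 = cv (\<lambda>y. u y $ 1) (Suc (Suc 0)) 0" "a2 = cv (\<lambda>y. u y $ 1) (Suc 0) (Suc 0)"
    "b2 = cv (\<lambda>y. u y $ 1) 0 (Suc (Suc 0))" "c2 = cv (\<lambda>y. u y $ 2) 0 (Suc (Suc 0))"
  define T11 T12 T22 where T: "T11 = cv (\<lambda>y. u y $ 1 * u y $ 1)" "T12 = cv (\<lambda>y. u y $ 1 * u y $ 2)"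
    "T22 = cv (\<lambda>y. u y $ 2 * u y $ 2)"
  define r r1 r2 s s1 s2 where rs:
    "r = (\<lambda>x. (- 1 / 2) * (Q x * b x - P x * c x - T22 (Suc 0) 0 x + T12 0 (Suc 0) x))"
    "r1 = (\<lambda>x. (- 1 / 2) * ((b x * b x + Q x * a2 x) - (a x * c x + P x * b2 x) - T22 (Suc (Suc 0)) 0 x + T12 (Suc 0) (Suc 0) x))"
    "r2 = (\<lambda>x. (- 1 / 2) * ((c x * b x + Q x * b2 x) - (b x * c x + P x * c2 x) - T22 (Suc 0) (Suc 0) x + T12 0 (Suc (Suc 0)) x))"
    "s = (\<lambda>x. (- 1 / 2) * (P x * b x - a x * Q x - T11 0 (Suc 0) x + T12 (Suc 0) 0 x))"
    "s1 = (\<lambda>x. (- 1 / 2) * ((a x * b x + P x * a2 x) - (a1 x * Q x + a x * b x) - T11 (Suc 0) (Suc 0) x + T12 (Suc (Suc 0)) 0 x))"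
    "s2 = (\<lambda>x. (- 1 / 2) * ((b x * b x + P x * b2 x) - (a2 x * Q x + a x * c x) - T11 0 (Suc (Suc 0)) x + T12 (Suc 0) (Suc 0) x))"
  \<comment> \<open>\<open>\<rho>\<close> is the sum of \<open>A * kernel_const * M\<close>, from
    the errors of \<open>P\<close> and \<open>Q\<close> times the Hessian bound, and
    \<open>A\<^sup>2 * kernel_const / \<epsilon>\<close>, from the commutators.\<close>
  define M \<rho> where M: "M = A * kernel_const / \<epsilon>" "\<rho> = A\<^sup>2 * kernel_const * (kernel_const + 1) / \<epsilon>"
  note g = cv_grad[OF cont_u_nth] and gT = cv_grad[OF cont_uu]
  have gP: "has_grad2 P (a x) (b x) x" and ga: "has_grad2 a (a1 x) (a2 x) x" for x
    unfolding f by (rule g)+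
  have gQ: "has_grad2 Q (b x) (c x) x" if "x \<in> W" for x
    using g[of 2 0 0 x] unfolding cv_swap[OF that] f .
  have gb: "has_grad2 b (a2 x) (b2 x) x" for x
    unfolding f by (rule g)
  have gc: "has_grad2 c (b2 x) (c2 x) x" if "x \<in> W" for x
    using g[of 2 0 "Suc 0" x] unfolding cv_swap[OF that] f .
  have cont: "continuous_on S P" "continuous_on S Q" "continuous_on S a" "continuous_on S b" "continuous_on S c"
    "continuous_on S a1" "continuous_on S a2" "continuous_on S b2" "continuous_on S c2" for S
    unfolding f by (rule cv_cont[OF cont_u_nth])+
  have contT: "continuous_on S (T11 i j)" "continuous_on S (T12 i j)" "continuous_on S (T22 i j)" for S i j
    unfolding T by (rule cv_cont[OF cont_uu])+
  have gT': "has_grad2 (T11 i j) (T11 (Suc i) j x) (T11 i (Suc j) x) x"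
    "has_grad2 (T12 i j) (T12 (Suc i) j x) (T12 i (Suc j) x) x"
    "has_grad2 (T22 i j) (T22 (Suc i) j x) (T22 i (Suc j) x) x" for i j x
    unfolding T by (rule gT)+
  have M0: "0 \<le> M" "0 \<le> \<rho>" using A kernel_const_nonneg eps by (simp_all add: M)
  have abc: "\<bar>a x\<bar> \<le> M" "\<bar>b x\<bar> \<le> M" "\<bar>c x\<bar> \<le> M" if "x \<in> W" for x
    unfolding f M by (rule cv_deriv_bound[OF that], simp)+
  have PQ: "\<bar>P x - u x $ 1\<bar> \<le> A * kernel_const" "\<bar>Q x - u x $ 2\<bar> \<le> A * kernel_const" if "x \<in> W" for x
    unfolding f by (rule cv_error[OF that])+
  have tri: "\<bar>(- 1 / 2) * (p - q - e + f)\<bar> \<le> k + l"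
    if "\<bar>p\<bar> \<le> k" "\<bar>q\<bar> \<le> k" "\<bar>e\<bar> \<le> l" "\<bar>f\<bar> \<le> l" for p q e f k l :: real
    using abs_le_D1[OF that(1)] abs_le_D2[OF that(1)] abs_le_D1[OF that(2)] abs_le_D2[OF that(2)]
      abs_le_D1[OF that(3)] abs_le_D2[OF that(3)] abs_le_D1[OF that(4)] abs_le_D2[OF that(4)]
    by (intro abs_leI) (simp_all add: field_simps)
  have four: "\<bar>(- 1 / 2) * (X * Y - Z * Y' - E + E')\<bar> \<le> \<rho>"
    if "\<bar>X\<bar> \<le> A * kernel_const" "\<bar>Y\<bar> \<le> M" "\<bar>Z\<bar> \<le> A * kernel_const" "\<bar>Y'\<bar> \<le> M" "\<bar>E\<bar> \<le> A\<^sup>2 * kernel_const / \<epsilon>" "\<bar>E'\<bar> \<le> A\<^sup>2 * kernel_const / \<epsilon>"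
    for X Y Z Y' E E' :: real
  proof -
    have AD: "0 \<le> A * kernel_const" using A kernel_const_nonneg by simp
    have "\<bar>X * Y\<bar> \<le> A * kernel_const * M" "\<bar>Z * Y'\<bar> \<le> A * kernel_const * M"
      unfolding abs_mult by (rule mult_mono[OF that(1,2) AD], simp, rule mult_mono[OF that(3,4) AD], simp)
    then have "\<bar>(- 1 / 2) * (X * Y - Z * Y' - E + E')\<bar> \<le> A * kernel_const * M + A\<^sup>2 * kernel_const / \<epsilon>"
      using that(5,6) by (rule tri)
    also have "\<dots> = \<rho>" using eps by (simp add: M field_simps power2_eq_square)
    finally show ?thesis .
  qed
  have "det_approx W u \<eta> P Q a b c a1 a2 b2 c2 M \<rho> r s r1 r2 s1 s2"
  proof
    fix x assume x: "x \<in> W"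
    show "\<bar>P x - u x $ 1\<bar> \<le> \<eta>" "\<bar>Q x - u x $ 2\<bar> \<le> \<eta>" using PQ[OF x] \<eta>(1) by linarith+
    show "has_grad2 P (a x) (b x) x" by (rule gP)
    show "has_grad2 Q (b x) (c x) x" by (rule gQ[OF x])
    show "has_grad2 a (a1 x) (a2 x) x" by (rule ga)
    show "has_grad2 b (a2 x) (b2 x) x" by (rule gb)
    show "has_grad2 c (b2 x) (c2 x) x" by (rule gc[OF x])
    show "has_grad2 r (r1 x) (r2 x) x" unfolding rs
      by (rule has_grad2_cmult[OF has_grad2_add[OF has_grad2_diff[OF has_grad2_diff[OF
            has_grad2_mult[OF gQ[OF x] gb] has_grad2_mult[OF gP gc[OF x]]] gT'(3)] gT'(2)]])
    show "has_grad2 s (s1 x) (s2 x) x" unfolding rs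
      by (rule has_grad2_cmult[OF has_grad2_add[OF has_grad2_diff[OF has_grad2_diff[OF
            has_grad2_mult[OF gP gb] has_grad2_mult[OF ga gQ[OF x]]] gT'(1)] gT'(2)]])
    show "r1 x + s2 x = a x * c x - (b x)\<^sup>2"
      using weak_at[OF x] unfolding rs T by (simp add: power2_eq_square field_simps)
    show "\<bar>a x\<bar> \<le> M" "\<bar>b x\<bar> \<le> M" "\<bar>c x\<bar> \<le> M" by (rule abc[OF x])+
    have sw: "cv (\<lambda>y. u y $ 2) (Suc 0) 0 x = b x" unfolding f by (rule cv_swap[OF x])
    have E: "\<bar>T22 (Suc 0) 0 x - u x $ 2 * b x - u x $ 2 * b x\<bar> \<le> A\<^sup>2 * kernel_const / \<epsilon>"
      "\<bar>T12 0 (Suc 0) x - u x $ 2 * b x - u x $ 1 * c x\<bar> \<le> A\<^sup>2 * kernel_const / \<epsilon>"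
      "\<bar>T11 0 (Suc 0) x - u x $ 1 * b x - u x $ 1 * b x\<bar> \<le> A\<^sup>2 * kernel_const / \<epsilon>"
      "\<bar>T12 (Suc 0) 0 x - u x $ 2 * a x - u x $ 1 * b x\<bar> \<le> A\<^sup>2 * kernel_const / \<epsilon>"
      using cv_commutator_bound[OF x, of "Suc 0" 0 2 2] cv_commutator_bound[OF x, of 0 "Suc 0" 1 2]
        cv_commutator_bound[OF x, of 0 "Suc 0" 1 1] cv_commutator_bound[OF x, of "Suc 0" 0 1 2]
      unfolding T sw by (simp_all add: f)
    \<comment> \<open>Recentring all factors at \<open>u x\<close>: the added terms cancel, and
      every summand becomes small. The same is done for \<open>s\<close>.\<close>
    have "r x = (- 1 / 2) * ((Q x - u x $ 2) * b x - (P x - u x $ 1) * c x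
        - (T22 (Suc 0) 0 x - u x $ 2 * b x - u x $ 2 * b x) + (T12 0 (Suc 0) x - u x $ 2 * b x - u x $ 1 * c x))"
      unfolding rs by (simp add: algebra_simps)
    then show "\<bar>r x\<bar> \<le> \<rho>" using four[OF PQ(2)[OF x] abc(2)[OF x] PQ(1)[OF x] abc(3)[OF x] E(1,2)] by simp
    have "s x = (- 1 / 2) * ((P x - u x $ 1) * b x - (Q x - u x $ 2) * a x
        - (T11 0 (Suc 0) x - u x $ 1 * b x - u x $ 1 * b x) + (T12 (Suc 0) 0 x - u x $ 2 * a x - u x $ 1 * b x))"
      unfolding rs by (simp add: algebra_simps)
    then show "\<bar>s x\<bar> \<le> \<rho>" using four[OF PQ(1)[OF x] abc(2)[OF x] PQ(2)[OF x] abc(1)[OF x] E(3,4)] by simp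
  next
    show "continuous_on W a1" "continuous_on W a2" "continuous_on W b2" "continuous_on W c2" by (rule cont)+
    show "continuous_on W r1" "continuous_on W r2" "continuous_on W s1" "continuous_on W s2"
      unfolding rs by (intro continuous_on_mult continuous_on_add continuous_on_diff continuous_on_const cont contT)+
    show "\<rho> * (1 + M) \<le> \<eta>" using \<eta>(2) by (simp add: M)
    show "0 \<le> \<rho>" "0 \<le> M" by (rule M0)+
  qed
  then show ?thesis by blast
qed

end

text \<open>With oscillation \<open>C t\<^sup>\<alpha>\<close> at scale \<open>t\<close>, the worst error of the approximation is of order
  \<open>t\<^sup>3\<^sup>\<alpha> / t\<^sup>2\<close>; this is where \<open>\<alpha> > 2/3\<close> enters.\<close>

lemma holder_det_approximable:
  assumes \<Omega>: "open \<Omega>" "\<Omega> \<subseteq> box lo hi" and V: "\<And>x. has_grad2 V (u x $ 1) (u x $ 2) x" and uc: "continuous_on UNIV u"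
    and holder: "\<And>x y. norm (u x - u y) \<le> C * norm (x - y) powr \<alpha>" and "0 \<le> C" and \<alpha>: "2 / 3 < \<alpha>"
    and weak: "\<And>\<phi>. \<phi> \<in> test_functions \<Omega> \<Longrightarrow>
      integral (cbox lo hi) (\<lambda>x. (u x $ 1 * u x $ 1) * partial_deriv 2 (partial_deriv 2 \<phi>) x)
      + integral (cbox lo hi) (\<lambda>x. (u x $ 2 * u x $ 2) * partial_deriv 1 (partial_deriv 1 \<phi>) x)
      - 2 * integral (cbox lo hi) (\<lambda>x. (u x $ 1 * u x $ 2) * partial_deriv 2 (partial_deriv 1 \<phi>) x) = 0"
    and W: "compact W" "W \<subseteq> \<Omega>"
  shows "det_approximable W u"
  unfolding det_approximable_def
proof (intro allI impI)
  fix \<eta> :: real assume "0 < \<eta>"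
  have "\<exists>d>0. \<forall>x\<in>W. \<forall>y\<in>- \<Omega>. d \<le> dist x y"
    by (rule separate_compact_closed[OF W(1)]) (use \<Omega>(1) W(2) in auto)
  then obtain d where d: "0 < d" "\<And>x y. x \<in> W \<Longrightarrow> y \<notin> \<Omega> \<Longrightarrow> d \<le> dist x y" by auto
  obtain B0 B1 where B01: "\<And>t. \<bar>bumpd 0 t\<bar> \<le> B0" "\<And>t. \<bar>bumpd 1 t\<bar> \<le> B1"
    using bumpd_bounded[of 0] bumpd_bounded[of 1] by blast
  define B where "B = max B0 B1"
  have B: "\<bar>bumpd n t\<bar> \<le> B" if "n \<le> 1" for n t
  proof -
    have "n = 0 \<or> n = 1" using that by linarith
    then show ?thesis using B01(1)[of t] B01(2)[of t] by (auto simp: B_def)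
  qed
  define D where "D = 4 * B\<^sup>2 / bump_mass"
  \<comment> \<open>The oscillation at scale \<open>\<epsilon>\<close>; a point of
    \<open>cube x \<epsilon>\<close> has distance at most \<open>2 * \<epsilon>\<close> from
    \<open>x\<close>.\<close>
  define E where "E \<epsilon> = C * (2 * \<epsilon>) powr \<alpha>" for \<epsilon>
  have lim: "((\<lambda>\<epsilon>. (2 * \<epsilon>) powr \<beta>) \<longlongrightarrow> 0) (at_right 0)" if "0 < \<beta>" for \<beta> :: real
  proof (rule tendsto_zero_powrI[OF _ tendsto_const _ that])
    have "((\<lambda>\<epsilon>::real. 2 * \<epsilon>) \<longlongrightarrow> 2 * 0) (at_right 0)" by (intro tendsto_intros)
    then show "((\<lambda>\<epsilon>::real. 2 * \<epsilon>) \<longlongrightarrow> 0) (at_right 0)" by simp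
    show "\<forall>\<^sub>F \<epsilon>::real in at_right 0. 0 \<le> 2 * \<epsilon>" using eventually_at_right_less by (rule eventually_mono) simp
  qed
  have e: "(E \<epsilon>)\<^sup>2 * D * (D + 1) / \<epsilon> * (1 + E \<epsilon> * D / \<epsilon>)
      = 2 * C\<^sup>2 * D * (D + 1) * (2 * \<epsilon>) powr (2 * \<alpha> - 1) + 4 * C ^ 3 * D\<^sup>2 * (D + 1) * (2 * \<epsilon>) powr (3 * \<alpha> - 2)"
    if "0 < \<epsilon>" for \<epsilon>
  proof -
    define p where "p = (2 * \<epsilon>) powr \<alpha>"
    have p: "(2 * \<epsilon>) powr (2 * \<alpha> - 1) = p\<^sup>2 / (2 * \<epsilon>)" "(2 * \<epsilon>) powr (3 * \<alpha> - 2) = p ^ 3 / (2 * \<epsilon>)\<^sup>2"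
      using that by (simp_all add: p_def powr_diff powr_power mult.commute)
    have E: "E \<epsilon> = C * p" by (simp add: E_def p_def)
    show ?thesis using that unfolding p E
      by (simp add: field_simps power2_eq_square power3_eq_cube)
  qed
  have l1: "((\<lambda>\<epsilon>. D * C * (2 * \<epsilon>) powr \<alpha>) \<longlongrightarrow> D * C * 0) (at_right 0)"
    using \<alpha> by (intro tendsto_mult tendsto_const lim) simp
  have l2: "((\<lambda>\<epsilon>. 2 * C\<^sup>2 * D * (D + 1) * (2 * \<epsilon>) powr (2 * \<alpha> - 1) + 4 * C ^ 3 * D\<^sup>2 * (D + 1) * (2 * \<epsilon>) powr (3 * \<alpha> - 2))
      \<longlongrightarrow> 2 * C\<^sup>2 * D * (D + 1) * 0 + 4 * C ^ 3 * D\<^sup>2 * (D + 1) * 0) (at_right 0)"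
    using \<alpha> by (intro tendsto_add tendsto_mult[OF tendsto_const] lim) simp_all
  have "\<forall>\<^sub>F \<epsilon> in at_right 0. \<epsilon> < d / 2"
    using d(1) unfolding eventually_at_right_field by (intro exI[of _ "d / 2"]) auto
  moreover have "\<forall>\<^sub>F \<epsilon> in at_right 0. D * C * (2 * \<epsilon>) powr \<alpha> < \<eta>"
    by (rule order_tendstoD(2)[OF l1]) (use \<open>0 < \<eta>\<close> in simp)
  moreover have "\<forall>\<^sub>F \<epsilon> in at_right 0. 2 * C\<^sup>2 * D * (D + 1) * (2 * \<epsilon>) powr (2 * \<alpha> - 1)
      + 4 * C ^ 3 * D\<^sup>2 * (D + 1) * (2 * \<epsilon>) powr (3 * \<alpha> - 2) < \<eta>"
    by (rule order_tendstoD(2)[OF l2]) (use \<open>0 < \<eta>\<close> in simp)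
  ultimately have "\<forall>\<^sub>F \<epsilon> in at_right 0. 0 < \<epsilon> \<and> \<epsilon> < d / 2 \<and> D * C * (2 * \<epsilon>) powr \<alpha> < \<eta> \<and>
      2 * C\<^sup>2 * D * (D + 1) * (2 * \<epsilon>) powr (2 * \<alpha> - 1) + 4 * C ^ 3 * D\<^sup>2 * (D + 1) * (2 * \<epsilon>) powr (3 * \<alpha> - 2) < \<eta>"
    using eventually_at_right_less[of "0::real"] by (intro eventually_conj)
  then obtain \<epsilon> where \<epsilon>: "0 < \<epsilon>" "\<epsilon> < d / 2" "D * C * (2 * \<epsilon>) powr \<alpha> < \<eta>"
      "2 * C\<^sup>2 * D * (D + 1) * (2 * \<epsilon>) powr (2 * \<alpha> - 1) + 4 * C ^ 3 * D\<^sup>2 * (D + 1) * (2 * \<epsilon>) powr (3 * \<alpha> - 2) < \<eta>"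
    using eventually_happens'[OF trivial_limit_at_right_real] by blast
  interpret mollified_gradient \<Omega> W lo hi V u \<epsilon> "E \<epsilon>" B
  proof
    show "cube x \<epsilon> \<subseteq> \<Omega>" if "x \<in> W" for x
    proof
      fix y assume "y \<in> cube x \<epsilon>"
      then have "dist x y \<le> 2 * \<epsilon>" using cube_norm_le by (simp add: dist_norm)
      then show "y \<in> \<Omega>" using d(2)[OF that, of y] \<epsilon>(2) by fastforce
    qed
    show "norm (u x - u y) \<le> E \<epsilon>" if "y \<in> cube x \<epsilon>" for x y
    proof -
      have "norm (x - y) powr \<alpha> \<le> (2 * \<epsilon>) powr \<alpha>"
        using \<alpha> cube_norm_le[OF that] by (intro powr_mono2) auto
      then have "C * norm (x - y) powr \<alpha> \<le> E \<epsilon>" unfolding E_def using \<open>0 \<le> C\<close> by (rule mult_left_mono)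
      then show ?thesis using holder[of x y] by linarith
    qed
    show "0 \<le> E \<epsilon>" using \<open>0 \<le> C\<close> by (simp add: E_def)
  qed (use \<Omega>(2) V uc weak \<epsilon>(1) B in auto)
  have kernel_const: "kernel_const = D" by (simp add: kernel_const_def D_def)
  show "\<exists>P Q a b c a1 a2 b2 c2 M \<rho> r s r1 r2 s1 s2. det_approx W u \<eta> P Q a b c a1 a2 b2 c2 M \<rho> r s r1 r2 s1 s2"
  proof (rule mollified_det_approx)
    show "E \<epsilon> * kernel_const \<le> \<eta>" using \<epsilon>(3) by (simp add: kernel_const E_def mult_ac)
    show "(E \<epsilon>)\<^sup>2 * kernel_const * (kernel_const + 1) / \<epsilon> * (1 + E \<epsilon> * kernel_const / \<epsilon>) \<le> \<eta>"
      using \<epsilon>(4) unfolding kernel_const e[OF \<epsilon>(1)] by simp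
  qed
qed

section \<open>Developability\<close>

lemma holder_continuous_on:
  fixes u :: "real^2 \<Rightarrow> real^2"
  assumes "\<And>x y. norm (u x - u y) \<le> C * norm (x - y) powr \<alpha>" "0 < \<alpha>"
  shows "continuous_on UNIV u"
  unfolding continuous_on_def
proof
  fix x :: "real^2"
  have "((\<lambda>y. norm (y - x)) \<longlongrightarrow> 0) (at x)"
    by (intro tendsto_norm_zero LIM_zero tendsto_ident_at)
  then have "((\<lambda>y. norm (y - x) powr \<alpha>) \<longlongrightarrow> 0) (at x)"
    by (rule tendsto_zero_powrI[OF _ tendsto_const]) (simp_all add: assms(2))
  then have "((\<lambda>y. C * norm (y - x) powr \<alpha>) \<longlongrightarrow> 0) (at x)"
    by (rule tendsto_mult_right_zero)
  then have "((\<lambda>y. u y - u x) \<longlongrightarrow> 0) (at x)"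
    by (rule Lim_null_comparison[rotated]) (simp add: assms(1))
  then show "(u \<longlongrightarrow> u x) (at x within UNIV)" by (simp add: LIM_zero_cancel)
qed

lemma constant_gradient_affine:
  assumes "convex S" "S \<noteq> {}" and g: "\<And>x. x \<in> S \<Longrightarrow> has_grad2 V (k $ 1) (k $ 2) x"
  shows "\<exists>b. \<forall>y\<in>S. V y = k \<bullet> y + b"
proof -
  have "\<exists>c. \<forall>x\<in>S. V x - (k $ 1 * x $ 1 + k $ 2 * x $ 2) = c"
  proof (rule has_derivative_zero_constant[OF assms(1)])
    fix x assume "x \<in> S"
    from has_grad2_diff[OF g[OF this] has_grad2_add[OF has_grad2_cmult[OF has_grad2_coord1, of "k $ 1"]
        has_grad2_cmult[OF has_grad2_coord2, of "k $ 2"]]]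
    have "has_grad2 (\<lambda>x. V x - (k $ 1 * x $ 1 + k $ 2 * x $ 2)) 0 0 x" by simp
    then show "((\<lambda>x. V x - (k $ 1 * x $ 1 + k $ 2 * x $ 2)) has_derivative (\<lambda>_. 0)) (at x within S)"
      by (simp add: has_grad2_def has_derivative_at_withinI)
  qed
  then obtain c where c: "\<And>x. x \<in> S \<Longrightarrow> V x - (k $ 1 * x $ 1 + k $ 2 * x $ 2) = c" by blast
  have "V y = k \<bullet> y + c" if "y \<in> S" for y using c[OF that] by (simp add: inner_real2)
  then show ?thesis by blast
qed

theorem theorem1p3:
  fixes \<Omega> :: "(real^2) set" and \<alpha> :: real and v :: "real^2 \<Rightarrow> real"
  assumes "open \<Omega>" and "connected \<Omega>" and "\<Omega> \<noteq> {}" and "bounded \<Omega>"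
    and "2/3 < \<alpha>" and "\<alpha> < 1"
    and "v \<in> C1_holder_closure \<alpha> \<Omega>"
    and "distr_eq \<Omega> (very_weak_det_hessian \<Omega> v) (\<lambda>_. 0)"
  shows "developable_on \<Omega> v"
proof -
  obtain V where V: "V \<in> C1_holder \<alpha>" and v: "\<And>x. x \<in> \<Omega> \<Longrightarrow> v x = V x"
    using assms(7) unfolding C1_holder_closure_def by blast
  define u where "u = grad V"
  have dV: "V differentiable (at x)" for x using V by (simp add: C1_holder_def)
  have gV: "has_grad2 V (u x $ 1) (u x $ 2) x" for x
    using differentiable_has_grad2[OF dV] by (simp add: u_def grad_def)
  obtain C where C: "\<And>x y. norm (u x - u y) \<le> C * norm (x - y) powr \<alpha>"
    using V unfolding C1_holder_def u_def by blast
  have C': "norm (u x - u y) \<le> \<bar>C\<bar> * norm (x - y) powr \<alpha>" for x y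
    using C[of x y] mult_right_mono[OF abs_ge_self[of C], of "norm (x - y) powr \<alpha>"] by simp
  have uc: "continuous_on UNIV u"
    by (rule holder_continuous_on[OF C]) (use assms(5) in simp)
  obtain lo hi where box: "\<Omega> \<subseteq> box lo hi" by (rule bounded_subset_box[OF assms(4)])
  interpret flat_gradient \<Omega> V u
  proof
    show "det_approximable W u" if "compact W" "W \<subseteq> \<Omega>" for W
      by (rule holder_det_approximable[OF assms(1) box gV uc C' abs_ge_zero assms(5) _ that])
         (rule weak_det_integral_zero[OF assms(1) box gV uc v assms(8)])
  qed (use gV uc in auto)
  have gv: "grad v x = u x" if "x \<in> \<Omega>" for x
  proof -
    have "has_grad2 v (u x $ 1) (u x $ 2) x"
      by (rule has_grad2_cong[OF gV assms(1) that]) (simp add: v)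
    from has_grad2_partial_deriv[OF this] show ?thesis by (simp add: grad_def vec_eq_iff forall_2)
  qed
  show ?thesis unfolding developable_on_def
  proof
    fix x assume x: "x \<in> \<Omega>"
    show "affine_near v \<Omega> x \<or> (\<exists>p q. p \<in> frontier \<Omega> \<and> q \<in> frontier \<Omega> \<and> x \<in> open_segment p q \<and>
        open_segment p q \<subseteq> \<Omega> \<and> grad v constant_on open_segment p q)"
    \<comment> \<open>Interior points of the level set of \<open>u\<close> give the affine
      alternative, all others a segment. The level set is that of the extension on the whole plane,
      so the neighbourhood is intersected with \<open>\<Omega>\<close>.\<close>
    proof (cases "x \<in> interior {z. u z = u x}")
      case True
      then obtain e where e: "0 < e" "ball x e \<subseteq> interior {z. u z = u x} \<inter> \<Omega>"
        using openE[OF open_Int[OF open_interior assms(1)], of x] x by blast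
      then have s: "ball x e \<subseteq> \<Omega>" and k: "\<And>z. z \<in> ball x e \<Longrightarrow> u z = u x"
        using interior_subset[of "{z. u z = u x}"] by blast+
      have "\<exists>b. \<forall>y\<in>ball x e. V y = u x \<bullet> y + b"
      proof (rule constant_gradient_affine[OF convex_ball])
        show "has_grad2 V (u x $ 1) (u x $ 2) z" if "z \<in> ball x e" for z
          using gV[of z] unfolding k[OF that] .
      qed (use e(1) in simp)
      then obtain b where b: "\<And>y. y \<in> ball x e \<Longrightarrow> V y = u x \<bullet> y + b" by blast
      have "\<forall>y\<in>ball x e. v y = u x \<bullet> y + b" using b v s by auto
      then have "affine_near v \<Omega> x"
        unfolding affine_near_def using e(1) s by (intro exI[of _ "ball x e"]) auto
      then show ?thesis ..
    next
      case False
      obtain p q where pq: "p \<in> frontier \<Omega>" "q \<in> frontier \<Omega>" "x \<in> open_segment p q" "open_segment p q \<subseteq> \<Omega>"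
        "\<And>z. z \<in> open_segment p q \<Longrightarrow> u z = u x"
        by (rule interior_or_segment[OF assms(1,4) x False]) (rule that)
      have "grad v constant_on open_segment p q"
        unfolding constant_on_def using gv pq(4,5) by (metis subsetD)
      then show ?thesis using pq(1-4) by blast
    qed
  qed
qed

end
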